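(* Let the units be the individual data sources, let the sources be independent, assume (M) and (CC), and let $\Psi=\Psi_{0,u}$. Suppose $s_k=\{k\}$ for every $k\in[K]$. Then $\chi^*_{fwer}$ is asymptotically optimal as $\gamma,\delta\to0$ under every $\mathsf P\in\mathcal P_\Psi$, i.e. $\mathsf E_{\mathsf P}[T^*_{fwer}]\sim\inf\{\mathsf E_{\mathsf P}[T]:(T,D)\in\mathcal E_\Psi(\gamma,\delta)\}$, in each of the following cases: (i) $u=K$ and $s'_k=\{k\}$ for every $k\in[K]$, in which case $T^*_{fwer}=\inf\{n\in\mathbb N:\Lambda_k(n)\notin(1/A,B)\ \forall k\in[K]\}$; (ii) $u<K$ and $s'_k=[K]$ for every $k\in[K]$, in which case $T^*_{fwer}=T_0\wedge T_1\wedge T_2\wedge T_3\wedge T_4$, where \begin{align*} T_0&=\inf\{n:\Lambda_{(1)}(n)\le1/A\},\\ T_1&=\inf\{n:\Lambda_{(1)}(n)\ge B,\ \Lambda_{(2)}(n)\le\min\{1/A,\Lambda_{(1)}(n)/B\}\},\\ T_2&=\inf\{n:p(n)\in(1,u),\ \Lambda_{(1)}(n)\ge B,\ \Lambda_k(n)\notin(1/A,B)\ \forall k\in[K]\},\\ T_3&=\inf\{n:p(n)=u,\ \Lambda_{(u)}(n)\ge\max\{B,A\Lambda_{(u+1)}(n)\}\},\\ T_4&=\inf\{n:p(n)>u,\ \Lambda_{(1)}(n)\ge B,\ \Lambda_{(u)}(n)\ge\Lambda_{(u+1)}(n)\max\{A,B\}\}. \end{align*}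
   Context: Setting. $K$ data sources, $[K]=\{1,\dots,K\}$; $X_n^k$ is the observation of source $k$ at time $n\in\mathbb N$; for $s\subseteq[K]$, $X_n^s=\{X_n^k:k\in s\}$, $X^s=\{X^s_n\}_{n}$, $\mathcal F_n^s=\sigma(X_1^s,\dots,X_n^s)$ (superscript omitted for $s=[K]$, written $k$ for $s=\{k\}$). $\mathcal P$ is a finite family of distributions of $X$, $\mathsf P^s$ the law of $X^s$ under $\mathsf P$, $\mathcal Q^s=\{\mathsf P^s:\mathsf P\in\mathcal Q\}$. The units are the singletons $\{k\}$, $k\in[K]$ (identified with $k$). For each $k$, $\mathcal H^k,\mathcal G^k$ are nonempty disjoint subfamilies of $\mathcal P^k$; $\mathcal A(\mathsf P)=\{k:\mathsf P^k\in\mathcal G^k\}$. $\Psi=\Psi_{0,u}=\{A\subseteq[K]:|A|\le u\}$, where $u\le K$ is an a priori upper bound on the number of signals. $\mathcal P_\Psi=\{\mathsf P\in\mathcal P:\mathsf P^k\in\mathcal H^k\cup\mathcal G^k\ \forall k,\ \mathcal A(\mathsf P)\in\Psi\}$, $\mathcal H_0=\{\mathsf P\in\mathcal P:\mathsf P^k\in\mathcal H^k\ \forall k\}$, $\mathcal H_{\Psi,k}=\{\mathsf P\in\mathcal P_\Psi\setminus\mathcal H_0:k\notin\mathcal A(\mathsf P)\}$, $\mathcal G_{\Psi,k}=\{\mathsf P\in\mathcal P_\Psi:k\in\mathcal A(\mathsf P)\}$. Independence: $\mathsf P=\mathsf P^1\otimes\cdots\otimes\mathsf P^K$ for every $\mathsf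 P\in\mathcal P_\Psi$. Standing assumption: for $\mathsf P\in\mathcal G_{\Psi,k}\cup\mathcal H_0$, $\mathsf Q\in\mathcal H_{\Psi,k}\cup\mathcal H_0$, $k\in s\subseteq[K]$, $n\in\mathbb N$, $\mathsf P^s,\mathsf Q^s$ are mutually absolutely continuous on $\mathcal F_n^s$; $\Lambda_n(\mathsf P^s,\mathsf Q^s)=\frac{d\mathsf P^s}{d\mathsf Q^s}(\mathcal F_n^s)$, $Z_n=\log\Lambda_n$. Conditions (M) and (CC): for every $k\in[K]$, $\mathsf P\in\mathcal G_{\Psi,k}$, $\mathsf Q\in\mathcal H_{\Psi,k}\cup\mathcal H_0$, $k\in s\subseteq[K]$ there are positive numbers $\mathcal I(\mathsf P^s,\mathsf Q^s)$, $\mathcal I(\mathsf Q^s,\mathsf P^s)$ such that: (M) as $n\to\infty$, $\mathsf P(\max_{1\le m\le n}Z_m(\mathsf P^s,\mathsf Q^s)\ge n\rho)\to0$ for all $\rho>\mathcal I(\mathsf P^s,\mathsf Q^s)$ and $\mathsf Q(\max_{1\le m\le n}Z_m(\mathsf Q^s,\mathsf P^s)\ge n\rho)\to0$ for all $\rho>\mathcal I(\mathsf Q^s,\mathsf P^s)$; (CC) $\sum_n\mathsf P(Z_n(\mathsf P^s,\mathsf Q^s)<n\rho)<\infty$ for all $\rho<\mathcal I(\mathsf P^s,\mathsf Q^s)$ and $\sum_n\mathsf Q(Z_n(\mathsf Q^s,\mathsf P^s)<n\rho)<\infty$ for all $\rho<\mathcal I(\mathsf Q^s,\mathsf P^s)$.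 Statistics, for detection and isolation subsystems $s_k,s'_k\ni k$: $$\Lambda_{k,\rm det}(n)=\frac{\max\{\Lambda_n(\mathsf P,\mathsf P_0):\mathsf P\in\mathcal G_{\Psi,k}^{s_k}\}}{\max\{\Lambda_n(\mathsf P,\mathsf P_0):\mathsf P\in\mathcal H_0^{s_k}\}},\quad \Lambda_{k,\rm iso}(n)=\frac{\max\{\Lambda_n(\mathsf P,\mathsf P_0'):\mathsf P\in\mathcal G_{\Psi,k}^{s'_k}\}}{\max\{\Lambda_n(\mathsf P,\mathsf P_0'):\mathsf P\in\mathcal H_{\Psi,k}^{s'_k}\}},$$ with arbitrary $\mathsf P_0\in\mathcal H_0^{s_k}$, $\mathsf P_0'\in\mathcal H_0^{s'_k}$ (families over which maxima are taken are tacitly nonempty; for subsystem $\{k\}$ the statistic is the local statistic $\Lambda_k(n)=\max\{\Lambda_n(\mathsf P,\mathsf P_0):\mathsf P\in\mathcal G^k\}/\max\{\Lambda_n(\mathsf P,\mathsf P_0):\mathsf P\in\mathcal H^k\}$, $\mathsf P_0\in\mathcal H_0^k$ arbitrary). $D_{\rm iso}(n)=\{k:\Lambda_{k,\rm iso}(n)>1\}$; $\Lambda_{(1)}(n)\ge\dots\ge\Lambda_{(K)}(n)$ are the ordered local statistics, $p(n)=|\{k:\Lambda_k(n)>1\}|$. Test $\chi^*_{fwer}=(T^*_{fwer},D^*_{fwer})$ with common thresholds $A,B>1$: let $\tau_0=\inf\{n:\Lambda_{k,\rm det}(n)\le1/A\ \forall k\}$, $\tau_1=\inf\{n:\Lambda_{k,\rm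 det}(n)\ge B\text{ for some }k,\ \Lambda_{k,\rm iso}(n)\notin(1/A,B)\ \forall k,\ D_{\rm iso}(n)\in\Psi\setminus\{\emptyset\}\}$; $T^*_{fwer}=\tau_0\wedge\tau_1$, $D^*_{fwer}=\emptyset$ if $\tau_0<\tau_1$, $D^*_{fwer}=D_{\rm iso}(T^*_{fwer})$ if $\tau_1<\tau_0$. $\mathcal E_\Psi(\gamma,\delta)$ is the class of $(T,D)$ ($T$ an $\{\mathcal F_n\}$-stopping time, $D$ $\mathcal F_T$-measurable, $\Psi$-valued) with $\mathsf P(D\setminus\mathcal A(\mathsf P)\neq\emptyset)\le\gamma$, $\mathsf P(\mathcal A(\mathsf P)\setminus D\ne\emptyset)\le\delta$ for all $\mathsf P\in\mathcal P_\Psi$. The thresholds are functions of $\gamma,\delta$ with $\chi^*_{fwer}\in\mathcal E_\Psi(\gamma,\delta)$, $\log A\sim|\log\delta|$, $\log B\sim|\log\gamma|$ as $\gamma,\delta\to0$. $x\sim y$ means $x/y\to1$.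
   Formalization: It is additionally assumed that the local families H^k, G^k combine freely: for every A in Ψ, any choice of laws from G^k (k in A) and H^k (k not in A) occurs as the marginals of a member of P; without this the claim can fail. *)

theory Defs
  imports "HOL-Probability.Probability" "HOL-Library.Landau_Symbols"
begin

text \<open>
  Observations are realised on the canonical space: a path \<open>\<omega>\<close> assigns to source \<open>k\<close> and time
  \<open>i \<ge> 1\<close> the observation \<open>\<omega> k i\<close>, so that a distribution of the whole array of observations
  is a measure on this space. The members of \<open>hyps k\<close> and \<open>alts k\<close> (the families \<open>H\<^sup>k\<close> and
  \<open>G\<^sup>k\<close>) are laws of source \<open>k\<close> alone.
\<close>

record 'x model =
  nsrc  :: nat
  obs   :: "nat \<Rightarrow> 'x measure"
  fam   :: "(nat \<Rightarrow> nat \<Rightarrow> 'x) measure set"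
  hyps  :: "nat \<Rightarrow> (nat \<Rightarrow> nat \<Rightarrow> 'x) measure set"
  alts  :: "nat \<Rightarrow> (nat \<Rightarrow> nat \<Rightarrow> 'x) measure set"
  bound :: nat

type_synonym 'x path = "nat \<Rightarrow> nat \<Rightarrow> 'x"

definition srcs :: "'x model \<Rightarrow> nat set" where
  "srcs m = {1..nsrc m}"

definition src_paths :: "'x model \<Rightarrow> nat \<Rightarrow> (nat \<Rightarrow> 'x) measure" where
  "src_paths m k = PiM {1..} (\<lambda>_. obs m k)"

definition paths :: "'x model \<Rightarrow> nat set \<Rightarrow> 'x path measure" where
  "paths m s = PiM s (src_paths m)"

definition law :: "'x model \<Rightarrow> 'x path measure \<Rightarrow> nat set \<Rightarrow> 'x path measure" where
  "law m P s = distr P (paths m s) (\<lambda>\<omega>. restrict \<omega> s)"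

text \<open>
  The sigma-algebra generated by the observations of the sources in \<open>s\<close> at times
  \<open>1, \<dots>, t\<close>; for \<open>t = \<infinity>\<close> by all of them.
\<close>

definition filt :: "'x model \<Rightarrow> nat set \<Rightarrow> enat \<Rightarrow> 'x path measure" where
  "filt m s t = (let I = {i. 1 \<le> i \<and> enat i \<le> t} in
     vimage_algebra (space (paths m s)) (\<lambda>\<omega>. \<lambda>k\<in>s. restrict (\<omega> k) I)
       (PiM s (\<lambda>k. PiM I (\<lambda>_. obs m k))))"

subsection \<open>Hypotheses on the family of distributions\<close>

definition Psi :: "'x model \<Rightarrow> nat set set" where
  "Psi m = {A. A \<subseteq> srcs m \<and> card A \<le> bound m}"

definition active :: "'x model \<Rightarrow> 'x path measure \<Rightarrow> nat set" where
  "active m P = {k \<in> srcs m. law m P {k} \<in> alts m k}"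

definition fam_Psi :: "'x model \<Rightarrow> 'x path measure set" where
  "fam_Psi m = {P \<in> fam m. (\<forall>k\<in>srcs m. law m P {k} \<in> hyps m k \<union> alts m k) \<and> active m P \<in> Psi m}"

definition global_null :: "'x model \<Rightarrow> 'x path measure set" where
  "global_null m = {P \<in> fam m. \<forall>k\<in>srcs m. law m P {k} \<in> hyps m k}"

definition hyp_Psi :: "'x model \<Rightarrow> nat \<Rightarrow> 'x path measure set" where
  "hyp_Psi m k = {P \<in> fam_Psi m - global_null m. k \<notin> active m P}"

definition alt_Psi :: "'x model \<Rightarrow> nat \<Rightarrow> 'x path measure set" where
  "alt_Psi m k = {P \<in> fam_Psi m. k \<in> active m P}"

definition laws :: "'x model \<Rightarrow> 'x path measure set \<Rightarrow> nat set \<Rightarrow> 'x path measure set" where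
  "laws m Ps s = (\<lambda>P. law m P s) ` Ps"

definition testing_model :: "'x model \<Rightarrow> bool" where
  "testing_model m \<longleftrightarrow>
     1 \<le> nsrc m \<and> bound m \<le> nsrc m \<and>
     finite (fam m) \<and>
     (\<forall>P\<in>fam m. prob_space P \<and> sets P = sets (paths m (srcs m))) \<and>
     (\<forall>k\<in>srcs m. hyps m k \<subseteq> laws m (fam m) {k} \<and> hyps m k \<noteq> {} \<and>
                 alts m k \<subseteq> laws m (fam m) {k} \<and> alts m k \<noteq> {} \<and>
                 hyps m k \<inter> alts m k = {})"

definition independent_sources :: "'x model \<Rightarrow> bool" where
  "independent_sources m \<longleftrightarrow>
     (\<forall>P\<in>fam_Psi m. P = PiM (srcs m) (\<lambda>k. distr P (src_paths m k) (\<lambda>\<omega>. \<omega> k)))"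

text \<open>
  The families \<open>H\<^sup>k\<close> and \<open>G\<^sup>k\<close> of the individual sources may be combined freely, as far as
  the bound on the number of signals permits. With independence, the family \<open>fam_Psi\<close> then
  consists of exactly the product laws of this form. In particular the families of subsystem
  \<open>{k}\<close> entering the statistics of source \<open>k\<close> are the local ones, \<open>alts k\<close> and \<open>hyps k\<close>.
\<close>

definition all_combinations :: "'x model \<Rightarrow> bool" where
  "all_combinations m \<longleftrightarrow>
     (\<forall>A\<in>Psi m. \<forall>R. (\<forall>k\<in>srcs m. R k \<in> (if k \<in> A then alts m k else hyps m k)) \<longrightarrow>
        (\<exists>P\<in>fam m. \<forall>k\<in>srcs m. law m P {k} = R k))"

definition families_nonempty :: "'x model \<Rightarrow> bool" where
  "families_nonempty m \<longleftrightarrow>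
     global_null m \<noteq> {} \<and> (\<forall>k\<in>srcs m. alt_Psi m k \<noteq> {} \<and> hyp_Psi m k \<noteq> {})"

definition mutually_abs_cont :: "'x model \<Rightarrow> bool" where
  "mutually_abs_cont m \<longleftrightarrow>
     (\<forall>k\<in>srcs m. \<forall>P \<in> alt_Psi m k \<union> global_null m. \<forall>Q \<in> hyp_Psi m k \<union> global_null m.
      \<forall>s. k \<in> s \<and> s \<subseteq> srcs m \<longrightarrow> (\<forall>n\<ge>1.
        let P' = restr_to_subalg (law m P s) (filt m s (enat n));
            Q' = restr_to_subalg (law m Q s) (filt m s (enat n))
        in absolutely_continuous P' Q' \<and> absolutely_continuous Q' P'))"

subsection \<open>Likelihood ratios and their growth\<close>

text \<open>
  Here \<open>R\<close> and \<open>R0\<close> are laws on \<open>paths m s\<close>, and the derivative \<open>dR / dR0\<close> on the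
  sigma-algebra \<open>filt m s n\<close> is evaluated at a path of a possibly larger system. Under mutual
  absolute continuity it is almost surely positive and finite, so that the values
  \<open>enn2real \<infinity> = 0\<close> and \<open>ln 0 = 0\<close> are attained on null sets only.
\<close>

definition lr :: "'x model \<Rightarrow> nat set \<Rightarrow> nat \<Rightarrow> 'x path measure \<Rightarrow> 'x path measure \<Rightarrow> 'x path \<Rightarrow> real" where
  "lr m s n R R0 \<omega> =
     enn2real (RN_deriv (restr_to_subalg R0 (filt m s (enat n)))
                        (restr_to_subalg R (filt m s (enat n))) (restrict \<omega> s))"

definition llr :: "'x model \<Rightarrow> nat set \<Rightarrow> nat \<Rightarrow> 'x path measure \<Rightarrow> 'x path measure \<Rightarrow> 'x path \<Rightarrow> real" where
  "llr m s n P Q \<omega> = ln (lr m s n (law m P s) (law m Q s) \<omega>)"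

definition max_bound :: "'x model \<Rightarrow> nat set \<Rightarrow> 'x path measure \<Rightarrow> 'x path measure \<Rightarrow> real \<Rightarrow> bool" where
  "max_bound m s P Q I \<longleftrightarrow>
     (\<forall>\<rho>>I. (\<lambda>n. measure P {\<omega>\<in>space P. Max ((\<lambda>i. llr m s i P Q \<omega>) ` {1..n}) \<ge> real n * \<rho>})
        \<longlonglongrightarrow> 0)"

definition complete_bound :: "'x model \<Rightarrow> nat set \<Rightarrow> 'x path measure \<Rightarrow> 'x path measure \<Rightarrow> real \<Rightarrow> bool" where
  "complete_bound m s P Q I \<longleftrightarrow>
     (\<forall>\<rho><I. summable (\<lambda>n. measure P {\<omega>\<in>space P. llr m s n P Q \<omega> < real n * \<rho>}))"

text \<open>Conditions (M) and (CC), which involve the same numbers.\<close>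

definition cond_M_CC :: "'x model \<Rightarrow> bool" where
  "cond_M_CC m \<longleftrightarrow>
     (\<forall>k\<in>srcs m. \<forall>P \<in> alt_Psi m k. \<forall>Q \<in> hyp_Psi m k \<union> global_null m.
      \<forall>s. k \<in> s \<and> s \<subseteq> srcs m \<longrightarrow>
        (\<exists>I>0. \<exists>J>0. max_bound m s P Q I \<and> max_bound m s Q P J \<and>
                     complete_bound m s P Q I \<and> complete_bound m s Q P J))"

subsection \<open>Statistics\<close>

definition max_lr_ratio :: "'x model \<Rightarrow> nat set \<Rightarrow> nat \<Rightarrow> 'x path measure set \<Rightarrow> 'x path measure set
    \<Rightarrow> 'x path measure \<Rightarrow> 'x path \<Rightarrow> real" where
  "max_lr_ratio m s n Gs Hs R0 \<omega> =
     Max ((\<lambda>R. lr m s n R R0 \<omega>) ` Gs) / Max ((\<lambda>R. lr m s n R R0 \<omega>) ` Hs)"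

text \<open>
  The last parameter \<open>b\<close> of the statistics below selects the reference law (\<open>P\<^sub>0\<close> or its
  analogues) in the null family of the respective subsystem, one for each source.
\<close>

definition det_stat :: "'x model \<Rightarrow> (nat \<Rightarrow> nat set) \<Rightarrow> (nat \<Rightarrow> 'x path measure)
    \<Rightarrow> nat \<Rightarrow> nat \<Rightarrow> 'x path \<Rightarrow> real" where
  "det_stat m s b k n = max_lr_ratio m (s k) n
     (laws m (alt_Psi m k) (s k)) (laws m (global_null m) (s k)) (b k)"

definition iso_stat :: "'x model \<Rightarrow> (nat \<Rightarrow> nat set) \<Rightarrow> (nat \<Rightarrow> 'x path measure)
    \<Rightarrow> nat \<Rightarrow> nat \<Rightarrow> 'x path \<Rightarrow> real" where
  "iso_stat m s b k n = max_lr_ratio m (s k) n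
     (laws m (alt_Psi m k) (s k)) (laws m (hyp_Psi m k) (s k)) (b k)"

definition loc_stat :: "'x model \<Rightarrow> (nat \<Rightarrow> 'x path measure) \<Rightarrow> nat \<Rightarrow> nat \<Rightarrow> 'x path \<Rightarrow> real" where
  "loc_stat m b k n = max_lr_ratio m {k} n (alts m k) (hyps m k) (b k)"

text \<open>The \<open>i\<close>-th largest local statistic, for \<open>1 \<le> i \<le> nsrc m\<close>.\<close>

definition ord_stat :: "'x model \<Rightarrow> (nat \<Rightarrow> 'x path measure) \<Rightarrow> nat \<Rightarrow> nat \<Rightarrow> 'x path \<Rightarrow> real" where
  "ord_stat m b i n \<omega> = rev (sort (map (\<lambda>k. loc_stat m b k n \<omega>) [1..<Suc (nsrc m)])) ! (i - 1)"

definition num_pos :: "'x model \<Rightarrow> (nat \<Rightarrow> 'x path measure) \<Rightarrow> nat \<Rightarrow> 'x path \<Rightarrow> nat" where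
  "num_pos m b n \<omega> = card {k \<in> srcs m. loc_stat m b k n \<omega> > 1}"

subsection \<open>Tests\<close>

text \<open>The first time \<open>n \<ge> 1\<close> at which \<open>C\<close> holds, and \<open>\<infinity>\<close> if there is none.\<close>

definition first_time :: "(nat \<Rightarrow> 'x path \<Rightarrow> bool) \<Rightarrow> 'x path \<Rightarrow> enat" where
  "first_time C \<omega> = Inf {enat n | n. 1 \<le> n \<and> C n \<omega>}"

definition iso_set :: "'x model \<Rightarrow> (nat \<Rightarrow> nat set) \<Rightarrow> (nat \<Rightarrow> 'x path measure) \<Rightarrow> nat \<Rightarrow> 'x path \<Rightarrow> nat set" where
  "iso_set m s b n \<omega> = {k \<in> srcs m. iso_stat m s b k n \<omega> > 1}"

definition tau0 :: "'x model \<Rightarrow> (nat \<Rightarrow> nat set) \<Rightarrow> (nat \<Rightarrow> 'x path measure) \<Rightarrow> real \<Rightarrow> 'x path \<Rightarrow> enat" where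
  "tau0 m s b A = first_time (\<lambda>n \<omega>. \<forall>k\<in>srcs m. det_stat m s b k n \<omega> \<le> 1 / A)"

definition tau1 :: "'x model \<Rightarrow> (nat \<Rightarrow> nat set) \<Rightarrow> (nat \<Rightarrow> nat set)
    \<Rightarrow> (nat \<Rightarrow> 'x path measure) \<Rightarrow> (nat \<Rightarrow> 'x path measure) \<Rightarrow> real \<Rightarrow> real \<Rightarrow> 'x path \<Rightarrow> enat" where
  "tau1 m s s' b b' A B = first_time (\<lambda>n \<omega>.
     (\<exists>k\<in>srcs m. det_stat m s b k n \<omega> \<ge> B) \<and>
     (\<forall>k\<in>srcs m. iso_stat m s' b' k n \<omega> \<notin> {1 / A<..<B}) \<and>
     iso_set m s' b' n \<omega> \<in> Psi m - {{}})"

definition T_fwer :: "'x model \<Rightarrow> (nat \<Rightarrow> nat set) \<Rightarrow> (nat \<Rightarrow> nat set)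
    \<Rightarrow> (nat \<Rightarrow> 'x path measure) \<Rightarrow> (nat \<Rightarrow> 'x path measure) \<Rightarrow> real \<Rightarrow> real \<Rightarrow> 'x path \<Rightarrow> enat" where
  "T_fwer m s s' b b' A B \<omega> = min (tau0 m s b A \<omega>) (tau1 m s s' b b' A B \<omega>)"

text \<open>
  For \<open>A, B > 1\<close> the two times can agree only if both are infinite; the test does not stop
  in this case, and the value \<open>{}\<close> is a convention.
\<close>

definition D_fwer :: "'x model \<Rightarrow> (nat \<Rightarrow> nat set) \<Rightarrow> (nat \<Rightarrow> nat set)
    \<Rightarrow> (nat \<Rightarrow> 'x path measure) \<Rightarrow> (nat \<Rightarrow> 'x path measure) \<Rightarrow> real \<Rightarrow> real \<Rightarrow> 'x path \<Rightarrow> nat set" where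
  "D_fwer m s s' b b' A B \<omega> =
     (if tau1 m s s' b b' A B \<omega> < tau0 m s b A \<omega>
      then iso_set m s' b' (the_enat (T_fwer m s s' b b' A B \<omega>)) \<omega> else {})"

definition test_class :: "'x model \<Rightarrow> real \<Rightarrow> real \<Rightarrow> (('x path \<Rightarrow> enat) \<times> ('x path \<Rightarrow> nat set)) set" where
  "test_class m \<gamma> \<delta> = {(T, D).
     stopping_time (filt m (srcs m)) T \<and>
     (\<forall>\<omega>\<in>space (paths m (srcs m)). 1 \<le> T \<omega> \<and> D \<omega> \<in> Psi m) \<and>
     D \<in> measurable (filtration.pre_sigma (space (paths m (srcs m))) (filt m (srcs m)) T)
                    (count_space UNIV) \<and>
     (\<forall>P\<in>fam_Psi m.
        measure P {\<omega>\<in>space P. D \<omega> - active m P \<noteq> {}} \<le> \<gamma> \<and>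
        measure P {\<omega>\<in>space P. active m P - D \<omega> \<noteq> {}} \<le> \<delta>)}"

definition mean_time :: "'x path measure \<Rightarrow> ('x path \<Rightarrow> enat) \<Rightarrow> ennreal" where
  "mean_time P T = (\<integral>\<^sup>+ \<omega>. ennreal_of_enat (T \<omega>) \<partial>P)"

definition asymp_optimal :: "'x model \<Rightarrow> (real \<Rightarrow> real \<Rightarrow> 'x path \<Rightarrow> enat) \<Rightarrow> 'x path measure \<Rightarrow> bool" where
  "asymp_optimal m T P \<longleftrightarrow>
     ((\<lambda>(\<gamma>, \<delta>). mean_time P (T \<gamma> \<delta>) / (INF (T', D')\<in>test_class m \<gamma> \<delta>. mean_time P T'))
        \<longlongrightarrow> 1) (at_right 0 \<times>\<^sub>F at_right 0)"

subsection \<open>The five times for a nontrivial bound on the number of signals\<close>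

definition time0 :: "'x model \<Rightarrow> (nat \<Rightarrow> 'x path measure) \<Rightarrow> real \<Rightarrow> 'x path \<Rightarrow> enat" where
  "time0 m b A = first_time (\<lambda>n \<omega>. ord_stat m b 1 n \<omega> \<le> 1 / A)"

definition time1 :: "'x model \<Rightarrow> (nat \<Rightarrow> 'x path measure) \<Rightarrow> real \<Rightarrow> real \<Rightarrow> 'x path \<Rightarrow> enat" where
  "time1 m b A B = first_time (\<lambda>n \<omega>. ord_stat m b 1 n \<omega> \<ge> B \<and>
     ord_stat m b 2 n \<omega> \<le> min (1 / A) (ord_stat m b 1 n \<omega> / B))"

definition time2 :: "'x model \<Rightarrow> (nat \<Rightarrow> 'x path measure) \<Rightarrow> real \<Rightarrow> real \<Rightarrow> 'x path \<Rightarrow> enat" where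
  "time2 m b A B = first_time (\<lambda>n \<omega>. 1 < num_pos m b n \<omega> \<and> num_pos m b n \<omega> < bound m \<and>
     ord_stat m b 1 n \<omega> \<ge> B \<and> (\<forall>k\<in>srcs m. loc_stat m b k n \<omega> \<notin> {1 / A<..<B}))"

definition time3 :: "'x model \<Rightarrow> (nat \<Rightarrow> 'x path measure) \<Rightarrow> real \<Rightarrow> real \<Rightarrow> 'x path \<Rightarrow> enat" where
  "time3 m b A B = first_time (\<lambda>n \<omega>. num_pos m b n \<omega> = bound m \<and>
     ord_stat m b (bound m) n \<omega> \<ge> max B (A * ord_stat m b (bound m + 1) n \<omega>))"

definition time4 :: "'x model \<Rightarrow> (nat \<Rightarrow> 'x path measure) \<Rightarrow> real \<Rightarrow> real \<Rightarrow> 'x path \<Rightarrow> enat" where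
  "time4 m b A B = first_time (\<lambda>n \<omega>. num_pos m b n \<omega> > bound m \<and> ord_stat m b 1 n \<omega> \<ge> B \<and>
     ord_stat m b (bound m) n \<omega> \<ge> ord_stat m b (bound m + 1) n \<omega> * max A B)"

lemma filtration_filt:
  fixes m :: "'x model"
  shows "filtration (space (paths m s)) (filt m s)"
proof
  fix i j :: enat
  assume ij: "i \<le> j"
  define I J where "I = {n. 1 \<le> n \<and> enat n \<le> i}" and "J = {n. 1 \<le> n \<and> enat n \<le> j}"
  have IJ: "I \<subseteq> J" using ij by (auto simp: I_def J_def intro: order_trans)
  let ?M = "\<lambda>I. PiM s (\<lambda>k. PiM I (\<lambda>_. obs m k))"
  let ?r = "\<lambda>I \<omega>. \<lambda>k\<in>s. restrict (\<omega> k) I"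
  have "?r I \<in> measurable (vimage_algebra (space (paths m s)) (?r J) (?M J)) (?M I)"
  proof -
    have J1: "?r J \<in> space (paths m s) \<rightarrow> space (?M J)"
      by (auto simp: paths_def src_paths_def space_PiM PiE_def Pi_def extensional_def J_def)
    have "(\<lambda>\<omega>. ?r I (?r J \<omega>)) \<in> measurable (vimage_algebra (space (paths m s)) (?r J) (?M J)) (?M I)"
    proof (rule measurable_compose[OF measurable_vimage_algebra1[OF J1]])
      show "?r I \<in> measurable (?M J) (?M I)"
      proof (rule measurable_restrict)
        fix k assume k: "k \<in> s"
        show "(\<lambda>\<omega>. restrict (\<omega> k) I) \<in> measurable (?M J) (PiM I (\<lambda>_. obs m k))"
          by (rule measurable_compose[OF measurable_component_singleton[OF k]
                measurable_restrict_subset[OF IJ]])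
      qed
    qed
    moreover have "(\<lambda>\<omega> :: 'x path. ?r I (?r J \<omega>)) = ?r I"
      using IJ by (auto simp: fun_eq_iff restrict_def)
    ultimately show ?thesis by (simp only:)
  qed
  then have "sets (vimage_algebra (space (paths m s)) (?r I) (?M I))
    \<subseteq> sets (vimage_algebra (space (paths m s)) (?r J) (?M J))"
    by (intro sets_image_in_sets) (simp_all del: restrict_apply)
  then show "sets (filt m s i) \<subseteq> sets (filt m s j)"
    by (simp add: filt_def Let_def I_def J_def)
qed (simp add: filt_def Let_def)

end

theory Submission
  imports Defs "HOL-Real_Asymp.Real_Asymp"
begin

text \<open>
  Every law in \<open>fam_Psi\<close> is a product over the sources, so the likelihood ratio of two such laws is
  the product of the likelihood ratios of the individual sources (\<open>AE_lr_product\<close>). Outside one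
  null set all likelihood ratios are positive, satisfy the chain rule and factor in this way, at all
  times simultaneously; the structure of the test is elementary on such paths.

  \<^emph>\<open>The stopping rule.\<close> Write \<open>\<Lambda>\<^sub>k\<close> for the local ratio of source \<open>k\<close>. Since the local families
  combine freely, a maximum of full likelihood ratios over laws with prescribed signal sets is, up to
  a factor common to all maxima, the maximum of \<open>\<Prod>k\<in>A. \<Lambda>\<^sub>k\<close> over those signal sets \<open>A\<close>. So an isolation
  statistic based on all sources compares the best product over sets \<open>A\<close> of size at most \<open>u\<close> that contain
  \<open>k\<close> with the best one over nonempty such sets that avoid \<open>k\<close>. An exchange argument
  (\<open>top_set_optimal\<close>) finds both maximisers among the largest local ratios; how they look depends on
  the number \<open>p\<close> of local ratios above 1, and the cases \<open>p = 1\<close>, \<open>1 < p < u\<close>, \<open>p = u\<close> and \<open>p > u\<close> produce the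
  times \<open>time1\<close> to \<open>time4\<close> (\<open>stop_iff\<close>).

  \<^emph>\<open>Optimality.\<close> Let \<open>A\<close> be the set of signals under \<open>P\<close>, and let \<open>I\<^sub>k\<close> be the smallest growth rate of the
  log-likelihood ratio of source \<open>k\<close> against the opposite local family (\<open>rate\<close>). Changing the law of one
  source, or exchanging a signal with a non-signal, gives another admissible law \<open>Q\<close>, under which
  the decision that is probable under \<open>P\<close> has probability at most \<open>\<gamma>\<close> or \<open>\<delta>\<close>. Since the likelihood ratio
  of \<open>P\<close> to \<open>Q\<close> exceeds \<open>exp (n \<rho>)\<close> with vanishing probability when \<open>\<rho>\<close> is above the sum of the rates of the
  changed sources, a test needs time \<open>\<bar>ln \<gamma>\<bar> / I\<close> or \<open>\<bar>ln \<delta>\<bar> / I\<close> to first order, where \<open>I\<close> is that sum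
  (\<open>test_class_lower_bound\<close>). Removing a signal is always possible and yields
  \<open>\<bar>ln \<gamma>\<bar> / min\<^sub>A I\<close>. Adding a signal is possible when \<open>A\<close> has fewer than \<open>u\<close> elements and yields
  \<open>\<bar>ln \<delta>\<bar> / min\<^bsub>-A\<^esub> I\<close>. When \<open>A\<close> has \<open>u\<close> elements only an exchange is available, and it yields
  \<open>\<bar>ln \<delta>\<bar> / (min\<^sub>A I + min\<^bsub>-A\<^esub> I)\<close>. Conversely, complete convergence makes each \<open>\<Lambda>\<^sub>k\<close> follow its rate
  except at finitely many times whose expected number is finite. With thresholds \<open>a\<close> and \<open>c\<close> the test has
  stopped once \<open>\<Lambda>\<^sub>k \<ge> c\<close> on \<open>A\<close> and \<open>\<Lambda>\<^sub>k \<le> 1/a\<close> off \<open>A\<close>; when \<open>A\<close> has \<open>u < K\<close> elements, it suffices that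
  \<open>\<Lambda>\<^sub>k \<le> 1\<close> off \<open>A\<close> and that all ratios on \<open>A\<close> lead those off \<open>A\<close> by the factor \<open>a\<close>. This happens at the
  maximum of the very same two terms (\<open>mean_time_upper\<close>), and \<open>ratio_tendsto_1\<close> combines the two bounds.
\<close>

section \<open>Densities and time-n sigma-algebras\<close>

lemma AE_RN_deriv_pos:
  assumes "sigma_finite_measure M" "absolutely_continuous M N" "sets N = sets M"
  shows "AE x in N. 0 < RN_deriv M N x"
proof -
  interpret M: sigma_finite_measure M by fact
  have d: "density M (RN_deriv M N) = N" using assms by (intro M.density_RN_deriv)
  have "AE x in density M (RN_deriv M N). 0 < RN_deriv M N x"
    by (subst AE_density) auto
  then show ?thesis by (simp only: d)
qed

lemma AE_RN_deriv_chain: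
  assumes f: "sigma_finite_measure M" "sigma_finite_measure N"
    and ac: "absolutely_continuous M N" "absolutely_continuous N R"
    and s: "sets N = sets M" "sets R = sets M"
  shows "AE x in M. RN_deriv M R x = RN_deriv M N x * RN_deriv N R x"
proof -
  interpret M: sigma_finite_measure M by fact
  interpret N: sigma_finite_measure N by fact
  have dN: "density M (RN_deriv M N) = N" using ac s by (intro M.density_RN_deriv)
  have dR: "density N (RN_deriv N R) = R" using ac s by (intro N.density_RN_deriv) auto
  have m: "RN_deriv N R \<in> borel_measurable M"
    using borel_measurable_RN_deriv[of N R] measurable_cong_sets[OF s(1) refl] by blast
  have "density M (\<lambda>x. RN_deriv M N x * RN_deriv N R x) = density (density M (RN_deriv M N)) (RN_deriv N R)"
    using m by (subst density_density_eq) auto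
  also have "\<dots> = R" by (simp only: dN dR)
  finally have "AE x in M. RN_deriv M N x * RN_deriv N R x = RN_deriv M R x"
    using m by (intro M.RN_deriv_unique) auto
  then show ?thesis by eventually_elim simp
qed

lemma space_paths: "space (paths m s) = (\<Pi>\<^sub>E k\<in>s. space (src_paths m k))"
  by (simp add: paths_def space_PiM)

lemma filt_subalgebra: "subalgebra (paths m s) (filt m s t)"
proof -
  let ?I = "{i. 1 \<le> i \<and> enat i \<le> t}"
  let ?r = "\<lambda>\<omega>. \<lambda>k\<in>s. restrict (\<omega> k) ?I"
  have "?r \<in> measurable (paths m s) (PiM s (\<lambda>k. PiM ?I (\<lambda>_. obs m k)))"
    unfolding paths_def src_paths_def
  proof (rule measurable_restrict)
    fix k assume k: "k \<in> s"
    show "(\<lambda>\<omega>. restrict (\<omega> k) ?I) \<in> measurable (PiM s (\<lambda>k. PiM {1..} (\<lambda>_. obs m k))) (PiM ?I (\<lambda>_. obs m k))"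
      by (rule measurable_compose[OF measurable_component_singleton[OF k]
                measurable_restrict_subset]) auto
  qed
  then have "sets (filt m s t) \<subseteq> sets (paths m s)"
    unfolding filt_def Let_def by (intro sets_image_in_sets) auto
  then show ?thesis by (auto simp: subalgebra_def filt_def Let_def)
qed

section \<open>The testing problem\<close>

locale model_setting =
  fixes m :: "'x model"
  assumes testing: "testing_model m"
    and indep: "independent_sources m"
    and comb: "all_combinations m"
    and nonempty: "families_nonempty m"
    and mac: "mutually_abs_cont m"
    and MCC: "cond_M_CC m"

begin

abbreviation "K \<equiv> nsrc m"

abbreviation "S \<equiv> srcs m"

abbreviation "FP \<equiv> fam_Psi m"

text \<open>
  The law of subsystem \<open>s\<close> on its observations up to time \<open>n\<close>, the measure whose densities are the likelihood ratios.
\<close>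
abbreviation "sub P s n \<equiv> restr_to_subalg (law m P s) (filt m s (enat n))"

abbreviation "L s n P Q \<equiv> lr m s n (law m P s) (law m Q s)"

lemma finite_sources[simp]: "finite S" by (simp add: srcs_def)

lemma card_S: "card S = K" by (simp add: srcs_def)

lemma fam_PsiD: "P \<in> FP \<Longrightarrow> P \<in> fam m" by (simp add: fam_Psi_def)

lemma finite_fam: "finite (fam m)" using testing by (simp add: testing_model_def)

lemma finite_FP: "finite FP" using finite_fam by (simp add: fam_Psi_def)

lemma prob_fam: "P \<in> fam m \<Longrightarrow> prob_space P" using testing by (simp add: testing_model_def)

lemma sets_fam: "P \<in> fam m \<Longrightarrow> sets P = sets (paths m S)" using testing by (simp add: testing_model_def)

lemma space_fam: "P \<in> fam m \<Longrightarrow> space P = space (paths m S)" using sets_fam by (rule sets_eq_imp_space_eq)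

lemma hyps_alts_disjoint: "k \<in> S \<Longrightarrow> hyps m k \<inter> alts m k = {}" using testing by (simp add: testing_model_def)

lemma hyps_ne: "k \<in> S \<Longrightarrow> hyps m k \<noteq> {}" using testing by (simp add: testing_model_def)

lemma alts_ne: "k \<in> S \<Longrightarrow> alts m k \<noteq> {}" using testing by (simp add: testing_model_def)

lemma fin_hyps: "k \<in> S \<Longrightarrow> finite (hyps m k)"
  using testing unfolding testing_model_def laws_def by (meson finite_imageI finite_subset)

lemma fin_alts: "k \<in> S \<Longrightarrow> finite (alts m k)"
  using testing unfolding testing_model_def laws_def by (meson finite_imageI finite_subset)

lemma sources_nonempty: "S \<noteq> {}" using testing by (auto simp: testing_model_def srcs_def)

lemma null_subset: "global_null m \<subseteq> FP"
proof
  fix P assume P: "P \<in> global_null m"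
  then have "active m P = {}" using hyps_alts_disjoint by (auto simp: global_null_def active_def)
  with P show "P \<in> FP" by (auto simp: fam_Psi_def global_null_def Psi_def)
qed

lemma alt_subset: "alt_Psi m k \<subseteq> FP" by (auto simp: alt_Psi_def)

lemma null_active: "P \<in> global_null m \<Longrightarrow> active m P = {}" using hyps_alts_disjoint by (auto simp: global_null_def active_def)

lemma active_null: "P \<in> FP \<Longrightarrow> active m P = {} \<Longrightarrow> P \<in> global_null m"
  by (auto simp: fam_Psi_def global_null_def active_def)

lemma null_iff: "P \<in> FP \<Longrightarrow> P \<in> global_null m \<longleftrightarrow> active m P = {}"
  using active_null null_active by blast

lemma hyp_null_iff: "P \<in> FP \<Longrightarrow> P \<in> hyp_Psi m k \<union> global_null m \<longleftrightarrow> k \<notin> active m P"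
  using null_iff by (auto simp: hyp_Psi_def)

lemma FP_cover: assumes "P \<in> FP" shows "P \<in> alt_Psi m k \<or> P \<in> hyp_Psi m k \<or> P \<in> global_null m"
  using assms by (auto simp: alt_Psi_def hyp_Psi_def)

lemma fam_Psi_law: "P \<in> FP \<Longrightarrow> k \<in> S \<Longrightarrow> law m P {k} \<in> (if k \<in> active m P then alts m k else hyps m k)"
  by (auto simp: fam_Psi_def active_def)

lemma active_Psi: "P \<in> FP \<Longrightarrow> active m P \<in> Psi m" by (simp add: fam_Psi_def)

lemma active_sub: "P \<in> FP \<Longrightarrow> active m P \<subseteq> S" by (auto simp: active_def)

text \<open>
  Free combination of the local families also realises the prescribed signal set, since the local null and
  alternative families are disjoint.
\<close>
lemma combine_source_laws:
  assumes "A \<in> Psi m" "\<And>k. k \<in> S \<Longrightarrow> R k \<in> (if k \<in> A then alts m k else hyps m k)"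
  obtains P where "P \<in> FP" "active m P = A" "\<And>k. k \<in> S \<Longrightarrow> law m P {k} = R k"
proof -
  obtain P where P: "P \<in> fam m" "\<forall>k\<in>S. law m P {k} = R k"
    using comb assms unfolding all_combinations_def by blast
  have 1: "law m P {k} \<in> hyps m k \<union> alts m k" "law m P {k} \<in> alts m k \<longleftrightarrow> k \<in> A" if "k \<in> S" for k
    using assms(2)[OF that] P(2) that hyps_alts_disjoint[OF that] by (auto split: if_splits)
  have "active m P = A" using 1 assms(1) by (auto simp: active_def Psi_def)
  moreover have "P \<in> FP" using P(1) 1 calculation assms(1) by (auto simp: fam_Psi_def)
  ultimately show ?thesis using that P(2) by auto
qed

text \<open>
  A bound of 0 would exclude all signals, whereas the families of laws with a signal in \<open>k\<close> are nonempty.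
\<close>
lemma bound_pos: "1 \<le> bound m"
proof -
  obtain k where k: "k \<in> S" using sources_nonempty by auto
  then obtain P where "P \<in> alt_Psi m k" using nonempty by (auto simp: families_nonempty_def)
  then have "k \<in> active m P" "card (active m P) \<le> bound m" "active m P \<subseteq> S"
    by (auto simp: alt_Psi_def fam_Psi_def Psi_def)
  then show ?thesis using card_gt_0_iff[of "active m P"] finite_subset[OF _ finite_sources] by force
qed

text \<open>
  A law with signals but none in \<open>k\<close> has a signal elsewhere, so there are at least two sources.
\<close>
lemma other_source: assumes "k \<in> S" obtains j where "j \<in> S" "j \<noteq> k"
proof -
  obtain P where P: "P \<in> hyp_Psi m k" using assms nonempty by (auto simp: families_nonempty_def)
  then have "active m P \<noteq> {}" using active_null by (auto simp: hyp_Psi_def)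
  then obtain j where "j \<in> active m P" by auto
  moreover have "j \<noteq> k" using P calculation by (auto simp: hyp_Psi_def)
  ultimately show ?thesis using that by (auto simp: active_def)
qed

lemma realise_source_law:
  assumes A: "A \<in> Psi m" and k: "k \<in> S" "X \<in> (if k \<in> A then alts m k else hyps m k)"
  obtains P where "P \<in> FP" "active m P = A" "law m P {k} = X"
proof -
  define R where "R j = (if j = k then X else SOME Y. Y \<in> (if j \<in> A then alts m j else hyps m j))" for j
  have R: "R j \<in> (if j \<in> A then alts m j else hyps m j)" if j: "j \<in> S" for j
  proof (cases "j = k")
    case True
    show ?thesis unfolding R_def True using k(2) by (simp only: refl if_True)
  next
    case False
    have "(if j \<in> A then alts m j else hyps m j) \<noteq> {}" using alts_ne[OF j] hyps_ne[OF j] by simp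
    then show ?thesis unfolding R_def using False by (simp only: if_False some_in_eq) simp
  qed
  show ?thesis
    by (rule combine_source_laws[OF A R]) (use k that in \<open>auto simp: R_def\<close>)
qed

text \<open>
  Projected to one source, the global families are the local ones. For \<open>hyp_Psi\<close> this requires a signal in
  some other source.
\<close>
lemma laws_alt: assumes k: "k \<in> S" shows "laws m (alt_Psi m k) {k} = alts m k"
proof
  show "laws m (alt_Psi m k) {k} \<subseteq> alts m k" by (auto simp: laws_def alt_Psi_def active_def)
  show "alts m k \<subseteq> laws m (alt_Psi m k) {k}"
  proof
    fix X assume X: "X \<in> alts m k"
    have "{k} \<in> Psi m" using k bound_pos by (auto simp: Psi_def)
    then obtain P where "P \<in> FP" "active m P = {k}" "law m P {k} = X" by (rule realise_source_law[OF _ k]) (use X in auto)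
    then show "X \<in> laws m (alt_Psi m k) {k}" by (auto simp: laws_def alt_Psi_def)
  qed
qed

lemma laws_null: assumes k: "k \<in> S" shows "laws m (global_null m) {k} = hyps m k"
proof
  show "laws m (global_null m) {k} \<subseteq> hyps m k" using k by (auto simp: laws_def global_null_def)
  show "hyps m k \<subseteq> laws m (global_null m) {k}"
  proof
    fix X assume X: "X \<in> hyps m k"
    have "{} \<in> Psi m" by (auto simp: Psi_def)
    then obtain P where "P \<in> FP" "active m P = {}" "law m P {k} = X" by (rule realise_source_law[OF _ k]) (use X in auto)
    then show "X \<in> laws m (global_null m) {k}" using null_iff by (auto simp: laws_def)
  qed
qed

lemma laws_hyp: assumes k: "k \<in> S" shows "laws m (hyp_Psi m k) {k} = hyps m k"
proof
  show "laws m (hyp_Psi m k) {k} \<subseteq> hyps m k" using k fam_Psi_law by (fastforce simp: laws_def hyp_Psi_def)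
  show "hyps m k \<subseteq> laws m (hyp_Psi m k) {k}"
  proof
    fix X assume X: "X \<in> hyps m k"
    obtain j where j: "j \<in> S" "j \<noteq> k" using other_source[OF k] .
    then have "{j} \<in> Psi m" using bound_pos by (auto simp: Psi_def)
    then obtain P where P: "P \<in> FP" "active m P = {j}" "law m P {k} = X" by (rule realise_source_law[OF _ k]) (use X j in auto)
    then show "X \<in> laws m (hyp_Psi m k) {k}" using null_iff[OF P(1)] j by (auto simp: laws_def hyp_Psi_def)
  qed
qed

lemma src_law_FP: assumes "k \<in> S" "R \<in> alts m k \<union> hyps m k" obtains P where "P \<in> FP" "law m P {k} = R"
proof (cases "R \<in> alts m k")
  case True
  then have "R \<in> laws m (alt_Psi m k) {k}" using laws_alt assms by simp
  then show ?thesis using that alt_subset by (auto simp: laws_def)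
next
  case False
  then have "R \<in> laws m (global_null m) {k}" using laws_null assms by auto
  then show ?thesis using that null_subset by (auto simp: laws_def)
qed

section \<open>Mutual absolute continuity and the chain rule\<close>

lemma measurable_restr: "s \<subseteq> S \<Longrightarrow> (\<lambda>\<omega>. restrict \<omega> s) \<in> measurable (paths m S) (paths m s)"
  unfolding paths_def by (rule measurable_restrict_subset)

lemma measurable_restr_fam: "P \<in> fam m \<Longrightarrow> s \<subseteq> S \<Longrightarrow> (\<lambda>\<omega>. restrict \<omega> s) \<in> measurable P (paths m s)"
  using measurable_restr measurable_cong_sets[OF sets_fam refl] by blast

lemma sets_law[simp]: "sets (law m P s) = sets (paths m s)" by (simp add: law_def)

lemma space_law[simp]: "space (law m P s) = space (paths m s)" by (simp add: law_def)

lemma prob_law: "P \<in> fam m \<Longrightarrow> s \<subseteq> S \<Longrightarrow> prob_space (law m P s)"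
  unfolding law_def by (intro prob_space.prob_space_distr prob_fam measurable_restr_fam)

lemma subalg: "subalgebra (law m P s) (filt m s t)"
  using filt_subalgebra[of m s t] by (simp add: subalgebra_def)

lemma sets_sub[simp]: "sets (sub P s n) = sets (filt m s (enat n))"
  by (rule sets_restr_to_subalg[OF subalg])

lemma space_sub[simp]: "space (sub P s n) = space (paths m s)"
  by (simp add: space_restr_to_subalg)

lemma prob_sub: "P \<in> fam m \<Longrightarrow> s \<subseteq> S \<Longrightarrow> prob_space (sub P s n)"
  by (intro prob_space_restr_to_subalg subalg prob_law)

lemma sf_sub: "P \<in> fam m \<Longrightarrow> s \<subseteq> S \<Longrightarrow> sigma_finite_measure (sub P s n)"
  by (intro prob_space_imp_sigma_finite prob_sub)

lemma AE_sub_lift: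
  assumes "P \<in> fam m" "s \<subseteq> S" "AE x in sub P s n. \<phi> x"
  shows "AE \<omega> in P. \<phi> (restrict \<omega> s)"
proof -
  have "AE x in law m P s. \<phi> x" using AE_restr_to_subalg[OF subalg assms(3)] .
  then show ?thesis unfolding law_def
    by (rule AE_distrD[OF measurable_restr_fam[OF assms(1,2)]])
qed

lemma ac_trans: "absolutely_continuous A B \<Longrightarrow> absolutely_continuous B C \<Longrightarrow> absolutely_continuous A C"
  by (auto simp: absolutely_continuous_def)

text \<open>
  The assumption relates laws with a signal in \<open>k\<close> to laws without one. A global null law occurs on both
  sides, so it serves as an intermediary between any two laws.
\<close>
lemma ac_null:
  assumes P: "P \<in> FP" and N: "N \<in> global_null m" and s: "s \<noteq> {}" "s \<subseteq> S" and n: "n \<ge> 1"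
  shows "absolutely_continuous (sub P s n) (sub N s n) \<and> absolutely_continuous (sub N s n) (sub P s n)"
proof -
  obtain k where k: "k \<in> s" "k \<in> S" using s by auto
  consider "P \<in> alt_Psi m k \<union> global_null m" | "P \<in> hyp_Psi m k \<union> global_null m"
    using FP_cover[OF P, of k] by auto
  then show ?thesis
    using mac k s n N unfolding mutually_abs_cont_def Let_def by cases blast+
qed

lemma mutual_ac:
  assumes P: "P \<in> FP" and Q: "Q \<in> FP" and s: "s \<noteq> {}" "s \<subseteq> S" and n: "n \<ge> 1"
  shows "absolutely_continuous (sub P s n) (sub Q s n)"
proof -
  obtain N where "N \<in> global_null m" using nonempty by (auto simp: families_nonempty_def)
  then show ?thesis using ac_null[OF P _ s n] ac_null[OF Q _ s n] ac_trans by blast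
qed

lemma AE_lr_chain:
  assumes PQR: "P \<in> FP" "Q \<in> FP" "R \<in> FP" "P' \<in> FP" and s: "s \<noteq> {}" "s \<subseteq> S" and n: "n \<ge> 1"
  shows "AE \<omega> in P'. 0 < L s n P Q \<omega> \<and> L s n P R \<omega> = L s n P Q \<omega> * L s n Q R \<omega>"
proof -
  let ?P = "sub P s n" let ?Q = "sub Q s n" let ?R = "sub R s n" let ?P' = "sub P' s n"
  note f = PQR[THEN fam_PsiD]
  note sf = sf_sub[OF _ s(2)]
  have ac: "absolutely_continuous (sub X s n) (sub Y s n)" if "X \<in> FP" "Y \<in> FP" for X Y
    using mutual_ac[OF that s n] .
  have tr: "AE x in ?P'. \<phi> x" if "AE x in sub X s n. \<phi> x" "X \<in> FP" for \<phi> X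
    by (rule absolutely_continuous_AE[OF _ ac[OF that(2) PQR(4)] that(1)]) simp
  have pos: "AE x in ?P'. 0 < RN_deriv ?Q ?P x"
    by (rule tr[OF AE_RN_deriv_pos]) (use PQR f sf ac in auto)
  interpret Q: sigma_finite_measure ?Q using sf f by auto
  have fin: "AE x in ?P'. RN_deriv ?Q ?P x \<noteq> \<infinity>"
    by (rule tr[OF Q.RN_deriv_finite]) (use PQR f sf ac in auto)
  have ch: "AE x in ?P'. RN_deriv ?R ?P x = RN_deriv ?R ?Q x * RN_deriv ?Q ?P x"
    by (rule tr[OF AE_RN_deriv_chain]) (use PQR f sf ac in auto)
  have "AE x in ?P'. 0 < enn2real (RN_deriv ?Q ?P x) \<and>
     enn2real (RN_deriv ?R ?P x) = enn2real (RN_deriv ?Q ?P x) * enn2real (RN_deriv ?R ?Q x)"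
    using pos fin ch
    by eventually_elim (auto simp: enn2real_mult enn2real_positive_iff less_top mult.commute)
  from AE_sub_lift[OF f(4) s(2) this] show ?thesis by (simp add: lr_def)
qed

section \<open>Independence\<close>

abbreviation "src X k \<equiv> distr X (src_paths m k) (\<lambda>\<omega>. \<omega> k)"

lemma measurable_source: "X \<in> fam m \<Longrightarrow> k \<in> S \<Longrightarrow> (\<lambda>\<omega>. \<omega> k) \<in> measurable X (src_paths m k)"
  using measurable_component_singleton[of k S "src_paths m"] measurable_cong_sets[OF sets_fam refl, of X "src_paths m k"]
  by (auto simp: paths_def)

lemma src_integral:
  assumes X: "X \<in> fam m" "k \<in> S" and f: "f \<in> borel_measurable (paths m {k})"
  shows "(\<integral>\<^sup>+x. f (\<lambda>j\<in>{k}. x) \<partial>src X k) = (\<integral>\<^sup>+y. f y \<partial>law m X {k})"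
proof -
  have emb: "(\<lambda>x. \<lambda>j\<in>{k}. x) \<in> measurable (src_paths m k) (paths m {k})"
    unfolding paths_def by (rule measurable_restrict) auto
  have "(\<integral>\<^sup>+x. f (\<lambda>j\<in>{k}. x) \<partial>src X k) = (\<integral>\<^sup>+\<omega>. f (\<lambda>j\<in>{k}. \<omega> k) \<partial>X)"
    by (rule nn_integral_distr[OF measurable_source[OF X]]) (use measurable_compose[OF emb f] in simp)
  also have "\<dots> = (\<integral>\<^sup>+\<omega>. f (restrict \<omega> {k}) \<partial>X)"
    by (intro nn_integral_cong arg_cong[where f=f]) (auto simp: restrict_def)
  also have "\<dots> = (\<integral>\<^sup>+y. f y \<partial>law m X {k})"
    unfolding law_def by (rule nn_integral_distr[OF measurable_restr_fam, symmetric]) (use X f in auto)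
  finally show ?thesis .
qed

text \<open>
  Independence enters through this identity only: expectations of products of functions of the single
  sources factor.
\<close>
lemma indep_prod_integral:
  assumes X: "X \<in> FP" and f: "\<And>k. k \<in> S \<Longrightarrow> f k \<in> borel_measurable (paths m {k})"
  shows "(\<integral>\<^sup>+\<omega>. (\<Prod>k\<in>S. f k (restrict \<omega> {k})) \<partial>X) = (\<Prod>k\<in>S. \<integral>\<^sup>+y. f k y \<partial>law m X {k})"
proof -
  note X' = fam_PsiD[OF X]
  obtain k0 where k0: "k0 \<in> S" using sources_nonempty by auto
  define M where "M k = src X (if k \<in> S then k else k0)" for k
  have M: "prob_space (M k)" for k
    unfolding M_def using k0 by (intro prob_space.prob_space_distr prob_fam[OF X'] measurable_source[OF X']) auto
  interpret product_sigma_finite M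
    using M by (auto simp: product_sigma_finite_def prob_space_def finite_measure_def)
  have emb: "(\<lambda>x. \<lambda>j\<in>{k}. x) \<in> measurable (src_paths m k) (paths m {k})" for k
    unfolding paths_def by (rule measurable_restrict) auto
  have XM: "X = PiM S M"
    using indep X by (auto simp: independent_sources_def M_def cong: PiM_cong)
  have "(\<integral>\<^sup>+\<omega>. (\<Prod>k\<in>S. f k (restrict \<omega> {k})) \<partial>X) = (\<integral>\<^sup>+\<omega>. (\<Prod>k\<in>S. f k (\<lambda>j\<in>{k}. \<omega> k)) \<partial>PiM S M)"
    by (subst XM, intro nn_integral_cong prod.cong refl arg_cong[where f="f _"]) (auto simp: restrict_def)
  also have "\<dots> = (\<Prod>k\<in>S. \<integral>\<^sup>+x. f k (\<lambda>j\<in>{k}. x) \<partial>M k)"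
    by (rule product_nn_integral_prod) (auto simp: M_def intro!: measurable_compose[OF emb f])
  also have "\<dots> = (\<Prod>k\<in>S. \<integral>\<^sup>+y. f k y \<partial>law m X {k})"
    by (intro prod.cong refl) (simp add: M_def src_integral[OF X' _ f])
  finally show ?thesis .
qed

lemma law_full: assumes "P \<in> fam m" shows "law m P S = P"
proof -
  have "law m P S = distr P P (\<lambda>\<omega>. \<omega>)"
    unfolding law_def
    by (rule distr_cong) (auto simp: sets_fam[OF assms] space_fam[OF assms] space_paths PiE_restrict)
  then show ?thesis by simp
qed

lemma measurable_filt_restrict:
  assumes "s' \<subseteq> s" shows "(\<lambda>\<omega>. restrict \<omega> s') \<in> measurable (filt m s t) (filt m s' t)"
proof -
  let ?I = "{i. 1 \<le> i \<and> enat i \<le> t}"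
  let ?N = "\<lambda>k. PiM ?I (\<lambda>_. obs m k)"
  let ?r = "\<lambda>s \<omega>. \<lambda>k\<in>s. restrict (\<omega> k) ?I"
  have sp: "space (filt m s t) = space (paths m s)" by (simp add: filt_def Let_def)
  have r: "?r s \<in> measurable (filt m s t) (PiM s ?N)"
    unfolding filt_def Let_def
    by (rule measurable_vimage_algebra1)
       (auto simp: paths_def src_paths_def space_PiM PiE_def Pi_def extensional_def)
  have "(\<lambda>\<omega>. restrict (?r s \<omega>) s') \<in> measurable (filt m s t) (PiM s' ?N)"
    by (rule measurable_compose[OF r measurable_restrict_subset[OF assms]])
  also have "(\<lambda>\<omega>. restrict (?r s \<omega>) s') = (\<lambda>\<omega>. ?r s' (restrict \<omega> s'))"
    using assms by (auto simp: fun_eq_iff restrict_def)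
  finally have *: "(\<lambda>\<omega>. ?r s' (restrict \<omega> s')) \<in> measurable (filt m s t) (PiM s' ?N)" .
  show ?thesis
    unfolding filt_def[of m s'] Let_def
    by (rule measurable_vimage_algebra2[where g="\<lambda>\<omega>. restrict \<omega> s'" and f="?r s'", OF _ *])
       (use assms in \<open>auto simp: sp space_paths PiE_def Pi_def extensional_def\<close>)
qed

lemma RN_sub_measurable: "RN_deriv (sub Q s n) (sub P s n) \<in> borel_measurable (filt m s (enat n))"
  using borel_measurable_RN_deriv[of "sub Q s n" "sub P s n"]
  by (simp add: measurable_cong_sets[OF sets_sub refl])

lemma filt_measurable_paths: "f \<in> measurable (filt m s t) N \<Longrightarrow> f \<in> measurable (paths m s) N"
  by (rule measurable_from_subalg[OF filt_subalgebra])

lemma sub_change_of_measure: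
  assumes "P \<in> FP" "Q \<in> FP" "s \<noteq> {}" "s \<subseteq> S" "n \<ge> 1" and E: "E \<in> sets (filt m s (enat n))"
  shows "(\<integral>\<^sup>+y. RN_deriv (sub Q s n) (sub P s n) y * indicator E y \<partial>law m Q s) = emeasure (law m P s) E"
proof -
  interpret Q: sigma_finite_measure "sub Q s n" using sf_sub assms fam_PsiD by auto
  have "(\<integral>\<^sup>+y. RN_deriv (sub Q s n) (sub P s n) y * indicator E y \<partial>law m Q s)
      = (\<integral>\<^sup>+y. RN_deriv (sub Q s n) (sub P s n) y * indicator E y \<partial>sub Q s n)"
    by (rule nn_integral_subalgebra2[OF subalg, symmetric])
       (use RN_sub_measurable E in auto)
  also have "\<dots> = emeasure (density (sub Q s n) (RN_deriv (sub Q s n) (sub P s n))) E"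
    using E by (subst emeasure_density) auto
  also have "\<dots> = emeasure (sub P s n) E"
    using Q.density_RN_deriv[OF mutual_ac] assms by simp
  also have "\<dots> = emeasure (law m P s) E" by (rule emeasure_restr_to_subalg[OF subalg E])
  finally show ?thesis .
qed

lemma enn2real_prod: "enn2real (\<Prod>k\<in>A. f k) = (\<Prod>k\<in>A. enn2real (f k))"
  by (induction A rule: infinite_finite_induct) (auto simp: enn2real_mult)

text \<open>
  Both measures live on the sigma-algebra that is pulled back along the projection to the first \<open>n\<close>
  observations. It suffices to compare the image measures on rectangles, where both are products over the
  sources, by independence under \<open>P\<close> and under \<open>Q\<close> respectively.
\<close>
lemma density_lr_product:
  assumes P: "P \<in> FP" and Q: "Q \<in> FP" and n: "n \<ge> 1"
  defines "F \<equiv> \<lambda>\<omega>. \<Prod>k\<in>S. RN_deriv (sub Q {k} n) (sub P {k} n) (restrict \<omega> {k})"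
  shows "density (sub Q S n) F = sub P S n"
proof -
  note P' = fam_PsiD[OF P] and Q' = fam_PsiD[OF Q]
  let ?I = "{i. 1 \<le> i \<and> enat i \<le> enat n}"
  define N where "N = (\<lambda>k. PiM ?I (\<lambda>_. obs m k))"
  define r :: "nat set \<Rightarrow> 'x path \<Rightarrow> 'x path" where "r = (\<lambda>s \<omega>. \<lambda>k\<in>s. restrict (\<omega> k) ?I)"
  have rsp: "r s \<in> space (paths m s) \<rightarrow> space (PiM s N)" for s
    by (auto simp: r_def N_def paths_def src_paths_def space_PiM PiE_def Pi_def extensional_def)
  have filt_eq: "filt m s (enat n) = vimage_algebra (space (paths m s)) (r s) (PiM s N)" for s
    by (simp add: filt_def Let_def r_def N_def)
  have rm: "r s \<in> measurable (filt m s (enat n)) (PiM s N)" for s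
    unfolding filt_eq by (rule measurable_vimage_algebra1[OF rsp])
  have rX: "r S \<in> measurable X (PiM S N)" if "X \<in> fam m" for X
    using filt_measurable_paths[OF rm] measurable_cong_sets[OF sets_fam[OF that] refl] by blast
  have Fm: "F \<in> borel_measurable (filt m S (enat n))"
    unfolding F_def
    by (intro borel_measurable_prod_ennreal measurable_compose[OF measurable_filt_restrict RN_sub_measurable]) auto
  have FQ: "F \<in> borel_measurable Q"
    using filt_measurable_paths[OF Fm] measurable_cong_sets[OF sets_fam[OF Q'] refl] by blast
  have spQ: "space Q = space (paths m S)" and spP: "space P = space (paths m S)"
    using space_fam P' Q' by auto
  define \<mu> where "\<mu> = distr P (PiM S N) (r S)"
  define \<nu> where "\<nu> = distr (density Q F) (PiM S N) (r S)"
  have E: "{y\<in>space (paths m {k}). restrict (y k) ?I \<in> B} \<in> sets (filt m {k} (enat n))"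
    if "B \<in> sets (N k)" for k B
  proof -
    have "(\<lambda>y. r {k} y k) \<in> measurable (filt m {k} (enat n)) (N k)"
      by (rule measurable_compose[OF rm measurable_component_singleton]) simp
    from measurable_sets[OF this that] show ?thesis
      by (simp add: r_def vimage_def filt_eq Int_def conj_commute)
  qed
  have \<mu>\<nu>: "\<mu> = \<nu>"
  proof (rule measure_eqI_PiM_finite[where A="\<lambda>_. space (PiM S N)"])
    fix B assume B: "\<And>k. k \<in> S \<Longrightarrow> B k \<in> sets (N k)"
    define E where "E k = {y\<in>space (paths m {k}). restrict (y k) ?I \<in> B k}" for k
    have Es: "E k \<in> sets (filt m {k} (enat n))" if "k \<in> S" for k
      using E[OF B[OF that]] by (simp add: E_def)
    then have Es': "E k \<in> sets (paths m {k})" if "k \<in> S" for k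
      using filt_subalgebra[of m "{k}"] that by (auto simp: subalgebra_def)
    have BS: "Pi\<^sub>E S B \<in> sets (PiM S N)" using B by (intro sets_PiM_I_finite) auto
    have mem: "\<omega> \<in> r S -` Pi\<^sub>E S B \<inter> space (paths m S) \<longleftrightarrow> (\<forall>k\<in>S. restrict \<omega> {k} \<in> E k)"
      if "\<omega> \<in> space (paths m S)" for \<omega>
      using that by (auto simp: r_def E_def space_paths PiE_iff extensional_def)
    have ind: "indicator (r S -` Pi\<^sub>E S B \<inter> space (paths m S)) \<omega> = (\<Prod>k\<in>S. indicator (E k) (restrict \<omega> {k}) :: ennreal)"
      if "\<omega> \<in> space (paths m S)" for \<omega>
      using mem[OF that] by (auto simp: indicator_def prod_eq_1_iff intro!: prod_zero[symmetric])
    have "emeasure \<mu> (Pi\<^sub>E S B) = emeasure P (r S -` Pi\<^sub>E S B \<inter> space (paths m S))"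
      unfolding \<mu>_def using BS by (simp add: emeasure_distr[OF rX[OF P']] spP)
    also have "\<dots> = (\<integral>\<^sup>+\<omega>. indicator (r S -` Pi\<^sub>E S B \<inter> space (paths m S)) \<omega> \<partial>P)"
      using measurable_sets[OF rX[OF P'] BS] by (simp add: spP)
    also have "\<dots> = (\<integral>\<^sup>+\<omega>. (\<Prod>k\<in>S. indicator (E k) (restrict \<omega> {k})) \<partial>P)"
      by (intro nn_integral_cong ind) (simp add: spP)
    also have "\<dots> = (\<Prod>k\<in>S. \<integral>\<^sup>+y. indicator (E k) y \<partial>law m P {k})"
      by (rule indep_prod_integral[OF P]) (use Es' in auto)
    also have "\<dots> = (\<Prod>k\<in>S. emeasure (law m P {k}) (E k))"
      using Es' by (intro prod.cong refl nn_integral_indicator) auto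
    also have "\<dots> = (\<Prod>k\<in>S. \<integral>\<^sup>+y. RN_deriv (sub Q {k} n) (sub P {k} n) y * indicator (E k) y \<partial>law m Q {k})"
      by (intro prod.cong refl sub_change_of_measure[symmetric]) (use P Q n Es in auto)
    also have "\<dots> = (\<integral>\<^sup>+\<omega>. (\<Prod>k\<in>S. RN_deriv (sub Q {k} n) (sub P {k} n) (restrict \<omega> {k}) * indicator (E k) (restrict \<omega> {k})) \<partial>Q)"
      by (rule indep_prod_integral[OF Q, symmetric])
         (use Es' filt_measurable_paths[OF RN_sub_measurable] in auto)
    also have "\<dots> = (\<integral>\<^sup>+\<omega>. F \<omega> * indicator (r S -` Pi\<^sub>E S B \<inter> space (paths m S)) \<omega> \<partial>Q)"
      by (intro nn_integral_cong) (simp add: spQ ind F_def prod.distrib)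
    also have "\<dots> = emeasure (density Q F) (r S -` Pi\<^sub>E S B \<inter> space (paths m S))"
      using measurable_sets[OF rX[OF Q'] BS] FQ by (simp add: emeasure_density spQ)
    also have "\<dots> = emeasure \<nu> (Pi\<^sub>E S B)"
      unfolding \<nu>_def using BS rX[OF Q'] by (simp add: emeasure_distr spQ)
    finally show "emeasure \<mu> (Pi\<^sub>E S B) = emeasure \<nu> (Pi\<^sub>E S B)" .
  next
    show "range (\<lambda>_. space (PiM S N)) \<subseteq> prod_algebra S N"
      using space_in_prod_algebra[of S N] by (auto simp: space_PiM)
    show "emeasure \<mu> (space (PiM S N)) \<noteq> \<infinity>"
      using prob_space.emeasure_space_1[OF prob_space.prob_space_distr[OF prob_fam[OF P'] rX[OF P']]]
      by (simp add: \<mu>_def)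
  qed (auto simp: \<mu>_def \<nu>_def)
  show ?thesis
  proof (rule measure_eqI)
    fix E assume "E \<in> sets (density (sub Q S n) F)"
    then have E: "E \<in> sets (filt m S (enat n))" by simp
    then obtain B where B: "B \<in> sets (PiM S N)" "E = r S -` B \<inter> space (paths m S)"
      unfolding filt_eq sets_vimage_algebra2[OF rsp] by auto
    have EQ: "E \<in> sets Q" using E filt_subalgebra[of m S] sets_fam[OF Q'] by (auto simp: subalgebra_def)
    have "emeasure (density (sub Q S n) F) E = (\<integral>\<^sup>+\<omega>. F \<omega> * indicator E \<omega> \<partial>sub Q S n)"
      using E measurable_in_subalg[OF subalg Fm] by (subst emeasure_density) auto
    also have "\<dots> = (\<integral>\<^sup>+\<omega>. F \<omega> * indicator E \<omega> \<partial>Q)"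
      by (subst nn_integral_subalgebra2[OF subalg]) (use Fm E law_full[OF Q'] in auto)
    also have "\<dots> = emeasure \<nu> B"
      unfolding \<nu>_def using B rX[OF Q'] FQ EQ by (simp add: emeasure_distr emeasure_density spQ)
    also have "\<dots> = emeasure P E"
      unfolding \<mu>\<nu>[symmetric] \<mu>_def using B rX[OF P'] by (simp add: emeasure_distr spP)
    also have "\<dots> = emeasure (sub P S n) E"
      using emeasure_restr_to_subalg[OF subalg E, of P] unfolding law_full[OF P'] by (rule sym)
    finally show "emeasure (density (sub Q S n) F) E = emeasure (sub P S n) E" .
  qed simp
qed

lemma AE_lr_product:
  assumes P: "P \<in> FP" and Q: "Q \<in> FP" and P': "P' \<in> FP" and n: "n \<ge> 1"
  shows "AE \<omega> in P'. L S n P Q \<omega> = (\<Prod>k\<in>S. L {k} n P Q \<omega>)"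
proof -
  let ?F = "\<lambda>\<omega>. \<Prod>k\<in>S. RN_deriv (sub Q {k} n) (sub P {k} n) (restrict \<omega> {k})"
  interpret Q: sigma_finite_measure "sub Q S n" using sf_sub Q fam_PsiD by auto
  have Fm: "?F \<in> borel_measurable (sub Q S n)"
    unfolding measurable_cong_sets[OF sets_sub refl]
    by (intro borel_measurable_prod_ennreal measurable_compose[OF measurable_filt_restrict RN_sub_measurable]) auto
  have "AE \<omega> in sub Q S n. ?F \<omega> = RN_deriv (sub Q S n) (sub P S n) \<omega>"
    by (rule Q.RN_deriv_unique[OF Fm density_lr_product[OF P Q n]])
  then have "AE \<omega> in sub P' S n. ?F \<omega> = RN_deriv (sub Q S n) (sub P S n) \<omega>"
    by (rule absolutely_continuous_AE[rotated 2]) (use mutual_ac[OF Q P' sources_nonempty _ n] in auto)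
  from AE_sub_lift[OF fam_PsiD[OF P'] _ this]
  have "AE \<omega> in P'. ?F (restrict \<omega> S) = RN_deriv (sub Q S n) (sub P S n) (restrict \<omega> S)" by simp
  then show ?thesis
  proof eventually_elim
    case (elim \<omega>)
    have "restrict (restrict \<omega> S) {k} = restrict \<omega> {k}" if "k \<in> S" for k
      using that by (auto simp: restrict_def)
    then show ?case using arg_cong[OF elim, of enn2real, symmetric]
      by (simp add: lr_def enn2real_prod)
  qed
qed

text \<open>
  All statements about likelihood ratios are used on these paths only. Quantifying over all times and
  laws here keeps the exceptional null set independent of them.
\<close>
definition regular :: "'x path \<Rightarrow> bool" where
  "regular \<omega> \<longleftrightarrow> (\<forall>n\<ge>1. \<forall>P\<in>FP. \<forall>Q\<in>FP.
     (\<forall>s. s \<noteq> {} \<and> s \<subseteq> S \<longrightarrow> (\<forall>R\<in>FP. 0 < L s n P Q \<omega> \<and> L s n P R \<omega> = L s n P Q \<omega> * L s n Q R \<omega>)) \<and>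
     L S n P Q \<omega> = (\<Prod>k\<in>S. L {k} n P Q \<omega>))"

lemma AE_regular: assumes "P' \<in> FP" shows "AE \<omega> in P'. regular \<omega>"
proof -
  let ?Ss = "{s. s \<noteq> {} \<and> s \<subseteq> S}"
  have fin: "countable FP" "countable ?Ss" using finite_FP by (auto intro: countable_finite)
  have chain: "\<forall>n\<in>{1..}. \<forall>P\<in>FP. \<forall>Q\<in>FP. \<forall>s\<in>?Ss. \<forall>R\<in>FP.
      AE \<omega> in P'. 0 < L s n P Q \<omega> \<and> L s n P R \<omega> = L s n P Q \<omega> * L s n Q R \<omega>"
    using assms by (intro ballI AE_lr_chain) auto
  have prd: "\<forall>n\<in>{1..}. \<forall>P\<in>FP. \<forall>Q\<in>FP. AE \<omega> in P'. L S n P Q \<omega> = (\<Prod>k\<in>S. L {k} n P Q \<omega>)"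
    using assms by (intro ballI AE_lr_product) auto
  have "AE \<omega> in P'. (\<forall>n\<in>{1..}. \<forall>P\<in>FP. \<forall>Q\<in>FP. \<forall>s\<in>?Ss. \<forall>R\<in>FP.
      0 < L s n P Q \<omega> \<and> L s n P R \<omega> = L s n P Q \<omega> * L s n Q R \<omega>) \<and>
      (\<forall>n\<in>{1..}. \<forall>P\<in>FP. \<forall>Q\<in>FP. L S n P Q \<omega> = (\<Prod>k\<in>S. L {k} n P Q \<omega>))"
  proof (rule AE_conjI)
    show "AE \<omega> in P'. \<forall>n\<in>{1..}. \<forall>P\<in>FP. \<forall>Q\<in>FP. \<forall>s\<in>?Ss. \<forall>R\<in>FP.
      0 < L s n P Q \<omega> \<and> L s n P R \<omega> = L s n P Q \<omega> * L s n Q R \<omega>"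
      using chain unfolding AE_ball_countable[OF fin(1)] AE_ball_countable[OF fin(2)]
        AE_ball_countable[OF countableI_type] .
    show "AE \<omega> in P'. \<forall>n\<in>{1..}. \<forall>P\<in>FP. \<forall>Q\<in>FP. L S n P Q \<omega> = (\<Prod>k\<in>S. L {k} n P Q \<omega>)"
      using prd unfolding AE_ball_countable[OF fin(1)] AE_ball_countable[OF countableI_type] .
  qed
  then show ?thesis
  proof eventually_elim
    case (elim \<omega>)
    show ?case unfolding regular_def using elim by blast
  qed
qed

lemma regularD:
  assumes "regular \<omega>" "n \<ge> 1" "P \<in> FP" "Q \<in> FP" "s \<noteq> {}" "s \<subseteq> S"
  shows "0 < L s n P Q \<omega>" "\<And>R. R \<in> FP \<Longrightarrow> L s n P R \<omega> = L s n P Q \<omega> * L s n Q R \<omega>"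
  using assms unfolding regular_def by blast+

lemma regular_product: "regular \<omega> \<Longrightarrow> n \<ge> 1 \<Longrightarrow> P \<in> FP \<Longrightarrow> Q \<in> FP \<Longrightarrow> L S n P Q \<omega> = (\<Prod>k\<in>S. L {k} n P Q \<omega>)"
  unfolding regular_def by blast

lemma regular_refl: assumes "regular \<omega>" "n \<ge> 1" "P \<in> FP" "s \<noteq> {}" "s \<subseteq> S" shows "L s n P P \<omega> = 1"
  using regularD(1)[OF assms(1-3,3-5)] regularD(2)[OF assms(1-3,3-5) assms(3)] by simp

end

section \<open>Largest products over sets of bounded size\<close>

text \<open>
  The isolation statistic in terms of local ratios \<open>y\<close>: at most \<open>u\<close> factors, with \<open>k\<close> among them or not. The empty
  set is excluded in the second case because the corresponding hypothesis excludes the global null.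
\<close>
definition best_alt :: "'i set \<Rightarrow> nat \<Rightarrow> ('i \<Rightarrow> real) \<Rightarrow> 'i \<Rightarrow> real" where
  "best_alt S u y k = Max ((\<lambda>A. \<Prod>j\<in>A. y j) ` {A. A \<subseteq> S \<and> card A \<le> u \<and> k \<in> A})"

definition best_null :: "'i set \<Rightarrow> nat \<Rightarrow> ('i \<Rightarrow> real) \<Rightarrow> 'i \<Rightarrow> real" where
  "best_null S u y k = Max ((\<lambda>A. \<Prod>j\<in>A. y j) ` {A. A \<subseteq> S \<and> card A \<le> u \<and> A \<noteq> {} \<and> k \<notin> A})"

definition iso_ratio :: "'i set \<Rightarrow> nat \<Rightarrow> ('i \<Rightarrow> real) \<Rightarrow> 'i \<Rightarrow> real" where
  "iso_ratio S u y k = best_alt S u y k / best_null S u y k"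

lemma iso_ratio_reindex:
  assumes "bij_betw \<sigma> I S" "finite I" "i \<in> I"
  shows "iso_ratio S u y (\<sigma> i) = iso_ratio I u (\<lambda>i. y (\<sigma> i)) i"
proof -
  have inj: "inj_on \<sigma> I" and S: "S = \<sigma> ` I" using assms(1) by (auto simp: bij_betw_def)
  have prod: "(\<Prod>j\<in>\<sigma> ` A. y j) = (\<Prod>j\<in>A. y (\<sigma> j))" if "A \<subseteq> I" for A
    using inj_on_subset[OF inj that] by (simp add: prod.reindex)
  have crd: "card (\<sigma> ` A) = card A" if "A \<subseteq> I" for A
    using inj_on_subset[OF inj that] by (rule card_image)
  have mem: "\<sigma> i \<in> \<sigma> ` A \<longleftrightarrow> i \<in> A" if "A \<subseteq> I" for A
    using inj that assms(3) by (auto simp: inj_on_def)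
  have 1: "{A. A \<subseteq> S \<and> card A \<le> u \<and> \<sigma> i \<in> A} = (`) \<sigma> ` {A. A \<subseteq> I \<and> card A \<le> u \<and> i \<in> A}"
  proof (intro equalityI subsetI)
    fix A assume A: "A \<in> {A. A \<subseteq> S \<and> card A \<le> u \<and> \<sigma> i \<in> A}"
    then obtain A' where "A' \<subseteq> I" "A = \<sigma> ` A'" unfolding S by (auto simp: subset_image_iff)
    with A crd mem show "A \<in> (`) \<sigma> ` {A. A \<subseteq> I \<and> card A \<le> u \<and> i \<in> A}" by (auto intro!: imageI)
  qed (auto simp: S crd)
  have 2: "{A. A \<subseteq> S \<and> card A \<le> u \<and> A \<noteq> {} \<and> \<sigma> i \<notin> A} = (`) \<sigma> ` {A. A \<subseteq> I \<and> card A \<le> u \<and> A \<noteq> {} \<and> i \<notin> A}"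
  proof (intro equalityI subsetI)
    fix A assume A: "A \<in> {A. A \<subseteq> S \<and> card A \<le> u \<and> A \<noteq> {} \<and> \<sigma> i \<notin> A}"
    then obtain A' where A': "A' \<subseteq> I" "A = \<sigma> ` A'" unfolding S by (auto simp: subset_image_iff)
    with A crd[OF A'(1)] mem[OF A'(1)] have "A' \<in> {A. A \<subseteq> I \<and> card A \<le> u \<and> A \<noteq> {} \<and> i \<notin> A}" by auto
    with A' show "A \<in> (`) \<sigma> ` {A. A \<subseteq> I \<and> card A \<le> u \<and> A \<noteq> {} \<and> i \<notin> A}" by blast
  next
    fix A assume "A \<in> (`) \<sigma> ` {A. A \<subseteq> I \<and> card A \<le> u \<and> A \<noteq> {} \<and> i \<notin> A}"
    then obtain A' where "A' \<subseteq> I" "card A' \<le> u" "A' \<noteq> {}" "i \<notin> A'" "A = \<sigma> ` A'" by auto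
    with crd mem show "A \<in> {A. A \<subseteq> S \<and> card A \<le> u \<and> A \<noteq> {} \<and> \<sigma> i \<notin> A}"
      by (auto simp: S)
  qed
  have "best_alt S u y (\<sigma> i) = best_alt I u (\<lambda>i. y (\<sigma> i)) i"
    unfolding best_alt_def 1 image_image by (intro arg_cong[where f=Max] image_cong refl) (auto simp: prod)
  moreover have "best_null S u y (\<sigma> i) = best_null I u (\<lambda>i. y (\<sigma> i)) i"
    unfolding best_null_def 2 image_image by (intro arg_cong[where f=Max] image_cong refl) (auto simp: prod)
  ultimately show ?thesis by (simp add: iso_ratio_def)
qed

text \<open>
  Exchange argument. Passing from \<open>A\<close> to \<open>T\<close> drops the elements of \<open>A - T\<close>, each contributing at most \<open>t\<close>, and gains
  those of \<open>T - A\<close>, each contributing at least \<open>t \<ge> 1\<close>. If \<open>T\<close> uses up the cap, at least as many are gained as lost;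
  if \<open>t = 1\<close>, the lost product is at most 1 and the gained one at least 1.
\<close>
lemma top_set_optimal:
  fixes y :: "'i \<Rightarrow> real"
  assumes S: "finite S" "\<And>j. j \<in> S \<Longrightarrow> 0 < y j"
    and T: "T \<subseteq> S" "1 \<le> t" "\<And>j. j \<in> T \<Longrightarrow> t \<le> y j" "\<And>j. j \<in> S - T \<Longrightarrow> y j \<le> t"
    and c: "card T = c \<or> t = 1"
    and A: "A \<subseteq> S" "card A \<le> c"
  shows "(\<Prod>j\<in>A. y j) \<le> (\<Prod>j\<in>T. y j)"
proof -
  have fin: "finite A" "finite T" using S A T by (auto intro: finite_subset)
  have pos: "0 \<le> (\<Prod>j\<in>A \<inter> T. y j)" using A S by (intro prod_nonneg) (auto intro: less_imp_le)
  have "(\<Prod>j\<in>A - T. y j) \<le> (\<Prod>j\<in>A - T. t)"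
    using A T by (intro prod_mono) (auto intro!: less_imp_le[OF S(2)])
  also have "\<dots> = t ^ card (A - T)" by simp
  also have "\<dots> \<le> t ^ card (T - A)"
  proof (cases "t = 1")
    case False
    then have "card T = c" using c by simp
    then have "card (A - T) \<le> card (T - A)"
      using A fin card_Int_Diff[of A T] card_Int_Diff[of T A] by (simp add: Int_commute)
    then show ?thesis using T(2) by (intro power_increasing)
  qed simp
  also have "\<dots> = (\<Prod>j\<in>T - A. t)" by simp
  also have "\<dots> \<le> (\<Prod>j\<in>T - A. y j)" using T by (intro prod_mono) auto
  finally have le: "(\<Prod>j\<in>A - T. y j) \<le> (\<Prod>j\<in>T - A. y j)" .
  have "(\<Prod>j\<in>A. y j) = (\<Prod>j\<in>A \<inter> T. y j) * (\<Prod>j\<in>A - T. y j)"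
    using fin by (subst prod.union_disjoint[symmetric]) (auto intro: prod.cong)
  also have "\<dots> \<le> (\<Prod>j\<in>A \<inter> T. y j) * (\<Prod>j\<in>T - A. y j)" using pos le by (rule mult_left_mono[rotated])
  also have "\<dots> = (\<Prod>j\<in>T. y j)"
    using fin by (subst prod.union_disjoint[symmetric]) (auto intro: prod.cong)
  finally show ?thesis .
qed

lemma best_alt_eq:
  fixes y :: "'i \<Rightarrow> real"
  assumes S: "finite S" "k \<in> S" "\<And>j. j \<in> S \<Longrightarrow> 0 < y j" and u: "1 \<le> u"
    and T: "T \<subseteq> S - {k}" "card T \<le> u - 1" "1 \<le> t" "\<And>j. j \<in> T \<Longrightarrow> t \<le> y j" "\<And>j. j \<in> S - {k} - T \<Longrightarrow> y j \<le> t"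
    and c: "card T = u - 1 \<or> t = 1"
  shows "best_alt S u y k = y k * (\<Prod>j\<in>T. y j)"
  unfolding best_alt_def
proof (rule Max_eqI)
  have fT: "finite T" "k \<notin> T" using S T by (auto intro: finite_subset)
  show "y k * (\<Prod>j\<in>T. y j) \<in> (\<lambda>A. \<Prod>j\<in>A. y j) ` {A. A \<subseteq> S \<and> card A \<le> u \<and> k \<in> A}"
    using fT T S u by (intro image_eqI[of _ _ "insert k T"]) auto
  fix x assume "x \<in> (\<lambda>A. \<Prod>j\<in>A. y j) ` {A. A \<subseteq> S \<and> card A \<le> u \<and> k \<in> A}"
  then obtain A where A: "A \<subseteq> S" "card A \<le> u" "k \<in> A" "x = (\<Prod>j\<in>A. y j)" by auto
  have fA: "finite A" using A S by (auto intro: finite_subset)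
  have "(\<Prod>j\<in>A - {k}. y j) \<le> (\<Prod>j\<in>T. y j)"
    by (rule top_set_optimal[where S="S - {k}" and t=t and c="u-1"]) (use assms A fA in auto)
  then show "x \<le> y k * (\<Prod>j\<in>T. y j)"
    using A fA S by (simp add: prod.remove[of A k] less_imp_le)
qed (use S in auto)

lemma best_null_eq:
  fixes y :: "'i \<Rightarrow> real"
  assumes S: "finite S" "\<And>j. j \<in> S \<Longrightarrow> 0 < y j"
    and T: "T \<subseteq> S - {k}" "T \<noteq> {}" "card T \<le> u" "1 \<le> t" "\<And>j. j \<in> T \<Longrightarrow> t \<le> y j" "\<And>j. j \<in> S - {k} - T \<Longrightarrow> y j \<le> t"
    and c: "card T = u \<or> t = 1"
  shows "best_null S u y k = (\<Prod>j\<in>T. y j)"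
  unfolding best_null_def
proof (rule Max_eqI)
  show "(\<Prod>j\<in>T. y j) \<in> (\<lambda>A. \<Prod>j\<in>A. y j) ` {A. A \<subseteq> S \<and> card A \<le> u \<and> A \<noteq> {} \<and> k \<notin> A}"
    using T by (intro image_eqI[of _ _ T]) auto
  fix x assume "x \<in> (\<lambda>A. \<Prod>j\<in>A. y j) ` {A. A \<subseteq> S \<and> card A \<le> u \<and> A \<noteq> {} \<and> k \<notin> A}"
  then obtain A where A: "A \<subseteq> S - {k}" "card A \<le> u" "x = (\<Prod>j\<in>A. y j)" by auto
  have "(\<Prod>j\<in>A. y j) \<le> (\<Prod>j\<in>T. y j)"
    by (rule top_set_optimal[where S="S - {k}" and t=t and c=u]) (use assms A in auto)
  then show "x \<le> (\<Prod>j\<in>T. y j)" using A by simp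
qed (use S in auto)

text \<open>
  A nonempty product of factors that are at most 1 is at most each of them, so a single largest factor is best; the
  empty product would exceed it.
\<close>
lemma best_null_single:
  fixes y :: "'i \<Rightarrow> real"
  assumes S: "finite S" "\<And>j. j \<in> S \<Longrightarrow> 0 < y j" and u: "1 \<le> u"
    and l: "l \<in> S - {k}" "\<And>j. j \<in> S - {k} \<Longrightarrow> y j \<le> y l" "y l \<le> 1"
  shows "best_null S u y k = y l"
  unfolding best_null_def
proof (rule Max_eqI)
  show "y l \<in> (\<lambda>A. \<Prod>j\<in>A. y j) ` {A. A \<subseteq> S \<and> card A \<le> u \<and> A \<noteq> {} \<and> k \<notin> A}"
    using l u by (intro image_eqI[of _ _ "{l}"]) auto
  fix x assume "x \<in> (\<lambda>A. \<Prod>j\<in>A. y j) ` {A. A \<subseteq> S \<and> card A \<le> u \<and> A \<noteq> {} \<and> k \<notin> A}"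
  then obtain A where A: "A \<subseteq> S - {k}" "A \<noteq> {}" "x = (\<Prod>j\<in>A. y j)" by auto
  then obtain a where a: "a \<in> A" by auto
  have fA: "finite A" using A S by (auto intro: finite_subset)
  have "(\<Prod>j\<in>A - {a}. y j) \<le> 1"
  proof (rule prod_le_1)
    fix j assume "j \<in> A - {a}"
    then have "j \<in> S - {k}" using A by auto
    then show "0 \<le> y j \<and> y j \<le> 1" using S(2)[of j] l(2)[of j] l(3) by auto
  qed
  then have "x \<le> y a" using A(1,3) a fA S by (simp add: prod.remove[of A a] less_imp_le mult_left_le subset_iff)
  also have "y a \<le> y l" using l A a by auto
  finally show "x \<le> y l" .
qed (use S in auto)

lemma cancel_ratio: "N = x * q \<Longrightarrow> D = z * q \<Longrightarrow> 0 < q \<Longrightarrow> N / D = x / (z :: real)"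
  by simp

lemma not_in_gap_iff: "x \<notin> {l<..<c} \<longleftrightarrow> x \<le> l \<or> c \<le> (x::real)" by auto

locale sorted_ratios =
  fixes K u :: nat and y :: "nat \<Rightarrow> real"
  assumes u: "1 \<le> u" "u < K"
    and pos: "\<And>i. i \<in> {1..K} \<Longrightarrow> 0 < y i"
    and anti: "\<And>i j. 1 \<le> i \<Longrightarrow> i \<le> j \<Longrightarrow> j \<le> K \<Longrightarrow> y j \<le> y i"

begin

definition "p = card {i\<in>{1..K}. 1 < y i}"

abbreviation "isol \<equiv> iso_ratio {1..K} u y"

lemma exceeding_one: "{i\<in>{1..K}. 1 < y i} = {1..p}"
proof -
  let ?S = "{i\<in>{1..K}. 1 < y i}"
  have "?S = {1..card ?S}"
  proof (cases "?S = {}")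
    case False
    define M where "M = Max ?S"
    have M: "M \<in> ?S" unfolding M_def by (rule Max_in) (use False in auto)
    have "?S = {1..M}"
    proof (intro equalityI subsetI)
      fix i assume "i \<in> {1..M}"
      then show "i \<in> ?S" using M anti[of i M] by auto
    next
      fix i assume i: "i \<in> ?S"
      then have "i \<le> M" unfolding M_def by (intro Max_ge) auto
      with i show "i \<in> {1..M}" by auto
    qed
    then show ?thesis by simp
  qed simp
  then show ?thesis by (simp add: p_def)
qed

lemma exceeding_one_iff: "1 \<le> i \<Longrightarrow> i \<le> K \<Longrightarrow> 1 < y i \<longleftrightarrow> i \<le> p"
  using exceeding_one by (auto simp: set_eq_iff)

lemma p_le: "p \<le> K" 
  unfolding p_def by (rule order_trans[OF card_mono[of "{1..K}"]]) auto

lemma gt_one: "1 \<le> i \<Longrightarrow> i \<le> p \<Longrightarrow> 1 < y i" using exceeding_one_iff[of i] p_le by auto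

lemma le_one: "p < i \<Longrightarrow> i \<le> K \<Longrightarrow> y i \<le> 1" using exceeding_one_iff[of i] by (auto simp: not_less)

text \<open>
  When all ratios above 1 fit under the cap, the same other sources are best together with \<open>i\<close> and without it, and
  their product cancels.
\<close>
lemma iso_ratio_below_cap: assumes p: "1 < p" "p < u \<or> (p = u \<and> i \<le> u)" and i: "i \<in> {1..K}" shows "isol i = y i"
proof -
  let ?T = "{1..p} - {i}"
  have c: "card ?T \<le> u - 1" using p i by (cases "i \<le> p") (auto simp: card_Diff_singleton_if)
  have "(if i = 1 then 2 else 1) \<in> ?T" using p by auto
  then have ne: "?T \<noteq> {}" by blast
  have "best_alt {1..K} u y i = y i * (\<Prod>j\<in>?T. y j)"
    by (rule best_alt_eq[where t=1]) (use i u c p_le pos gt_one le_one in \<open>auto intro: less_imp_le\<close>)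
  moreover have "best_null {1..K} u y i = (\<Prod>j\<in>?T. y j)"
    by (rule best_null_eq[where t=1]) (use i u c ne p_le pos gt_one le_one in \<open>auto intro: less_imp_le\<close>)
  moreover have "(\<Prod>j\<in>?T. y j) > 0" using pos p_le by (intro prod_pos) auto
  ultimately have "isol i = y i / 1" unfolding iso_ratio_def by (intro cancel_ratio) simp_all
  then show ?thesis by simp
qed

text \<open>
  Including \<open>i\<close> displaces the last of the \<open>u\<close> best.
\<close>
lemma iso_ratio_outside_top: assumes p: "u \<le> p" and i: "u < i" "i \<le> K" shows "isol i = y i / y u"
proof -
  have "best_alt {1..K} u y i = y i * (\<Prod>j\<in>{1..u-1}. y j)"
    by (rule best_alt_eq[where t="y u"]) (use i u p pos gt_one anti in \<open>auto intro: less_imp_le\<close>)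
  moreover have "best_null {1..K} u y i = (\<Prod>j\<in>{1..u}. y j)"
    by (rule best_null_eq[where t="y u"]) (use i u p pos gt_one anti in \<open>auto intro: less_imp_le\<close>)
  moreover have "(\<Prod>j\<in>{1..u}. y j) = y u * (\<Prod>j\<in>{1..u-1}. y j)"
    using u by (cases u) (auto simp: mult.commute)
  moreover have "(\<Prod>j\<in>{1..u-1}. y j) > 0" using pos u by (intro prod_pos) auto
  ultimately show ?thesis unfolding iso_ratio_def by (intro cancel_ratio) simp_all
qed

text \<open>
  Without \<open>i\<close> the next ratio after the \<open>u\<close> best fills its place.
\<close>
lemma iso_ratio_inside_top: assumes p: "u < p" and i: "1 \<le> i" "i \<le> u" shows "isol i = y i / y (Suc u)"
proof -
  let ?T = "{1..u} - {i}" let ?T' = "insert (Suc u) ?T"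
  have T': "?T' = {1..Suc u} - {i}" using i by auto
  have "Suc u \<in> {1..Suc u} - {i}" using i by auto
  then have ne: "{1..Suc u} - {i} \<noteq> {}" by blast
  have "best_alt {1..K} u y i = y i * (\<Prod>j\<in>?T. y j)"
    by (rule best_alt_eq[where t="y u"]) (use i u p pos gt_one anti in \<open>auto intro: less_imp_le\<close>)
  moreover have "best_null {1..K} u y i = (\<Prod>j\<in>?T'. y j)" unfolding T'
    by (rule best_null_eq[where t="y (Suc u)"]) (use i u p p_le pos gt_one anti ne in \<open>auto intro: less_imp_le\<close>)
  moreover have "(\<Prod>j\<in>?T'. y j) = y (Suc u) * (\<Prod>j\<in>?T. y j)" by simp
  moreover have "(\<Prod>j\<in>?T. y j) > 0" using pos u by (intro prod_pos) auto
  ultimately show ?thesis unfolding iso_ratio_def by (intro cancel_ratio) simp_all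
qed

text \<open>
  With the best set \<open>{1}\<close> excluded and the empty set not admitted, the second largest ratio is the best alternative.
\<close>
lemma iso_ratio_single_top: assumes p: "p = 1" shows "isol 1 = y 1 / y 2"
proof -
  have "best_alt {1..K} u y 1 = y 1 * (\<Prod>j\<in>{}. y j)"
    by (rule best_alt_eq[where t=1]) (use u p pos le_one in auto)
  moreover have "best_null {1..K} u y 1 = y 2"
    by (rule best_null_single) (use u p pos le_one anti in auto)
  ultimately show ?thesis by (simp add: iso_ratio_def)
qed

lemma iso_ratio_single_rest: assumes p: "p = 1" "1 < u" and i: "1 < i" "i \<le> K" shows "isol i = y i"
proof -
  have "best_alt {1..K} u y i = y i * (\<Prod>j\<in>{1}. y j)"
    by (rule best_alt_eq[where t=1]) (use u p i pos le_one gt_one[of 1] in auto)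
  moreover have "best_null {1..K} u y i = (\<Prod>j\<in>{1}. y j)"
    by (rule best_null_eq[where t=1]) (use u p i pos le_one gt_one[of 1] in auto)
  ultimately show ?thesis using pos[of 1] u by (simp add: iso_ratio_def)
qed

text \<open>
  The condition of \<open>tau1\<close>, and below it those of \<open>time1\<close> to \<open>time4\<close>, for sorted local ratios.
\<close>
definition "stop a c \<longleftrightarrow> (\<exists>i\<in>{1..K}. c \<le> y i) \<and> (\<forall>i\<in>{1..K}. isol i \<notin> {1 / a<..<c}) \<and>
   {i\<in>{1..K}. 1 < isol i} \<noteq> {} \<and> card {i\<in>{1..K}. 1 < isol i} \<le> u"

definition "stop1 a c \<longleftrightarrow> c \<le> y 1 \<and> y 2 \<le> min (1 / a) (y 1 / c)"

definition "stop2 a c \<longleftrightarrow> 1 < p \<and> p < u \<and> c \<le> y 1 \<and> (\<forall>i\<in>{1..K}. y i \<notin> {1 / a<..<c})"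

definition "stop3 a c \<longleftrightarrow> p = u \<and> max c (a * y (u + 1)) \<le> y u"

definition "stop4 a c \<longleftrightarrow> u < p \<and> c \<le> y 1 \<and> y (u + 1) * max a c \<le> y u"

lemma some_ge_iff: "(\<exists>i\<in>{1..K}. c \<le> y i) \<longleftrightarrow> c \<le> y 1"
proof
  assume "\<exists>i\<in>{1..K}. c \<le> y i"
  then obtain i where "i \<in> {1..K}" "c \<le> y i" by blast
  then show "c \<le> y 1" using anti[of 1 i] by auto
qed (use u in \<open>auto intro!: bexI[of _ 1]\<close>)

text \<open>
  The gap lies around 1, so among the values on either side of the cut between \<open>q\<close> and \<open>r\<close> those at the cut are
  closest to it.
\<close>
lemma
  fixes f :: "nat \<Rightarrow> real"
  assumes ac: "1 < a" "1 < c" and q: "1 \<le> q" "r = Suc q" "r \<le> K"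
    and hi: "1 \<le> f q" "\<And>i. 1 \<le> i \<Longrightarrow> i \<le> q \<Longrightarrow> f q \<le> f i"
    and lo: "f r \<le> 1" "\<And>i. r \<le> i \<Longrightarrow> i \<le> K \<Longrightarrow> f i \<le> f r"
  shows gap_iff: "(\<forall>i\<in>{1..K}. f i \<notin> {1 / a<..<c}) \<longleftrightarrow> f r \<le> 1 / a \<and> c \<le> f q"
    and exceeding_subset: "{i\<in>{1..K}. 1 < f i} \<subseteq> {1..q}"
    and exceeding_eq: "1 < f q \<Longrightarrow> {i\<in>{1..K}. 1 < f i} = {1..q}"
proof -
  have ia: "1 / a < 1" using ac by simp
  have mem: "q \<in> {1..K}" "r \<in> {1..K}" using q by auto
  show "(\<forall>i\<in>{1..K}. f i \<notin> {1 / a<..<c}) \<longleftrightarrow> f r \<le> 1 / a \<and> c \<le> f q"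
  proof
    assume "\<forall>i\<in>{1..K}. f i \<notin> {1 / a<..<c}"
    then have "f q \<notin> {1 / a<..<c}" "f r \<notin> {1 / a<..<c}" using mem by blast+
    then show "f r \<le> 1 / a \<and> c \<le> f q" using hi(1) lo(1) ia ac unfolding not_in_gap_iff by linarith
  next
    assume A: "f r \<le> 1 / a \<and> c \<le> f q"
    show "\<forall>i\<in>{1..K}. f i \<notin> {1 / a<..<c}"
    proof
      fix i assume "i \<in> {1..K}"
      then show "f i \<notin> {1 / a<..<c}" using A hi(2)[of i] lo(2)[of i] q by (cases "i \<le> q") auto
    qed
  qed
  show sub: "{i\<in>{1..K}. 1 < f i} \<subseteq> {1..q}"
  proof
    fix i assume i: "i \<in> {i\<in>{1..K}. 1 < f i}"
    show "i \<in> {1..q}"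
    proof (rule ccontr)
      assume "i \<notin> {1..q}"
      then have "f i \<le> 1" using lo(1) lo(2)[of i] i q by auto
      with i show False by simp
    qed
  qed
  show "{i\<in>{1..K}. 1 < f i} = {1..q}" if "1 < f q"
  proof (intro equalityI sub subsetI)
    fix i assume "i \<in> {1..q}"
    then show "i \<in> {i\<in>{1..K}. 1 < f i}" using hi(2)[of i] that q by auto
  qed
qed

text \<open>
  In each range of \<open>p\<close> the isolation ratios are known explicitly, and those at the positions next to the cut decide. The
  case \<open>p = 1\<close> splits because a single signal exhausts the cap if \<open>u = 1\<close>: the other sources then have ratio \<open>y i / y 1\<close>
  instead of \<open>y i\<close>, and the condition of \<open>time3\<close>, which that of \<open>time1\<close> implies, is the relevant one.
\<close>
lemma stop_iff:
  assumes ac: "1 < a" "1 < c"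
  shows "stop a c \<longleftrightarrow> stop1 a c \<or> stop2 a c \<or> stop3 a c \<or> stop4 a c"
proof -
  have ia: "1 / a < 1" "0 < 1 / a" using ac by auto
  have pos: "y 1 > 0" "y 2 > 0" "y u > 0" "y (Suc u) > 0" using pos u by auto
  have e: "c \<le> y 1 / y 2 \<longleftrightarrow> c * y 2 \<le> y 1" "y 2 \<le> y 1 / c \<longleftrightarrow> c * y 2 \<le> y 1"
    "y 2 / y 1 \<le> 1 / a \<longleftrightarrow> a * y 2 \<le> y 1" "y (Suc u) / y u \<le> 1 / a \<longleftrightarrow> a * y (Suc u) \<le> y u"
    "c \<le> y u / y (Suc u) \<longleftrightarrow> c * y (Suc u) \<le> y u"
    using pos ac by (simp_all add: field_simps)
  have n1: "\<not> stop1 a c" if "2 \<le> p"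
  proof -
    have "1 / a < y 2" using gt_one[of 2] that ia by linarith
    then show ?thesis by (auto simp: stop1_def)
  qed
  consider "p = 0" | "p = 1" "1 < u" | "p = 1" "u = 1" | "1 < p" "p < u" | "1 < p" "p = u" | "u < p"
    using u by linarith
  then show ?thesis
  proof cases
    case 1
    then have "\<not> c \<le> y 1" using le_one[of 1] u ac by auto
    then show ?thesis using 1 u unfolding stop_def some_ge_iff by (auto simp: stop1_def stop2_def stop3_def stop4_def)
  next
    case 2
    have g: "1 < y 1" "y 2 \<le> 1" using gt_one[of 1] le_one[of 2] 2 u by auto
    have i1: "isol 1 = y 1 / y 2" and i2: "isol 2 = y 2" using 2 u iso_ratio_single_top iso_ratio_single_rest[of 2] by auto
    have f1: "1 < isol 1" unfolding i1 using g pos by simp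
    have hi: "isol 1 \<le> isol i" if "1 \<le> i" "i \<le> 1" for i using that by (metis le_antisym order_refl)
    have lo: "isol i \<le> isol 2" if "2 \<le> i" "i \<le> K" for i
      using anti[of 2 i] that 2 iso_ratio_single_rest[of i] unfolding i2 by simp
    have f2: "isol 2 \<le> 1" unfolding i2 by (rule g(2))
    have r: "2 = Suc 1" "2 \<le> K" using u 2 by auto
    have gap: "(\<forall>i\<in>{1..K}. isol i \<notin> {1 / a<..<c}) \<longleftrightarrow> isol 2 \<le> 1 / a \<and> c \<le> isol 1"
      by (rule gap_iff[OF ac le_refl r less_imp_le[OF f1] _ f2]) (fact hi lo)+
    have S: "{i\<in>{1..K}. 1 < isol i} = {1..1}"
      by (rule exceeding_eq[OF ac le_refl r less_imp_le[OF f1] _ f2 _ f1]) (fact hi lo)+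
    have "stop a c \<longleftrightarrow> c \<le> y 1 \<and> y 2 \<le> 1 / a \<and> c * y 2 \<le> y 1"
      unfolding stop_def some_ge_iff gap S i1 i2 e using u by simp
    then show ?thesis using 2 unfolding stop1_def stop2_def stop3_def stop4_def min.bounded_iff e by auto
  next
    case 3
    have g: "1 < y 1" "y 2 \<le> 1" using gt_one[of 1] le_one[of 2] 3 u by auto
    have io: "isol i = y i / y 1" if "1 < i" "i \<le> K" for i using iso_ratio_outside_top[of i] 3 that by auto
    have i1: "isol 1 = y 1 / y 2" and i2: "isol 2 = y 2 / y 1" using 3 u iso_ratio_single_top io[of 2] by auto
    have f1: "1 < isol 1" unfolding i1 using g pos by simp
    have hi: "isol 1 \<le> isol i" if "1 \<le> i" "i \<le> 1" for i using that by (metis le_antisym order_refl)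
    have lo: "isol i \<le> isol 2" if "2 \<le> i" "i \<le> K" for i
      using anti[of 2 i] that io[of i] pos unfolding i2 by (simp add: divide_right_mono)
    have f2: "isol 2 \<le> 1" unfolding i2 using g pos by simp
    have r: "2 = Suc 1" "2 \<le> K" using u 3 by auto
    have gap: "(\<forall>i\<in>{1..K}. isol i \<notin> {1 / a<..<c}) \<longleftrightarrow> isol 2 \<le> 1 / a \<and> c \<le> isol 1"
      by (rule gap_iff[OF ac le_refl r less_imp_le[OF f1] _ f2]) (fact hi lo)+
    have S: "{i\<in>{1..K}. 1 < isol i} = {1..1}"
      by (rule exceeding_eq[OF ac le_refl r less_imp_le[OF f1] _ f2 _ f1]) (fact hi lo)+
    have l: "stop a c \<longleftrightarrow> c \<le> y 1 \<and> a * y 2 \<le> y 1 \<and> c * y 2 \<le> y 1"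
      unfolding stop_def some_ge_iff gap S i1 i2 e using u by simp
    have "c * y 2 \<le> c" using g ac pos by (simp add: mult_left_le)
    then have cy: "c * y 2 \<le> y 1" if "c \<le> y 1" using that by linarith
    have ay: "a * y 2 \<le> y 1" if "y 2 \<le> 1 / a" using that g ac pos by (simp add: field_simps)
    have u2: "u + 1 = 2" using 3 by simp
    show ?thesis unfolding l stop1_def stop2_def stop3_def stop4_def min.bounded_iff max.bounded_iff e u2
      using 3 cy ay ac by auto
  next
    case 4
    have io: "isol i = y i" if "i \<in> {1..K}" for i by (rule iso_ratio_below_cap) (use 4 that in simp_all)
    have S: "{i\<in>{1..K}. 1 < isol i} = {1..p}" unfolding exceeding_one[symmetric]
      by (rule Collect_cong) (use io in force)
    have A: "(\<forall>i\<in>{1..K}. isol i \<notin> {1 / a<..<c}) \<longleftrightarrow> (\<forall>i\<in>{1..K}. y i \<notin> {1 / a<..<c})"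
      by (rule ball_cong[OF refl]) (simp only: io)
    show ?thesis unfolding stop_def some_ge_iff S A stop2_def stop3_def stop4_def using 4 n1 by auto
  next
    case 5
    have ii: "isol i = y i" if "1 \<le> i" "i \<le> u" for i using iso_ratio_below_cap[of i] 5 u that by auto
    have io: "isol i = y i / y u" if "u < i" "i \<le> K" for i using iso_ratio_outside_top[of i] 5 that by auto
    have iu: "isol u = y u" and isu: "isol (Suc u) = y (Suc u) / y u" using ii[of u] io[of "Suc u"] u by auto
    have f1: "1 < isol u" unfolding iu using gt_one[of u] 5 u by auto
    have hi: "isol u \<le> isol i" if "1 \<le> i" "i \<le> u" for i using anti[of i u] that u ii[OF that] iu by simp
    have lo: "isol i \<le> isol (Suc u)" if "Suc u \<le> i" "i \<le> K" for i
      using anti[of "Suc u" i] that io[of i] pos unfolding isu by (simp add: divide_right_mono)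
    have f2: "isol (Suc u) \<le> 1" unfolding isu using anti[of u "Suc u"] u pos by simp
    have r: "Suc u = Suc u" "Suc u \<le> K" using u by auto
    have gap: "(\<forall>i\<in>{1..K}. isol i \<notin> {1 / a<..<c}) \<longleftrightarrow> isol (Suc u) \<le> 1 / a \<and> c \<le> isol u"
      by (rule gap_iff[OF ac u(1) r less_imp_le[OF f1] _ f2]) (fact hi lo)+
    have S: "{i\<in>{1..K}. 1 < isol i} = {1..u}"
      by (rule exceeding_eq[OF ac u(1) r less_imp_le[OF f1] _ f2 _ f1]) (fact hi lo)+
    have "stop a c \<longleftrightarrow> c \<le> y 1 \<and> c \<le> y u \<and> a * y (Suc u) \<le> y u"
      unfolding stop_def some_ge_iff gap S iu isu e using u by auto
    then show ?thesis unfolding stop2_def stop3_def stop4_def max.bounded_iff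
      using 5 n1 anti[of 1 u] u by auto
  next
    case 6
    have ii: "isol i = y i / y (Suc u)" if "1 \<le> i" "i \<le> u" for i using iso_ratio_inside_top[of i] 6 that by auto
    have io: "isol i = y i / y u" if "u < i" "i \<le> K" for i using iso_ratio_outside_top[of i] 6 that by auto
    have iu: "isol u = y u / y (Suc u)" and isu: "isol (Suc u) = y (Suc u) / y u" using ii[of u] io[of "Suc u"] u by auto
    have f1: "1 \<le> isol u" unfolding iu using anti[of u "Suc u"] u pos by simp
    have hi: "isol u \<le> isol i" if "1 \<le> i" "i \<le> u" for i
      using anti[of i u] that u ii[OF that] pos unfolding iu by (simp add: divide_right_mono)
    have lo: "isol i \<le> isol (Suc u)" if "Suc u \<le> i" "i \<le> K" for i
      using anti[of "Suc u" i] that io[of i] pos unfolding isu by (simp add: divide_right_mono)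
    have f2: "isol (Suc u) \<le> 1" unfolding isu using anti[of u "Suc u"] u pos by simp
    have r: "Suc u = Suc u" "Suc u \<le> K" using u by auto
    have "{i\<in>{1..K}. 1 < isol i} \<subseteq> {1..u}"
      by (rule exceeding_subset[OF ac u(1) r f1 _ f2]) (fact hi lo)+
    from card_mono[OF _ this] have cS: "card {i\<in>{1..K}. 1 < isol i} \<le> u" by simp
    have gap: "(\<forall>i\<in>{1..K}. isol i \<notin> {1 / a<..<c}) \<longleftrightarrow> isol (Suc u) \<le> 1 / a \<and> c \<le> isol u"
      by (rule gap_iff[OF ac u(1) r f1 _ f2]) (fact hi lo)+
    have l: "(\<forall>i\<in>{1..K}. isol i \<notin> {1 / a<..<c}) \<longleftrightarrow> a * y (Suc u) \<le> y u \<and> c * y (Suc u) \<le> y u"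
      unfolding gap iu isu e ..
    have ne: "{i\<in>{1..K}. 1 < isol i} \<noteq> {}" if "c * y (Suc u) \<le> y u"
    proof -
      have "1 < isol u" unfolding iu using that ac e(5) by linarith
      then have "u \<in> {i\<in>{1..K}. 1 < isol i}" using u by auto
      then show ?thesis by blast
    qed
    have "a * y (Suc u) \<le> c * y (Suc u) \<longleftrightarrow> a \<le> c" using pos(4) by simp
    then have mx: "y (u + 1) * max a c \<le> y u \<longleftrightarrow> a * y (Suc u) \<le> y u \<and> c * y (Suc u) \<le> y u"
      by (auto simp: max_def mult.commute)
    have "stop a c \<longleftrightarrow> c \<le> y 1 \<and> y (u + 1) * max a c \<le> y u"
      unfolding stop_def some_ge_iff l mx using cS ne by blast
    moreover have "2 \<le> p" using 6 u by linarith
    ultimately show ?thesis unfolding stop2_def stop3_def stop4_def using 6 n1 by auto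
  qed
qed

lemma ge_if_card: assumes "i \<le> card {j\<in>{1..K}. c \<le> y j}" "1 \<le> i" "i \<le> K" shows "c \<le> y i"
proof (rule ccontr)
  assume n: "\<not> c \<le> y i"
  have "{j\<in>{1..K}. c \<le> y j} \<subseteq> {1..<i}"
  proof
    fix j assume j: "j \<in> {j\<in>{1..K}. c \<le> y j}"
    show "j \<in> {1..<i}"
    proof (rule ccontr)
      assume "j \<notin> {1..<i}"
      then have "y j \<le> y i" using anti[of i j] j assms by auto
      then show False using n j by auto
    qed
  qed
  from card_mono[OF _ this] assms show False by simp
qed

lemma le_if_card: assumes "card {j\<in>{1..K}. d < y j} < i" "i \<le> K" shows "y i \<le> d"
proof (rule ccontr)
  assume n: "\<not> y i \<le> d"
  have "{1..i} \<subseteq> {j\<in>{1..K}. d < y j}"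
  proof
    fix j assume "j \<in> {1..i}"
    then show "j \<in> {j\<in>{1..K}. d < y j}" using anti[of j i] n assms by auto
  qed
  from card_mono[OF _ this] assms show False by simp
qed

text \<open>
  The configuration to which the ratios converge when \<open>A\<close> is the set of signals. If \<open>A\<close> has \<open>u\<close> elements, the lead of
  its ratios over the others replaces the bound \<open>1 / a\<close> on the others.
\<close>
lemma stop_if_separated:
  assumes ac: "1 < a" "1 < c" and A: "A \<subseteq> {1..K}" "A \<noteq> {}" "card A \<le> u"
    and hi: "\<And>k. k \<in> A \<Longrightarrow> c \<le> y k" and lo: "\<And>k. k \<in> {1..K} - A \<Longrightarrow> y k \<le> 1"
    and lo': "\<And>k. card A < u \<Longrightarrow> k \<in> {1..K} - A \<Longrightarrow> y k \<le> 1 / a"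
    and gap: "\<And>k j. card A = u \<Longrightarrow> k \<in> A \<Longrightarrow> j \<in> {1..K} - A \<Longrightarrow> a * y j \<le> y k"
  shows "stop a c"
proof -
  have fA: "finite A" using A finite_subset by blast
  have "{i\<in>{1..K}. 1 < y i} = A"
  proof (intro equalityI subsetI)
    fix i assume "i \<in> {i\<in>{1..K}. 1 < y i}" then show "i \<in> A" using lo[of i] by force
  next
    fix i assume "i \<in> A" then show "i \<in> {i\<in>{1..K}. 1 < y i}" using hi[of i] A ac by force
  qed
  then have p: "p = card A" by (simp add: p_def)
  have A1: "1 \<le> card A" using A fA by (simp add: Suc_le_eq card_gt_0_iff)
  have ge: "x \<le> y i" if "\<And>k. k \<in> A \<Longrightarrow> x \<le> y k" "1 \<le> i" "i \<le> card A" for x i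
  proof (rule ge_if_card)
    have "card A \<le> card {j\<in>{1..K}. x \<le> y j}" using that A by (intro card_mono) auto
    then show "i \<le> card {j\<in>{1..K}. x \<le> y j}" using that by simp
  qed (use that A u in auto)
  have le: "y i \<le> x" if "\<And>k. k \<in> {1..K} - A \<Longrightarrow> y k \<le> x" "card A < i" "i \<le> K" for x i
  proof (rule le_if_card)
    have "{j\<in>{1..K}. x < y j} \<subseteq> A" using that(1) by force
    from card_mono[OF fA this] show "card {j\<in>{1..K}. x < y j} < i" using that by simp
  qed (use that in auto)
  have y1: "c \<le> y 1" using ge[of c 1] hi A1 by auto
  consider "card A = 1" "1 < u" | "1 < card A" "card A < u" | "card A = u" using A A1 by linarith
  then have "stop1 a c \<or> stop2 a c \<or> stop3 a c \<or> stop4 a c"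
  proof cases
    case 1
    have 2: "y 2 \<le> 1" "y 2 \<le> 1 / a" using le[of 1 2] le[of "1 / a" 2] lo lo' 1 u by auto
    have "1 \<le> y 1 / c" using y1 ac by simp
    then have "y 2 \<le> y 1 / c" using 2 by linarith
    then show ?thesis using 2 y1 by (simp add: stop1_def)
  next
    case 2
    have "y i \<notin> {1 / a<..<c}" if "i \<in> {1..K}" for i
      using hi[of i] lo'[of i] that 2 by (cases "i \<in> A") auto
    then show ?thesis using 2 p y1 by (simp add: stop2_def)
  next
    case 3
    \<comment> \<open>The gap condition refers to pairs; the largest ratio outside \<open>A\<close> makes it a single lower bound on \<open>A\<close>.\<close>
    let ?R = "{1..K} - A"
    have "card ?R = K - u" using card_Diff_subset[OF fA A(1)] 3 by simp
    then have "0 < card ?R" using u by linarith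
    then have ne: "?R \<noteq> {}" by (metis card.empty less_irrefl)
    define d where "d = Max (y ` ?R)"
    have "d \<in> y ` ?R" unfolding d_def by (rule Max_in) (use ne in auto)
    then obtain j where j: "j \<in> ?R" "d = y j" by auto
    have d: "y k \<le> d" if "k \<in> ?R" for k unfolding d_def by (rule Max_ge) (use that in auto)
    have "y (u + 1) \<le> d" by (rule le) (use d 3 u in auto)
    then have "a * y (u + 1) \<le> a * d" using ac by (intro mult_left_mono) auto
    moreover have "max c (a * d) \<le> y u" by (rule ge) (use hi gap 3 j u in auto)
    ultimately show ?thesis using 3 p by (simp add: stop3_def)
  qed
  then show ?thesis using stop_iff[OF ac] by blast
qed

end

section \<open>The statistics in terms of the local ratios\<close>

lemma Max_scale:
  fixes f :: "'b \<Rightarrow> real"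
  assumes "finite X" "X \<noteq> {}" "0 < c"
  shows "Max ((\<lambda>x. f x * c) ` X) = Max (f ` X) * c"
proof -
  have "mono (\<lambda>x. x * c)" using assms by (auto simp: mono_def)
  from mono_Max_commute[OF this, of "f ` X"] assms show ?thesis by (simp add: image_image)
qed

lemma prod_choice:
  fixes g h :: "'i \<Rightarrow> real"
  assumes "finite S" "A \<subseteq> S" "\<And>k. k \<in> S \<Longrightarrow> h k \<noteq> 0"
  shows "(\<Prod>k\<in>S. if k \<in> A then g k else h k) = (\<Prod>k\<in>S. h k) * (\<Prod>k\<in>A. g k / h k)"
proof -
  have "(\<Prod>k\<in>A. g k / h k) = (\<Prod>k\<in>S. if k \<in> A then g k / h k else 1)"
    using assms by (simp add: prod.If_cases Int_absorb1)
  then show ?thesis using assms by (auto simp: prod.distrib[symmetric] intro!: prod.cong)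
qed

context model_setting begin

definition null_ref where "null_ref = (SOME N. N \<in> global_null m)"

lemma null_ref: "null_ref \<in> global_null m"
  unfolding null_ref_def using nonempty by (auto simp: families_nonempty_def some_in_eq)

text \<open>
  The local statistic relative to one fixed null law. On regular paths it agrees with those relative to any other
  null law, since the reference density cancels from numerator and denominator.
\<close>
definition Lam :: "nat \<Rightarrow> nat \<Rightarrow> 'x path \<Rightarrow> real" where
  "Lam k n \<omega> = loc_stat m (\<lambda>k. law m null_ref {k}) k n \<omega>"

lemma loc_stat_base:
  assumes g: "regular \<omega>" "n \<ge> 1" "k \<in> S" and b: "b k \<in> laws m (global_null m) {k}"
  shows "loc_stat m b k n \<omega> = Lam k n \<omega>"
proof -
  obtain N where N: "N \<in> global_null m" "b k = law m N {k}" using b by (auto simp: laws_def)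
  let ?c = "L {k} n null_ref N \<omega>"
  have NF: "N \<in> FP" "null_ref \<in> FP" using N null_ref null_subset by auto
  have c: "0 < ?c" using regularD(1)[OF g(1,2) NF(2,1)] g(3) by auto
  have e: "lr m {k} n R (law m N {k}) \<omega> = lr m {k} n R (law m null_ref {k}) \<omega> * ?c" if R: "R \<in> alts m k \<union> hyps m k" for R
  proof -
    obtain P where P: "P \<in> FP" "law m P {k} = R" using src_law_FP[OF g(3) R] .
    show ?thesis using regularD(2)[OF g(1,2) P(1) NF(2) _ _ NF(1), of "{k}"] g(3) P(2) by auto
  qed
  have "Max ((\<lambda>R. lr m {k} n R (law m N {k}) \<omega>) ` X) = Max ((\<lambda>R. lr m {k} n R (law m null_ref {k}) \<omega>) ` X) * ?c"
    if "X \<subseteq> alts m k \<union> hyps m k" "finite X" "X \<noteq> {}" for X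
    unfolding Max_scale[OF that(2,3) c, symmetric] by (intro arg_cong[where f=Max] image_cong refl e) (use that in auto)
  then show ?thesis unfolding loc_stat_def Lam_def max_lr_ratio_def N(2)
    using c fin_alts fin_hyps alts_ne hyps_ne g(3) by auto
qed

definition alt_max where "alt_max N k n \<omega> = Max ((\<lambda>R. lr m {k} n R (law m N {k}) \<omega>) ` alts m k)"

definition null_max where "null_max N k n \<omega> = Max ((\<lambda>R. lr m {k} n R (law m N {k}) \<omega>) ` hyps m k)"

lemma alt_null_max_pos:
  assumes g: "regular \<omega>" "n \<ge> 1" "k \<in> S" "N \<in> FP"
  shows "0 < alt_max N k n \<omega>" "0 < null_max N k n \<omega>"
proof -
  have "0 < lr m {k} n R (law m N {k}) \<omega>" if R: "R \<in> alts m k \<union> hyps m k" for R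
  proof -
    obtain P where P: "P \<in> FP" "law m P {k} = R" using src_law_FP[OF g(3) R] .
    show ?thesis using regularD(1)[OF g(1,2) P(1) g(4), of "{k}"] g(3) P(2) by auto
  qed
  then show "0 < alt_max N k n \<omega>" "0 < null_max N k n \<omega>"
    unfolding alt_max_def null_max_def
    using fin_alts[OF g(3)] fin_hyps[OF g(3)] alts_ne[OF g(3)] hyps_ne[OF g(3)] by (simp_all add: Max_gr_iff)
      blast+
qed

lemma Lam_eq:
  assumes g: "regular \<omega>" "n \<ge> 1" "k \<in> S" and N: "N \<in> global_null m"
  shows "Lam k n \<omega> = alt_max N k n \<omega> / null_max N k n \<omega>"
  using loc_stat_base[of \<omega> n k "\<lambda>k. law m N {k}"] g N
  by (auto simp: loc_stat_def max_lr_ratio_def alt_max_def null_max_def laws_def)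

lemma Lam_pos: "regular \<omega> \<Longrightarrow> n \<ge> 1 \<Longrightarrow> k \<in> S \<Longrightarrow> 0 < Lam k n \<omega>"
  using Lam_eq[OF _ _ _ null_ref] alt_null_max_pos null_ref null_subset by auto

text \<open>
  By the product formula the maximum can be taken source by source once the signal set is fixed. The product of
  the null maxima does not depend on that set and is factored out.
\<close>
lemma Max_lr_product:
  assumes g: "regular \<omega>" "n \<ge> 1" and N: "N \<in> global_null m" and AA: "AA \<subseteq> Psi m" "AA \<noteq> {}"
  shows "Max ((\<lambda>P. L S n P N \<omega>) ` {P\<in>FP. active m P \<in> AA})
       = (\<Prod>k\<in>S. null_max N k n \<omega>) * Max ((\<lambda>A. \<Prod>k\<in>A. Lam k n \<omega>) ` AA)"
proof (rule Max_eqI)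
  have NF: "N \<in> FP" using N null_subset by auto
  let ?V = "\<lambda>A. \<Prod>k\<in>A. Lam k n \<omega>" let ?H = "\<Prod>k\<in>S. null_max N k n \<omega>"
  let ?W = "\<lambda>A. \<Prod>k\<in>S. if k \<in> A then alt_max N k n \<omega> else null_max N k n \<omega>"
  have "finite (Psi m)" by (rule finite_subset[of _ "Pow S"]) (auto simp: Psi_def)
  then have fAA: "finite AA" using AA by (auto intro: finite_subset)
  have W: "?W A = ?H * ?V A" if "A \<in> Psi m" for A
  proof -
    have A: "A \<subseteq> S" using that by (auto simp: Psi_def)
    have "?W A = ?H * (\<Prod>k\<in>A. alt_max N k n \<omega> / null_max N k n \<omega>)"
      by (rule prod_choice[OF finite_sources A]) (use alt_null_max_pos[OF g _ NF] in force)
    then show ?thesis using A Lam_eq[OF g _ N] by (auto intro!: prod.cong)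
  qed
  have H: "0 < ?H" using alt_null_max_pos[OF g _ NF] by (intro prod_pos) auto
  have "Max (?V ` AA) \<in> ?V ` AA" using fAA AA by (intro Max_in) auto
  then obtain A where A: "A \<in> AA" "Max (?V ` AA) = ?V A" by auto
  then have AP: "A \<in> Psi m" using AA by auto
  \<comment> \<open>The maximising laws of the single sources, combined, attain the maximum.\<close>
  have "\<exists>R. \<forall>k\<in>S. R k \<in> (if k \<in> A then alts m k else hyps m k) \<and>
      lr m {k} n (R k) (law m N {k}) \<omega> = (if k \<in> A then alt_max N k n \<omega> else null_max N k n \<omega>)"
  proof (rule bchoice, rule ballI)
    fix k assume k: "k \<in> S"
    have "alt_max N k n \<omega> \<in> (\<lambda>R. lr m {k} n R (law m N {k}) \<omega>) ` alts m k"
      "null_max N k n \<omega> \<in> (\<lambda>R. lr m {k} n R (law m N {k}) \<omega>) ` hyps m k"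
      unfolding alt_max_def null_max_def using fin_alts fin_hyps alts_ne hyps_ne k by (auto intro!: Max_in)
    then show "\<exists>R. R \<in> (if k \<in> A then alts m k else hyps m k) \<and>
      lr m {k} n R (law m N {k}) \<omega> = (if k \<in> A then alt_max N k n \<omega> else null_max N k n \<omega>)"
      by (cases "k \<in> A") auto
  qed
  then obtain R where R: "\<And>k. k \<in> S \<Longrightarrow> R k \<in> (if k \<in> A then alts m k else hyps m k)"
    "\<And>k. k \<in> S \<Longrightarrow> lr m {k} n (R k) (law m N {k}) \<omega> = (if k \<in> A then alt_max N k n \<omega> else null_max N k n \<omega>)"
    by blast
  obtain P where P: "P \<in> FP" "active m P = A" "\<And>k. k \<in> S \<Longrightarrow> law m P {k} = R k"
    using combine_source_laws[OF AP R(1)] by blast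
  have "L S n P N \<omega> = ?W A" unfolding regular_product[OF g P(1) NF] by (intro prod.cong refl) (simp add: P(3) R(2))
  also have "\<dots> = ?H * Max (?V ` AA)" using W[OF AP] A by simp
  finally show "?H * Max (?V ` AA) \<in> (\<lambda>P. L S n P N \<omega>) ` {P\<in>FP. active m P \<in> AA}"
    using P A(1) by (intro image_eqI[of _ _ P]) auto
  fix x assume "x \<in> (\<lambda>P. L S n P N \<omega>) ` {P\<in>FP. active m P \<in> AA}"
  then obtain P where P: "P \<in> FP" "active m P \<in> AA" "x = L S n P N \<omega>" by auto
  have "x \<le> ?W (active m P)" unfolding P(3) regular_product[OF g P(1) NF]
  proof (rule prod_mono, rule conjI)
    fix k assume k: "k \<in> S"
    show "0 \<le> L {k} n P N \<omega>" using regularD(1)[OF g P(1) NF, of "{k}"] k by auto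
    show "L {k} n P N \<omega> \<le> (if k \<in> active m P then alt_max N k n \<omega> else null_max N k n \<omega>)"
      using fam_Psi_law[OF P(1) k] fin_alts[OF k] fin_hyps[OF k]
      by (auto simp: alt_max_def null_max_def split: if_splits)
  qed
  also have "\<dots> = ?H * ?V (active m P)" using W P AA by auto
  also have "\<dots> \<le> ?H * Max (?V ` AA)" using P H fAA by (intro mult_left_mono) auto
  finally show "x \<le> ?H * Max (?V ` AA)" .
qed (use finite_FP in auto)

lemma iso_stat_eq_iso_ratio:
  assumes g: "regular \<omega>" "n \<ge> 1" "k \<in> S" and s': "s' k = S" "b' k \<in> laws m (global_null m) S"
  shows "iso_stat m s' b' k n \<omega> = iso_ratio S (bound m) (\<lambda>k. Lam k n \<omega>) k"
proof -
  obtain N where N: "N \<in> global_null m" "b' k = law m N S" using s' by (auto simp: laws_def)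
  let ?A1 = "{A. A \<subseteq> S \<and> card A \<le> bound m \<and> k \<in> A}"
  let ?A0 = "{A. A \<subseteq> S \<and> card A \<le> bound m \<and> A \<noteq> {} \<and> k \<notin> A}"
  obtain j where j: "j \<in> S" "j \<noteq> k" using other_source[OF g(3)] .
  have "{k} \<in> ?A1" "{j} \<in> ?A0" using j g(3) bound_pos by auto
  then have ne: "?A1 \<noteq> {}" "?A0 \<noteq> {}" by blast+
  have 1: "alt_Psi m k = {P\<in>FP. active m P \<in> ?A1}" by (auto simp: alt_Psi_def fam_Psi_def Psi_def)
  have 0: "hyp_Psi m k = {P\<in>FP. active m P \<in> ?A0}"
    using null_iff by (auto simp: hyp_Psi_def fam_Psi_def Psi_def)
  have H: "0 < (\<Prod>k\<in>S. null_max N k n \<omega>)" using alt_null_max_pos[OF g(1,2)] N null_subset by (intro prod_pos) auto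
  have "Max ((\<lambda>P. L S n P N \<omega>) ` alt_Psi m k) = (\<Prod>k\<in>S. null_max N k n \<omega>) * best_alt S (bound m) (\<lambda>k. Lam k n \<omega>) k"
    unfolding 1 best_alt_def by (rule Max_lr_product[OF g(1,2) N(1)]) (use ne in \<open>auto simp: Psi_def\<close>)
  moreover have "Max ((\<lambda>P. L S n P N \<omega>) ` hyp_Psi m k) = (\<Prod>k\<in>S. null_max N k n \<omega>) * best_null S (bound m) (\<lambda>k. Lam k n \<omega>) k"
    unfolding 0 best_null_def by (rule Max_lr_product[OF g(1,2) N(1)]) (use ne in \<open>auto simp: Psi_def\<close>)
  ultimately have "iso_stat m s' b' k n \<omega> =
      ((\<Prod>k\<in>S. null_max N k n \<omega>) * best_alt S (bound m) (\<lambda>k. Lam k n \<omega>) k) /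
      ((\<Prod>k\<in>S. null_max N k n \<omega>) * best_null S (bound m) (\<lambda>k. Lam k n \<omega>) k)"
    by (simp only: iso_stat_def max_lr_ratio_def s' N(2) laws_def image_image)
  also have "\<dots> = iso_ratio S (bound m) (\<lambda>k. Lam k n \<omega>) k"
    unfolding iso_ratio_def by (rule mult_divide_mult_cancel_left) (use H in linarith)
  finally show ?thesis .
qed

lemma ordered_enumeration:
  obtains \<sigma> where "bij_betw \<sigma> {1..K} S" "\<And>i. i \<in> {1..K} \<Longrightarrow> ord_stat m b i n \<omega> = loc_stat m b (\<sigma> i) n \<omega>"
    "\<And>i j. 1 \<le> i \<Longrightarrow> i \<le> j \<Longrightarrow> j \<le> K \<Longrightarrow> ord_stat m b j n \<omega> \<le> ord_stat m b i n \<omega>"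
proof -
  let ?f = "\<lambda>k. loc_stat m b k n \<omega>"
  define xs where "xs = rev (sort_key ?f [1..<Suc K])"
  have len: "length xs = K" by (simp add: xs_def)
  have S: "set xs = S" unfolding xs_def srcs_def by (auto simp del: upt_Suc)
  have dist: "distinct xs" by (simp add: xs_def del: upt_Suc)
  have sm: "map ?f (sort_key ?f ys) = sort (map ?f ys)" for ys
    by (rule properties_for_sort[symmetric]) auto
  have mp: "rev (sort (map ?f [1..<Suc K])) = map ?f xs"
    unfolding xs_def by (simp add: sm rev_map[symmetric] del: upt_Suc)
  have bij0: "bij_betw (\<lambda>i. xs ! i) {..<K} S" using bij_betw_nth[OF dist] len S by auto
  have b1: "bij_betw (\<lambda>i. i - 1) {1..K} {..<K}"
    by (rule bij_betwI[where g=Suc]) auto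
  have "bij_betw (\<lambda>i. xs ! (i - 1)) {1..K} S"
    using bij_betw_trans[OF b1 bij0] by (simp add: comp_def)
  moreover have o: "ord_stat m b i n \<omega> = ?f (xs ! (i - 1))" if "i \<in> {1..K}" for i
    unfolding ord_stat_def mp using that len by (subst nth_map) auto
  moreover have "ord_stat m b j n \<omega> \<le> ord_stat m b i n \<omega>" if "1 \<le> i" "i \<le> j" "j \<le> K" for i j
  proof -
    have "sorted_wrt (\<ge>) (rev (sort (map ?f [1..<Suc K])))"
      by (simp add: sorted_wrt_rev del: upt_Suc)
    then have "sorted_wrt (\<ge>) (map ?f xs)" unfolding mp .
    then have "map ?f xs ! (j - 1) \<le> map ?f xs ! (i - 1)"
      using that len by (cases "i = j") (auto simp: sorted_wrt_iff_nth_less)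
    then show ?thesis using that len o[of i] o[of j] by auto
  qed
  ultimately show ?thesis by (rule that)
qed

end

section \<open>The stopping rule\<close>

lemma first_time_cong: "(\<And>n. 1 \<le> n \<Longrightarrow> C n \<omega> = C' n \<omega>) \<Longrightarrow> first_time C \<omega> = first_time C' \<omega>"
  unfolding first_time_def by (rule arg_cong[where f=Inf]) auto

lemma first_time_or: "first_time (\<lambda>n \<omega>. C n \<omega> \<or> C' n \<omega>) \<omega> = min (first_time C \<omega>) (first_time C' \<omega>)"
proof -
  have "{enat n |n. 1 \<le> n \<and> (C n \<omega> \<or> C' n \<omega>)} = {enat n |n. 1 \<le> n \<and> C n \<omega>} \<union> {enat n |n. 1 \<le> n \<and> C' n \<omega>}" by auto
  then show ?thesis unfolding first_time_def by (simp add: Inf_union_distrib inf_min)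
qed

lemma first_time_le: "1 \<le> n \<Longrightarrow> C n \<omega> \<Longrightarrow> first_time C \<omega> \<le> enat n"
  unfolding first_time_def by (rule Inf_lower) auto

context model_setting begin

abbreviation "tau1_at s s' b b' a c n \<omega> \<equiv> (\<exists>k\<in>S. c \<le> det_stat m s b k n \<omega>) \<and>
  (\<forall>k\<in>S. iso_stat m s' b' k n \<omega> \<notin> {1 / a<..<c}) \<and> iso_set m s' b' n \<omega> \<in> Psi m - {{}}"

lemma det_stat_local:
  assumes "regular \<omega>" "n \<ge> 1" "k \<in> S" "s k = {k}" "b k \<in> laws m (global_null m) {k}"
  shows "det_stat m s b k n \<omega> = Lam k n \<omega>"
  using loc_stat_base[where b=b, OF assms(1-3,5)] assms(3,4)
  by (simp add: det_stat_def loc_stat_def laws_alt laws_null)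

lemma iso_stat_local:
  assumes "regular \<omega>" "n \<ge> 1" "k \<in> S" "s k = {k}" "b k \<in> laws m (global_null m) {k}"
  shows "iso_stat m s b k n \<omega> = Lam k n \<omega>"
  using loc_stat_base[where b=b, OF assms(1-3,5)] assms(3,4)
  by (simp add: iso_stat_def loc_stat_def laws_alt laws_hyp)

lemma tau0_local:
  assumes g: "regular \<omega>" and s: "\<forall>k\<in>S. s k = {k}" "\<forall>k\<in>S. b k \<in> laws m (global_null m) (s k)"
  shows "tau0 m s b a \<omega> = first_time (\<lambda>n \<omega>. \<forall>k\<in>S. Lam k n \<omega> \<le> 1 / a) \<omega>"
  unfolding tau0_def using det_stat_local[OF g, of _ _ s b] s by (intro first_time_cong) auto

text \<open>
  Without an effective bound on the number of signals the first time splits according to whether some ratio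
  is large: if none is, all are at most \<open>1/a\<close> and \<open>tau0\<close> has occurred; otherwise \<open>tau1\<close> has.
\<close>
lemma T_fwer_eq_local:
  assumes g: "regular \<omega>" and s: "\<forall>k\<in>S. s k = {k}" "\<forall>k\<in>S. b k \<in> laws m (global_null m) (s k)"
    and s': "\<forall>k\<in>S. s' k = {k}" "\<forall>k\<in>S. b' k \<in> laws m (global_null m) (s' k)"
    and u: "bound m = K" and ac: "1 < a" "1 < c"
  shows "T_fwer m s s' b b' a c \<omega> = first_time (\<lambda>n \<omega>. \<forall>k\<in>S. Lam k n \<omega> \<notin> {1 / a<..<c}) \<omega>"
proof -
  have "tau1 m s s' b b' a c \<omega> = first_time (\<lambda>n \<omega>. (\<exists>k\<in>S. c \<le> Lam k n \<omega>) \<and> (\<forall>k\<in>S. Lam k n \<omega> \<notin> {1 / a<..<c})) \<omega>"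
    unfolding tau1_def
  proof (rule first_time_cong)
    fix n :: nat assume n: "1 \<le> n"
    have d: "det_stat m s b k n \<omega> = Lam k n \<omega>" "iso_stat m s' b' k n \<omega> = Lam k n \<omega>" if "k \<in> S" for k
      using det_stat_local[OF g n that, of s b] iso_stat_local[OF g n that, of s' b'] s s' that by auto
    have i: "iso_set m s' b' n \<omega> = {k\<in>S. 1 < Lam k n \<omega>}" unfolding iso_set_def using d by auto
    have "card {k\<in>S. 1 < Lam k n \<omega>} \<le> bound m"
      unfolding u card_S[symmetric] by (intro card_mono) auto
    then have "iso_set m s' b' n \<omega> \<in> Psi m - {{}}" if "k \<in> S" "c \<le> Lam k n \<omega>" for k
      unfolding i using that ac by (fastforce simp: Psi_def)
    then show "(tau1_at s s' b b' a c n \<omega>) = ((\<exists>k\<in>S. c \<le> Lam k n \<omega>) \<and> (\<forall>k\<in>S. Lam k n \<omega> \<notin> {1 / a<..<c}))"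
      using d by auto
  qed
  then have "T_fwer m s s' b b' a c \<omega> = first_time (\<lambda>n \<omega>. (\<forall>k\<in>S. Lam k n \<omega> \<le> 1 / a) \<or>
      ((\<exists>k\<in>S. c \<le> Lam k n \<omega>) \<and> (\<forall>k\<in>S. Lam k n \<omega> \<notin> {1 / a<..<c}))) \<omega>"
    unfolding T_fwer_def tau0_local[OF g s] by (simp add: first_time_or)
  also have "\<dots> = first_time (\<lambda>n \<omega>. \<forall>k\<in>S. Lam k n \<omega> \<notin> {1 / a<..<c}) \<omega>"
    by (rule first_time_cong) (use not_in_gap_iff in auto)
  finally show ?thesis .
qed

text \<open>
  Transfers the condition of \<open>tau1\<close> to the sorted local ratios, along an enumeration of the sources that
  realises the order statistics.
\<close>
lemma tau1_condition_sorted: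
  assumes g: "regular \<omega>" and n: "1 \<le> n"
    and s: "\<forall>k\<in>S. s k = {k}" "\<forall>k\<in>S. b k \<in> laws m (global_null m) (s k)"
    and s': "\<forall>k\<in>S. s' k = S" "\<forall>k\<in>S. b' k \<in> laws m (global_null m) (s' k)"
    and bl: "\<forall>k\<in>S. bl k \<in> laws m (global_null m) {k}"
    and u: "bound m < K"
  obtains \<sigma> where "bij_betw \<sigma> {1..K} S" "sorted_ratios K (bound m) (\<lambda>i. Lam (\<sigma> i) n \<omega>)"
    "\<And>i. i \<in> {1..K} \<Longrightarrow> ord_stat m bl i n \<omega> = Lam (\<sigma> i) n \<omega>"
    "num_pos m bl n \<omega> = sorted_ratios.p K (\<lambda>i. Lam (\<sigma> i) n \<omega>)"
    "\<And>a c. tau1_at s s' b b' a c n \<omega> \<longleftrightarrow> sorted_ratios.stop K (bound m) (\<lambda>i. Lam (\<sigma> i) n \<omega>) a c"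
proof -
  have lb: "loc_stat m bl k n \<omega> = Lam k n \<omega>" if "k \<in> S" for k using loc_stat_base[OF g n that, of bl] bl that by auto
  obtain \<sigma> where \<sigma>: "bij_betw \<sigma> {1..K} S" "\<And>i. i \<in> {1..K} \<Longrightarrow> ord_stat m bl i n \<omega> = loc_stat m bl (\<sigma> i) n \<omega>"
    "\<And>i j. 1 \<le> i \<Longrightarrow> i \<le> j \<Longrightarrow> j \<le> K \<Longrightarrow> ord_stat m bl j n \<omega> \<le> ord_stat m bl i n \<omega>"
    using ordered_enumeration[of bl n \<omega>] by blast
  let ?y = "\<lambda>i. Lam (\<sigma> i) n \<omega>"
  have \<sigma>S: "\<sigma> i \<in> S" if "i \<in> {1..K}" for i using \<sigma>(1) that by (auto simp: bij_betw_def)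
  have img: "S = \<sigma> ` {1..K}" and inj: "inj_on \<sigma> {1..K}" using \<sigma>(1) by (auto simp: bij_betw_def)
  have o: "ord_stat m bl i n \<omega> = ?y i" if "i \<in> {1..K}" for i using \<sigma>(2)[OF that] lb \<sigma>S[OF that] by simp
  interpret sr: sorted_ratios K "bound m" ?y
  proof
    show "?y j \<le> ?y i" if "1 \<le> i" "i \<le> j" "j \<le> K" for i j
      using \<sigma>(3)[OF that] o[of i] o[of j] that by auto
  qed (use u bound_pos Lam_pos[OF g n] \<sigma>S in auto)
  have cim: "card {k\<in>S. Q k} = card {i\<in>{1..K}. Q (\<sigma> i)}" for Q
  proof -
    have "{k\<in>S. Q k} = \<sigma> ` {i\<in>{1..K}. Q (\<sigma> i)}" unfolding img by auto
    moreover have "card (\<sigma> ` {i\<in>{1..K}. Q (\<sigma> i)}) = card {i\<in>{1..K}. Q (\<sigma> i)}"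
      by (rule card_image[OF inj_on_subset[OF inj]]) blast
    ultimately show ?thesis by (simp only:)
  qed
  have np: "num_pos m bl n \<omega> = sr.p"
  proof -
    have "{k\<in>S. 1 < loc_stat m bl k n \<omega>} = {k\<in>S. 1 < Lam k n \<omega>}" using lb by auto
    then show ?thesis unfolding num_pos_def sr.p_def using cim[of "\<lambda>k. 1 < Lam k n \<omega>"] by simp
  qed
  have d: "det_stat m s b k n \<omega> = Lam k n \<omega>" if "k \<in> S" for k
    using det_stat_local[OF g n that, of s b] s that by auto
  have isy: "iso_stat m s' b' (\<sigma> i) n \<omega> = iso_ratio {1..K} (bound m) ?y i" if "i \<in> {1..K}" for i
    using iso_stat_eq_iso_ratio[OF g n \<sigma>S[OF that], of s' b'] s' \<sigma>S[OF that] iso_ratio_reindex[OF \<sigma>(1) _ that] by simp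
  have iset: "iso_set m s' b' n \<omega> \<in> Psi m - {{}} \<longleftrightarrow> {i\<in>{1..K}. 1 < iso_ratio {1..K} (bound m) ?y i} \<noteq> {} \<and>
     card {i\<in>{1..K}. 1 < iso_ratio {1..K} (bound m) ?y i} \<le> bound m"
  proof -
    let ?J = "{i\<in>{1..K}. 1 < iso_ratio {1..K} (bound m) ?y i}"
    have J: "{i\<in>{1..K}. 1 < iso_stat m s' b' (\<sigma> i) n \<omega>} = ?J" by (rule Collect_cong) (use isy in auto)
    have c: "card (iso_set m s' b' n \<omega>) = card ?J"
      unfolding iso_set_def cim J ..
    have "iso_set m s' b' n \<omega> \<subseteq> S" by (auto simp: iso_set_def)
    moreover have "finite ?J" by simp
    moreover have "finite (iso_set m s' b' n \<omega>)" using calculation(1) by (rule finite_subset) simp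
    ultimately show ?thesis unfolding Psi_def using c by (metis (no_types, lifting) Diff_iff card_eq_0_iff mem_Collect_eq singletonD singletonI)
  qed
  have st: "tau1_at s s' b b' a c n \<omega> \<longleftrightarrow> sr.stop a c" for a c
  proof -
    have 1: "(\<exists>k\<in>S. c \<le> det_stat m s b k n \<omega>) \<longleftrightarrow> (\<exists>i\<in>{1..K}. c \<le> ?y i)"
      using d unfolding img by auto
    have 2: "(\<forall>k\<in>S. iso_stat m s' b' k n \<omega> \<notin> {1 / a<..<c}) \<longleftrightarrow> (\<forall>i\<in>{1..K}. iso_ratio {1..K} (bound m) ?y i \<notin> {1 / a<..<c})"
      unfolding img Set.ball_simps(9) by (rule ball_cong[OF refl]) (simp only: isy)
    show ?thesis unfolding sr.stop_def 1 2 iset ..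
  qed
  show ?thesis by (rule that[OF \<sigma>(1) sr.sorted_ratios_axioms o np st])
qed

lemma T_fwer_eq_Min_times:
  assumes g: "regular \<omega>"
    and s: "\<forall>k\<in>S. s k = {k}" "\<forall>k\<in>S. b k \<in> laws m (global_null m) (s k)"
    and s': "\<forall>k\<in>S. s' k = S" "\<forall>k\<in>S. b' k \<in> laws m (global_null m) (s' k)"
    and bl: "\<forall>k\<in>S. bl k \<in> laws m (global_null m) {k}"
    and u: "bound m < K" and ac: "1 < a" "1 < c"
  shows "T_fwer m s s' b b' a c \<omega> = Min {time0 m bl a \<omega>, time1 m bl a c \<omega>, time2 m bl a c \<omega>,
     time3 m bl a c \<omega>, time4 m bl a c \<omega>}"
proof -
  let ?C1 = "\<lambda>n \<omega>. ord_stat m bl 1 n \<omega> \<ge> c \<and> ord_stat m bl 2 n \<omega> \<le> min (1 / a) (ord_stat m bl 1 n \<omega> / c)"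
  let ?C2 = "\<lambda>n \<omega>. 1 < num_pos m bl n \<omega> \<and> num_pos m bl n \<omega> < bound m \<and>
     ord_stat m bl 1 n \<omega> \<ge> c \<and> (\<forall>k\<in>S. loc_stat m bl k n \<omega> \<notin> {1 / a<..<c})"
  let ?C3 = "\<lambda>n \<omega>. num_pos m bl n \<omega> = bound m \<and>
     ord_stat m bl (bound m) n \<omega> \<ge> max c (a * ord_stat m bl (bound m + 1) n \<omega>)"
  let ?C4 = "\<lambda>n \<omega>. num_pos m bl n \<omega> > bound m \<and> ord_stat m bl 1 n \<omega> \<ge> c \<and>
     ord_stat m bl (bound m) n \<omega> \<ge> ord_stat m bl (bound m + 1) n \<omega> * max a c"
  have t1: "tau1 m s s' b b' a c \<omega> = first_time (\<lambda>n \<omega>. ?C1 n \<omega> \<or> ?C2 n \<omega> \<or> ?C3 n \<omega> \<or> ?C4 n \<omega>) \<omega>"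
    unfolding tau1_def
  proof (rule first_time_cong)
    fix n :: nat assume n: "1 \<le> n"
    obtain \<sigma> where \<sigma>: "bij_betw \<sigma> {1..K} S" "sorted_ratios K (bound m) (\<lambda>i. Lam (\<sigma> i) n \<omega>)"
      "\<And>i. i \<in> {1..K} \<Longrightarrow> ord_stat m bl i n \<omega> = Lam (\<sigma> i) n \<omega>"
      "num_pos m bl n \<omega> = sorted_ratios.p K (\<lambda>i. Lam (\<sigma> i) n \<omega>)"
      "\<And>a c. tau1_at s s' b b' a c n \<omega> \<longleftrightarrow> sorted_ratios.stop K (bound m) (\<lambda>i. Lam (\<sigma> i) n \<omega>) a c"
    by (rule tau1_condition_sorted[OF g n s s' bl u], rule that)
    interpret sr: sorted_ratios K "bound m" "\<lambda>i. Lam (\<sigma> i) n \<omega>" by fact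
    have r: "1 \<in> {1..K}" "2 \<in> {1..K}" "bound m \<in> {1..K}" "bound m + 1 \<in> {1..K}" using u bound_pos by auto
    have l: "(\<forall>i\<in>{1..K}. Lam (\<sigma> i) n \<omega> \<notin> {1 / a<..<c}) \<longleftrightarrow> (\<forall>k\<in>S. loc_stat m bl k n \<omega> \<notin> {1 / a<..<c})"
    proof -
      have img: "S = \<sigma> ` {1..K}" using \<sigma>(1) by (auto simp: bij_betw_def)
      have "(\<forall>k\<in>S. loc_stat m bl k n \<omega> \<notin> {1 / a<..<c}) \<longleftrightarrow> (\<forall>k\<in>S. Lam k n \<omega> \<notin> {1 / a<..<c})"
        using loc_stat_base[OF g n, of _ bl] bl by simp
      then show ?thesis unfolding img by simp
    qed
    show "(tau1_at s s' b b' a c n \<omega>) = (?C1 n \<omega> \<or> ?C2 n \<omega> \<or> ?C3 n \<omega> \<or> ?C4 n \<omega>)"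
      unfolding \<sigma>(5) sr.stop_iff[OF ac] sr.stop1_def sr.stop2_def sr.stop3_def sr.stop4_def
        \<sigma>(3)[OF r(1)] \<sigma>(3)[OF r(2)] \<sigma>(3)[OF r(3)] \<sigma>(3)[OF r(4)] \<sigma>(4) l ..
  qed
  have t0: "tau0 m s b a \<omega> = time0 m bl a \<omega>"
    unfolding tau0_local[OF g s] time0_def
  proof (rule first_time_cong)
    fix n :: nat assume n: "1 \<le> n"
    obtain \<sigma> where \<sigma>: "bij_betw \<sigma> {1..K} S" "sorted_ratios K (bound m) (\<lambda>i. Lam (\<sigma> i) n \<omega>)"
      "\<And>i. i \<in> {1..K} \<Longrightarrow> ord_stat m bl i n \<omega> = Lam (\<sigma> i) n \<omega>"
      "num_pos m bl n \<omega> = sorted_ratios.p K (\<lambda>i. Lam (\<sigma> i) n \<omega>)"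
      "\<And>a c. tau1_at s s' b b' a c n \<omega> \<longleftrightarrow> sorted_ratios.stop K (bound m) (\<lambda>i. Lam (\<sigma> i) n \<omega>) a c"
    by (rule tau1_condition_sorted[OF g n s s' bl u], rule that)
    interpret sr: sorted_ratios K "bound m" "\<lambda>i. Lam (\<sigma> i) n \<omega>" by fact
    have img: "S = \<sigma> ` {1..K}" using \<sigma>(1) by (auto simp: bij_betw_def)
    have r: "1 \<in> {1..K}" using u by auto
    have "(\<forall>i\<in>{1..K}. Lam (\<sigma> i) n \<omega> \<le> 1 / a) \<longleftrightarrow> Lam (\<sigma> 1) n \<omega> \<le> 1 / a"
      using r sr.anti[of 1] by force
    then show "(\<forall>k\<in>S. Lam k n \<omega> \<le> 1 / a) = (ord_stat m bl 1 n \<omega> \<le> 1 / a)"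
      unfolding \<sigma>(3)[OF r] img Set.ball_simps(9) .
  qed
  show ?thesis
    unfolding T_fwer_def t0 t1 first_time_or time1_def[symmetric] time2_def[symmetric] time3_def[symmetric] time4_def[symmetric]
    by simp
qed

lemma T_fwer_hit_null:
  assumes g: "regular \<omega>" and n: "1 \<le> n" and s: "\<forall>k\<in>S. s k = {k}" "\<forall>k\<in>S. b k \<in> laws m (global_null m) (s k)"
    and l: "\<And>k. k \<in> S \<Longrightarrow> Lam k n \<omega> \<le> 1 / a"
  shows "T_fwer m s s' b b' a c \<omega> \<le> enat n"
  unfolding T_fwer_def tau0_local[OF g s] by (rule min.coboundedI1, rule first_time_le[OF n]) (use l in auto)

lemma T_fwer_hit_local:
  assumes g: "regular \<omega>" and n: "1 \<le> n" and s: "\<forall>k\<in>S. s k = {k}" "\<forall>k\<in>S. b k \<in> laws m (global_null m) (s k)"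
    and s': "\<forall>k\<in>S. s' k = {k}" "\<forall>k\<in>S. b' k \<in> laws m (global_null m) (s' k)"
    and u: "bound m = K" and ac: "1 < a" "1 < c"
    and l: "\<And>k. k \<in> S \<Longrightarrow> c \<le> Lam k n \<omega> \<or> Lam k n \<omega> \<le> 1 / a"
  shows "T_fwer m s s' b b' a c \<omega> \<le> enat n"
  unfolding T_fwer_eq_local[OF g s s' u ac] by (rule first_time_le[OF n]) (use l not_in_gap_iff in blast)

lemma T_fwer_hit_full:
  assumes g: "regular \<omega>" and n: "1 \<le> n" and s: "\<forall>k\<in>S. s k = {k}" "\<forall>k\<in>S. b k \<in> laws m (global_null m) (s k)"
    and s': "\<forall>k\<in>S. s' k = S" "\<forall>k\<in>S. b' k \<in> laws m (global_null m) (s' k)"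
    and bl: "\<forall>k\<in>S. bl k \<in> laws m (global_null m) {k}"
    and u: "bound m < K" and ac: "1 < a" "1 < c"
    and A: "A \<subseteq> S" "A \<noteq> {}" "card A \<le> bound m"
    and hi: "\<And>k. k \<in> A \<Longrightarrow> c \<le> Lam k n \<omega>" and lo: "\<And>k. k \<in> S - A \<Longrightarrow> Lam k n \<omega> \<le> 1"
    and lo': "\<And>k. card A < bound m \<Longrightarrow> k \<in> S - A \<Longrightarrow> Lam k n \<omega> \<le> 1 / a"
    and gap: "\<And>k j. card A = bound m \<Longrightarrow> k \<in> A \<Longrightarrow> j \<in> S - A \<Longrightarrow> a * Lam j n \<omega> \<le> Lam k n \<omega>"
  shows "T_fwer m s s' b b' a c \<omega> \<le> enat n"
proof -
  obtain \<sigma> where \<sigma>: "bij_betw \<sigma> {1..K} S" "sorted_ratios K (bound m) (\<lambda>i. Lam (\<sigma> i) n \<omega>)"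
      "\<And>i. i \<in> {1..K} \<Longrightarrow> ord_stat m bl i n \<omega> = Lam (\<sigma> i) n \<omega>"
      "num_pos m bl n \<omega> = sorted_ratios.p K (\<lambda>i. Lam (\<sigma> i) n \<omega>)"
      "\<And>a c. tau1_at s s' b b' a c n \<omega> \<longleftrightarrow> sorted_ratios.stop K (bound m) (\<lambda>i. Lam (\<sigma> i) n \<omega>) a c"
    by (rule tau1_condition_sorted[OF g n s s' bl u], rule that)
  interpret sr: sorted_ratios K "bound m" "\<lambda>i. Lam (\<sigma> i) n \<omega>" by fact
  have img: "\<sigma> ` {1..K} = S" and inj: "inj_on \<sigma> {1..K}" using \<sigma>(1) by (auto simp: bij_betw_def)
  define A' where "A' = {i\<in>{1..K}. \<sigma> i \<in> A}"
  have "A \<subseteq> \<sigma> ` {1..K}" using A(1) img by blast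
  then have "\<sigma> ` A' = A" unfolding A'_def by blast
  moreover have A'K: "A' \<subseteq> {1..K}" by (auto simp: A'_def)
  ultimately have cA: "card A' = card A" using card_image[OF inj_on_subset[OF inj A'K]] by simp
  have "A' \<noteq> {}" using \<open>\<sigma> ` A' = A\<close> A by auto
  have mem: "\<sigma> i \<in> A" if "i \<in> A'" for i using that by (simp add: A'_def)
  have mem': "\<sigma> i \<in> S - A" if "i \<in> {1..K} - A'" for i using that img by (auto simp: A'_def)
  have "sr.stop a c"
    by (rule sr.stop_if_separated[OF ac A'K \<open>A' \<noteq> {}\<close>])
       (use cA A(3) in \<open>simp_all add: hi[OF mem] lo[OF mem'] lo'[OF _ mem'] gap[OF _ mem mem']\<close>)
  then have "tau1 m s s' b b' a c \<omega> \<le> enat n"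
    unfolding tau1_def by (intro first_time_le[OF n] \<sigma>(5)[THEN iffD2])
  then show ?thesis unfolding T_fwer_def by (rule min.coboundedI2)
qed

end

section \<open>Lower bound on the mean sample size\<close>

lemma eventually_small_pair:
  assumes "0 < \<eta>" "\<And>g d. 0 < g \<Longrightarrow> g < \<eta> \<Longrightarrow> 0 < d \<Longrightarrow> d < \<eta> \<Longrightarrow> \<phi> g d"
  shows "\<forall>\<^sub>F (g, d) in at_right (0::real) \<times>\<^sub>F at_right (0::real). \<phi> g d"
proof -
  have "\<forall>\<^sub>F x in at_right (0::real). 0 < x \<and> x < \<eta>"
    unfolding eventually_at_right_field using assms(1) by (intro exI[of _ \<eta>]) auto
  from eventually_prodI[OF this this] show ?thesis
    by eventually_elim (use assms(2) in auto)
qed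

lemma mean_time_ge:
  assumes "prob_space P" and m: "{\<omega>\<in>space P. T \<omega> \<le> enat n} \<in> sets P"
  shows "ennreal ((real n + 1) * (1 - measure P {\<omega>\<in>space P. T \<omega> \<le> enat n})) \<le> mean_time P T"
proof -
  interpret prob_space P by fact
  let ?A = "{\<omega>\<in>space P. T \<omega> \<le> enat n}"
  have "ennreal ((real n + 1) * (1 - measure P ?A)) = ennreal (real n + 1) * emeasure P (space P - ?A)"
    using prob_compl[OF m] by (simp add: emeasure_eq_measure ennreal_mult)
  also have "\<dots> = (\<integral>\<^sup>+\<omega>. ennreal (real n + 1) * indicator (space P - ?A) \<omega> \<partial>P)"
    using m by (intro nn_integral_cmult_indicator[symmetric]) auto
  also have "\<dots> \<le> mean_time P T" unfolding mean_time_def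
  proof (rule nn_integral_mono)
    fix \<omega> assume "\<omega> \<in> space P"
    show "ennreal (real n + 1) * indicator (space P - ?A) \<omega> \<le> ennreal_of_enat (T \<omega>)"
    proof (cases "\<omega> \<in> space P - ?A")
      case True
      then have "enat n < T \<omega>" by auto
      then have "enat (Suc n) \<le> T \<omega>" using ileI1 by (simp flip: eSuc_enat)
      then have "ennreal_of_enat (enat (Suc n)) \<le> ennreal_of_enat (T \<omega>)" by (simp only: ennreal_of_enat_le_iff)
      moreover have "ennreal_of_enat (enat (Suc n)) = ennreal (real n + 1)"
        by (simp add: ennreal_of_nat_eq_real_of_nat add.commute)
      ultimately show ?thesis using True by (simp add: add.commute)
    qed simp
  qed
  finally show ?thesis .
qed

context model_setting begin

text \<open>A set in the sigma-algebra at a stopping time is observable at time \<open>\<infinity>\<close>.\<close>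
lemma decision_event:
  assumes T: "stopping_time (filt m S) T"
    and D: "D \<in> measurable (filtration.pre_sigma (space (paths m S)) (filt m S) T) (count_space UNIV)"
  shows "{\<omega>\<in>space (paths m S). D \<omega> \<in> V \<and> T \<omega> \<le> t} \<in> sets (filt m S t)"
    and "R \<in> fam m \<Longrightarrow> {\<omega>\<in>space R. D \<omega> \<in> V} \<in> sets R"
proof -
  interpret F: filtration "space (paths m S)" "filt m S" by (rule filtration_filt)
  have "{\<omega>\<in>space (paths m S). D \<omega> \<in> V} \<in> sets (F.pre_sigma T)"
    using measurable_sets[OF D, of V] by (simp add: F.space_pre_sigma vimage_def Int_def conj_commute)
  from F.sets_pre_sigmaD[OF T this]
  have *: "{\<omega>\<in>{\<omega>\<in>space (paths m S). D \<omega> \<in> V}. T \<omega> \<le> t} \<in> sets (filt m S t)" for t .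
  then show "{\<omega>\<in>space (paths m S). D \<omega> \<in> V \<and> T \<omega> \<le> t} \<in> sets (filt m S t)" by simp
  show "{\<omega>\<in>space R. D \<omega> \<in> V} \<in> sets R" if R: "R \<in> fam m"
    using *[of \<infinity>] filt_subalgebra[of m S \<infinity>] sets_fam[OF R] space_fam[OF R] by (auto simp: subalgebra_def)
qed

lemma lr_measurable:
  assumes "P' \<in> fam m" "s \<subseteq> S"
  shows "lr m s n (law m P s) (law m Q s) \<in> borel_measurable P'"
proof -
  have "(\<lambda>\<omega>. RN_deriv (sub Q s n) (sub P s n) (restrict \<omega> s)) \<in> borel_measurable P'"
    by (rule measurable_compose[OF measurable_restr_fam[OF assms] filt_measurable_paths[OF RN_sub_measurable]])
  then show ?thesis unfolding lr_def by measurable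
qed

lemma lr_measurable_filt: "L S n P Q \<in> borel_measurable (filt m S (enat n))"
proof -
  have "(\<lambda>\<omega>. RN_deriv (sub Q S n) (sub P S n) (restrict \<omega> S)) \<in> borel_measurable (filt m S (enat n))"
    by (rule measurable_compose[OF measurable_filt_restrict RN_sub_measurable]) simp
  then show ?thesis unfolding lr_def by measurable
qed

lemma change_of_measure:
  assumes P: "P \<in> FP" and Q: "Q \<in> FP" and n: "1 \<le> n" and E: "E \<in> sets (filt m S (enat n))" and x: "0 \<le> x"
  shows "measure P {\<omega>\<in>E. L S n P Q \<omega> < x} \<le> x * measure Q E"
proof -
  note P' = fam_PsiD[OF P] and Q' = fam_PsiD[OF Q]
  interpret P: prob_space P using prob_fam[OF P'] .
  interpret Q: prob_space Q using prob_fam[OF Q'] .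
  let ?E = "{\<omega>\<in>E. L S n P Q \<omega> < x}"
  have "?E = E \<inter> {\<omega>\<in>space (filt m S (enat n)). L S n P Q \<omega> < x}" using sets.sets_into_space[OF E] by auto
  also have "\<dots> \<in> sets (filt m S (enat n))"
    using E borel_measurable_less[OF lr_measurable_filt borel_measurable_const] by (intro sets.Int) auto
  finally have E': "?E \<in> sets (filt m S (enat n))" .
  interpret SQ: sigma_finite_measure "sub Q S n" using sf_sub Q' by auto
  have "AE y in sub Q S n. RN_deriv (sub Q S n) (sub P S n) y \<noteq> \<infinity>"
    by (rule SQ.RN_deriv_finite) (use sf_sub P' mutual_ac[OF Q P sources_nonempty _ n] in auto)
  from AE_sub_lift[OF Q' _ this]
  have fin: "AE \<omega> in Q. RN_deriv (sub Q S n) (sub P S n) (restrict \<omega> S) \<noteq> \<infinity>" by simp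
  have "emeasure P ?E = (\<integral>\<^sup>+\<omega>. RN_deriv (sub Q S n) (sub P S n) \<omega> * indicator ?E \<omega> \<partial>Q)"
    using sub_change_of_measure[OF P Q sources_nonempty _ n E'] by (simp add: law_full[OF P'] law_full[OF Q'] del: RN_deriv_def)
  also have "\<dots> \<le> (\<integral>\<^sup>+\<omega>. ennreal x * indicator E \<omega> \<partial>Q)"
  proof (rule nn_integral_mono_AE)
    show "AE \<omega> in Q. RN_deriv (sub Q S n) (sub P S n) \<omega> * indicator ?E \<omega> \<le> ennreal x * indicator E \<omega>"
      using fin AE_space
    proof eventually_elim
      case (elim \<omega>)
      have r: "restrict \<omega> S = \<omega>" using elim(2) by (simp add: space_fam[OF Q'] space_paths PiE_restrict)
      have "RN_deriv (sub Q S n) (sub P S n) \<omega> \<le> ennreal x" if "L S n P Q \<omega> < x"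
      proof -
        have "RN_deriv (sub Q S n) (sub P S n) \<omega> = ennreal (L S n P Q \<omega>)"
          using elim(1) unfolding lr_def r by (simp add: less_top)
        then show ?thesis using that by (simp add: ennreal_leI)
      qed
      then show ?case by (auto simp: indicator_def)
    qed
  qed
  also have "\<dots> = ennreal x * emeasure Q E"
  proof (rule nn_integral_cmult_indicator)
    show "E \<in> sets Q" using E filt_subalgebra[of m S] sets_fam[OF Q'] by (auto simp: subalgebra_def)
  qed
  also have "\<dots> = ennreal (x * measure Q E)" using x by (simp add: Q.emeasure_eq_measure ennreal_mult)
  finally show ?thesis using x by (simp add: P.emeasure_eq_measure)
qed

text \<open>
  On \<open>{T \<le> n, D \<in> U}\<close>, an event observable at time \<open>n\<close>, either the likelihood ratio is large or the change of
  measure bounds the probability by that under \<open>Q\<close>. Using the ratio at time \<open>n\<close> avoids evaluating it at \<open>T\<close>.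
\<close>
lemma stop_before_bound:
  assumes P: "P \<in> FP" and Q: "Q \<in> FP" and n: "1 \<le> n" and x: "0 \<le> x"
    and T: "stopping_time (filt m S) T"
    and D: "D \<in> measurable (filtration.pre_sigma (space (paths m S)) (filt m S) T) (count_space UNIV)"
  shows "{\<omega>\<in>space P. T \<omega> \<le> enat n} \<in> sets P"
    and "measure P {\<omega>\<in>space P. T \<omega> \<le> enat n} \<le> measure P {\<omega>\<in>space P. D \<omega> \<notin> U}
      + measure P {\<omega>\<in>space P. x \<le> L S n P Q \<omega>} + x * measure Q {\<omega>\<in>space Q. D \<omega> \<in> U}"
proof -
  note P' = fam_PsiD[OF P] and Q' = fam_PsiD[OF Q]
  interpret P: prob_space P using prob_fam[OF P'] .
  interpret Q: prob_space Q using prob_fam[OF Q'] .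
  interpret F: filtration "space (paths m S)" "filt m S" by (rule filtration_filt)
  have spf: "space (filt m S (enat n)) = space (paths m S)" by (rule F.space_F)
  have sp: "space P = space (paths m S)" "space Q = space (paths m S)" using space_fam P' Q' by auto
  have sub: "sets (filt m S t) \<subseteq> sets P" "sets (filt m S t) \<subseteq> sets Q" for t
    using filt_subalgebra[of m S] sets_fam P' Q' by (auto simp: subalgebra_def)
  have DPs: "{\<omega>\<in>space P. D \<omega> \<in> V} \<in> sets P" "{\<omega>\<in>space Q. D \<omega> \<in> V} \<in> sets Q" for V
    using decision_event(2)[OF T D] P' Q' by auto
  have TP: "{\<omega>\<in>space (paths m S). T \<omega> \<le> enat n} \<in> sets (filt m S (enat n))"
    using stopping_timeD[OF T, of "enat n"] by (simp add: pred_def spf)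
  then show Tm: "{\<omega>\<in>space P. T \<omega> \<le> enat n} \<in> sets P" using sub sp by auto
  let ?E = "{\<omega>\<in>space (paths m S). D \<omega> \<in> U \<and> T \<omega> \<le> enat n}"
  have E: "?E \<in> sets (filt m S (enat n))" by (rule decision_event(1)[OF T D])
  have Lm: "L S n P Q \<in> borel_measurable P" by (rule lr_measurable[OF P']) simp
  have Ls: "{\<omega>\<in>space P. x \<le> L S n P Q \<omega>} \<in> sets P" "{\<omega>\<in>space P. L S n P Q \<omega> < x} \<in> sets P"
    using Lm by measurable
  have Es: "{\<omega>\<in>?E. L S n P Q \<omega> < x} \<in> sets P"
  proof -
    have "{\<omega>\<in>?E. L S n P Q \<omega> < x} = ?E \<inter> {\<omega>\<in>space P. L S n P Q \<omega> < x}" using sp by auto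
    then show ?thesis using Ls E sub by auto
  qed
  have D': "{\<omega>\<in>space P. D \<omega> \<notin> U} \<in> sets P" using DPs(1)[of "- U"] by simp
  have "measure P {\<omega>\<in>space P. T \<omega> \<le> enat n} \<le> measure P ({\<omega>\<in>space P. D \<omega> \<notin> U} \<union> {\<omega>\<in>space P. x \<le> L S n P Q \<omega>} \<union> {\<omega>\<in>?E. L S n P Q \<omega> < x})"
    using D' Ls Es sp by (intro P.finite_measure_mono) auto
  also have "\<dots> \<le> measure P {\<omega>\<in>space P. D \<omega> \<notin> U} + measure P {\<omega>\<in>space P. x \<le> L S n P Q \<omega>} + measure P {\<omega>\<in>?E. L S n P Q \<omega> < x}"
    using D' Ls Es by (intro order_trans[OF measure_Un_le] add_mono measure_Un_le order_refl) auto
  also have "measure P {\<omega>\<in>?E. L S n P Q \<omega> < x} \<le> x * measure Q ?E"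
    by (rule change_of_measure[OF P Q n E x])
  also have "x * measure Q ?E \<le> x * measure Q {\<omega>\<in>space Q. D \<omega> \<in> U}"
    using x DPs(2)[of U] sp by (intro mult_left_mono Q.finite_measure_mono) auto
  finally show "measure P {\<omega>\<in>space P. T \<omega> \<le> enat n} \<le> measure P {\<omega>\<in>space P. D \<omega> \<notin> U}
      + measure P {\<omega>\<in>space P. x \<le> L S n P Q \<omega>} + x * measure Q {\<omega>\<in>space Q. D \<omega> \<in> U}" by simp
qed

abbreviation "lr_rarely_above P Q \<rho> \<equiv>
  (\<lambda>n. measure P {\<omega>\<in>space P. exp (real n * \<rho>) \<le> L S n P Q \<omega>}) \<longlonglongrightarrow> 0"

text \<open>
  With \<open>n\<close> slightly below \<open>\<bar>ln \<alpha>\<bar> / I\<close> all three terms of the preceding bound are small: the error probability under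
  \<open>P\<close>, the probability of an excessive likelihood ratio, and \<open>exp (n \<rho>) * \<alpha>\<close>, a positive power of \<open>\<alpha>\<close>. The threshold
  for \<open>\<alpha>\<close> and \<open>\<beta>\<close> does not depend on the test, as is needed for the infimum over all tests.
\<close>
lemma mean_time_lower_bound:
  assumes P: "P \<in> FP" and Q: "Q \<in> FP" and I: "0 < I"
    and tail: "\<And>\<rho>. I < \<rho> \<Longrightarrow> lr_rarely_above P Q \<rho>"
    and e: "0 < e" "e < 1"
  obtains \<eta> where "0 < \<eta>" "\<eta> \<le> 1" "\<And>\<alpha> \<beta> T D U. \<lbrakk>0 < \<alpha>; \<alpha> < \<eta>; 0 < \<beta>; \<beta> < \<eta>; stopping_time (filt m S) T;
      D \<in> measurable (filtration.pre_sigma (space (paths m S)) (filt m S) T) (count_space UNIV);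
      measure P {\<omega>\<in>space P. D \<omega> \<notin> U} \<le> \<beta>; measure Q {\<omega>\<in>space Q. D \<omega> \<in> U} \<le> \<alpha>\<rbrakk>
      \<Longrightarrow> ennreal ((1 - e) * (\<bar>ln \<alpha>\<bar> / I)) \<le> mean_time P T"
proof -
  \<comment> \<open>Three factors \<open>1 - t\<close> are lost: in the rate, in the choice of \<open>n\<close>, and in the probability that \<open>T > n\<close>.\<close>
  define t where "t = e / 3"
  define \<rho> where "\<rho> = I / (1 - t)"
  have t: "0 < t" "t < 1" and e3: "e = 3 * t" using e by (auto simp: t_def)
  have \<rho>: "I < \<rho>" "0 < \<rho>" using I t by (auto simp: \<rho>_def less_divide_eq)
  have "eventually (\<lambda>n. measure P {\<omega>\<in>space P. exp (real n * \<rho>) \<le> L S n P Q \<omega>} < t / 3) sequentially"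
    using order_tendstoD(2)[OF tail[OF \<rho>(1)], of "t/3"] t by simp
  then obtain n0 where n0: "\<And>n. n0 \<le> n \<Longrightarrow> measure P {\<omega>\<in>space P. exp (real n * \<rho>) \<le> L S n P Q \<omega>} < t / 3"
    by (auto simp: eventually_sequentially)
  have lim: "filterlim (\<lambda>\<alpha>. (1 - t) * (- ln \<alpha>) / \<rho>) at_top (at_right 0)"
    using t \<rho> by real_asymp
  have lim2: "((\<lambda>\<alpha>. \<alpha> powr t) \<longlongrightarrow> 0) (at_right (0::real))" using t by real_asymp
  have "eventually (\<lambda>\<alpha>. real (n0 + 1) \<le> (1 - t) * (- ln \<alpha>) / \<rho> \<and> \<alpha> powr t < t / 3 \<and> \<alpha> < t / 3 \<and> \<alpha> < 1) (at_right 0)"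
  proof (intro eventually_conj)
    show "\<forall>\<^sub>F \<alpha> in at_right 0. real (n0 + 1) \<le> (1 - t) * (- ln \<alpha>) / \<rho>"
      using lim by (auto simp: filterlim_at_top)
    show "\<forall>\<^sub>F \<alpha> in at_right 0. \<alpha> powr t < t / 3" by (rule order_tendstoD(2)[OF lim2]) (use t in simp)
    show "\<forall>\<^sub>F \<alpha> in at_right 0. \<alpha> < t / 3" unfolding eventually_at_right_field
      by (intro exI[of _ "t / 3"]) (use t in auto)
    show "\<forall>\<^sub>F \<alpha> in at_right 0. \<alpha> < (1::real)" unfolding eventually_at_right_field
      by (intro exI[of _ 1]) auto
  qed
  then obtain \<eta>' where \<eta>': "0 < \<eta>'" "\<And>\<alpha>. 0 < \<alpha> \<Longrightarrow> \<alpha> < \<eta>' \<Longrightarrow> real (n0 + 1) \<le> (1 - t) * (- ln \<alpha>) / \<rho> \<and> \<alpha> powr t < t / 3 \<and> \<alpha> < t / 3 \<and> \<alpha> < 1"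
    unfolding eventually_at_right_field by auto
  show ?thesis
  proof (rule that[of "min 1 \<eta>'"])
    fix \<alpha> \<beta> T D U
    assume a: "0 < \<alpha>" "\<alpha> < min 1 \<eta>'" and b: "0 < \<beta>" "\<beta> < min 1 \<eta>'" and T: "stopping_time (filt m S) T"
      and D: "D \<in> measurable (filtration.pre_sigma (space (paths m S)) (filt m S) T) (count_space UNIV)"
      and PQ: "measure P {\<omega>\<in>space P. D \<omega> \<notin> U} \<le> \<beta>" "measure Q {\<omega>\<in>space Q. D \<omega> \<in> U} \<le> \<alpha>"
    \<comment> \<open>By this choice \<open>exp (z * \<rho>) * \<alpha> = \<alpha> powr t\<close>.\<close>
    define z where "z = (1 - t) * (- ln \<alpha>) / \<rho>"
    define n where "n = nat \<lfloor>z\<rfloor>"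
    have z: "real (n0 + 1) \<le> z" and ae: "\<alpha> powr t < t / 3" and be: "\<beta> < t / 3" and a1: "\<alpha> < 1"
      using \<eta>'(2)[of \<alpha>] \<eta>'(2)[of \<beta>] a b by (auto simp: z_def)
    have n: "real n \<le> z" "z < real n + 1" unfolding n_def using z by linarith+
    have "n0 + 1 \<le> n" unfolding n_def using z by (simp add: le_nat_floor)
    then have nn: "1 \<le> n" "n0 \<le> n" by auto
    have "exp (real n * \<rho>) * \<alpha> \<le> exp (z * \<rho>) * \<alpha>" using n \<rho> a by (intro mult_right_mono) auto
    also have "z * \<rho> = (1 - t) * (- ln \<alpha>)" using \<rho> by (simp add: z_def)
    also have "exp ((1 - t) * (- ln \<alpha>)) * \<alpha> = exp ((1 - t) * (- ln \<alpha>)) * exp (ln \<alpha>)" using a by simp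
    also have "\<dots> = \<alpha> powr t" unfolding exp_add[symmetric] powr_def using a by (simp add: algebra_simps)
    finally have ea: "exp (real n * \<rho>) * \<alpha> < t / 3" using ae by simp
    note sb = stop_before_bound[OF P Q nn(1) exp_ge_zero[of "real n * \<rho>"] T D]
    have Tm: "{\<omega>\<in>space P. T \<omega> \<le> enat n} \<in> sets P" by (rule sb(1))
    have "exp (real n * \<rho>) * measure Q {\<omega>\<in>space Q. D \<omega> \<in> U} \<le> exp (real n * \<rho>) * \<alpha>"
      using PQ(2) by (intro mult_left_mono) auto
    then have le: "measure P {\<omega>\<in>space P. T \<omega> \<le> enat n} \<le> t"
      using sb(2)[of U] n0[OF nn(2)] ea be PQ(1) by linarith
    have "(1 - e) * (\<bar>ln \<alpha>\<bar> / I) \<le> ((1 - t) * (1 - t) * (1 - t)) * (- ln \<alpha> / I)"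
    proof -
      have "1 - e \<le> (1 - t) * (1 - t) * (1 - t)"
      proof -
        have "(1 - t) * (1 - t) * (1 - t) = 1 - e + t * t * (3 - t)"
          using e3 by (simp add: algebra_simps)
        moreover have "0 \<le> t * t * (3 - t)" using t by simp
        ultimately show ?thesis by linarith
      qed
      moreover have "0 \<le> - ln \<alpha> / I" using a a1 I by (simp add: divide_nonpos_pos)
      moreover have "\<bar>ln \<alpha>\<bar> = - ln \<alpha>" using a a1 by simp
      ultimately show ?thesis by (metis mult_right_mono)
    qed
    also have "\<dots> = z * (1 - t)" unfolding z_def \<rho>_def using I t by (simp add: field_simps)
    also have "\<dots> \<le> (real n + 1) * (1 - measure P {\<omega>\<in>space P. T \<omega> \<le> enat n})"
      using n le t by (intro mult_mono) auto
    finally have "ennreal ((1 - e) * (\<bar>ln \<alpha>\<bar> / I)) \<le> ennreal ((real n + 1) * (1 - measure P {\<omega>\<in>space P. T \<omega> \<le> enat n}))"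
      by (rule ennreal_leI)
    also have "\<dots> \<le> mean_time P T" by (rule mean_time_ge[OF prob_fam[OF fam_PsiD[OF P]] Tm])
    finally show "ennreal ((1 - e) * (\<bar>ln \<alpha>\<bar> / I)) \<le> mean_time P T" .
  qed (use \<eta>' in auto)
qed

text \<open>
  The local family of source \<open>k\<close> that is wrong under \<open>P\<close>.
\<close>
definition opposite :: "'x path measure \<Rightarrow> nat \<Rightarrow> 'x path measure set" where
  "opposite P k = (if k \<in> active m P then hyps m k else alts m k)"

definition src_llr :: "nat \<Rightarrow> nat \<Rightarrow> 'x path measure \<Rightarrow> 'x path measure \<Rightarrow> 'x path \<Rightarrow> real" where
  "src_llr k n P X \<omega> = ln (lr m {k} n (law m P {k}) X \<omega>)"

abbreviation "rarely_above P k X \<rho> \<equiv>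
  (\<lambda>n. measure P {\<omega>\<in>space P. real n * \<rho> \<le> src_llr k n P X \<omega>}) \<longlonglongrightarrow> 0"

abbreviation "summably_below P k X \<rho> \<equiv>
  summable (\<lambda>n. measure P {\<omega>\<in>space P. src_llr k n P X \<omega> < real n * \<rho>})"

text \<open>
  The exponential rate at which the likelihood ratio separates \<open>P\<close> from \<open>X\<close> in source \<open>k\<close>, in both senses in which
  it is assumed: it is exceeded with vanishing probability, and undershot summably often.
\<close>
definition llr_rate :: "'x path measure \<Rightarrow> nat \<Rightarrow> 'x path measure \<Rightarrow> real \<Rightarrow> bool" where
  "llr_rate P k X I \<longleftrightarrow> 0 < I \<and>
     (\<forall>\<rho>>I. rarely_above P k X \<rho>) \<and>
     (\<forall>\<rho><I. summably_below P k X \<rho>)"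

definition rate :: "'x path measure \<Rightarrow> nat \<Rightarrow> real" where
  "rate P k = Min ((\<lambda>X. SOME I. llr_rate P k X I) ` opposite P k)"

lemma src_llr_measurable: "P \<in> fam m \<Longrightarrow> k \<in> S \<Longrightarrow> src_llr k n P (law m Q {k}) \<in> borel_measurable P"
  unfolding src_llr_def using lr_measurable[of P "{k}" n P Q] by measurable

lemma opposite_finite: "k \<in> S \<Longrightarrow> finite (opposite P k) \<and> opposite P k \<noteq> {}"
  using fin_alts fin_hyps alts_ne hyps_ne by (auto simp: opposite_def)

lemma opposite_law: assumes "k \<in> S" "X \<in> opposite P k" obtains Q where "Q \<in> FP" "law m Q {k} = X"
    "k \<in> active m P \<Longrightarrow> Q \<in> global_null m" "k \<notin> active m P \<Longrightarrow> Q \<in> alt_Psi m k"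
proof (cases "k \<in> active m P")
  case True
  then have "X \<in> laws m (global_null m) {k}" using assms laws_null by (simp add: opposite_def)
  then show ?thesis using that True null_subset by (auto simp: laws_def)
next
  case False
  then have "X \<in> laws m (alt_Psi m k) {k}" using assms laws_alt by (simp add: opposite_def)
  then show ?thesis using that False alt_subset by (auto simp: laws_def)
qed

text \<open>
  The rate conditions are stated for a law with a signal in \<open>k\<close> against one without, in both directions; which
  direction applies depends on whether \<open>k\<close> is a signal under \<open>P\<close>. The running maximum bounds the last value.
\<close>
lemma llr_rate_exists:
  assumes P: "P \<in> FP" and k: "k \<in> S" and X: "X \<in> opposite P k"
  shows "\<exists>I. llr_rate P k X I"
proof -
  obtain Q where Q: "Q \<in> FP" "law m Q {k} = X"
    "k \<in> active m P \<Longrightarrow> Q \<in> global_null m" "k \<notin> active m P \<Longrightarrow> Q \<in> alt_Psi m k"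
    using opposite_law[OF k X] by blast
  have "\<exists>I>0. max_bound m {k} P Q I \<and> complete_bound m {k} P Q I"
  proof (cases "k \<in> active m P")
    case True
    then have "P \<in> alt_Psi m k" "Q \<in> hyp_Psi m k \<union> global_null m" using P Q by (auto simp: alt_Psi_def)
    then show ?thesis using MCC k unfolding cond_M_CC_def by blast
  next
    case False
    then have "Q \<in> alt_Psi m k" "P \<in> hyp_Psi m k \<union> global_null m" using Q hyp_null_iff[OF P] by auto
    then show ?thesis using MCC k unfolding cond_M_CC_def by blast
  qed
  then obtain I where I: "0 < I" "max_bound m {k} P Q I" "complete_bound m {k} P Q I" by blast
  interpret P: prob_space P using prob_fam[OF fam_PsiD[OF P]] .
  have e: "llr m {k} n P Q \<omega> = src_llr k n P X \<omega>" for n \<omega> by (simp add: llr_def src_llr_def Q(2))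
  have meas[measurable]: "src_llr k n P X \<in> borel_measurable P" for n
    using src_llr_measurable[OF fam_PsiD[OF P] k, of n Q] by (simp add: Q(2))
  have "rarely_above P k X \<rho>" if "I < \<rho>" for \<rho>
  proof (rule tendsto_sandwich[OF _ _ tendsto_const])
    show "(\<lambda>n. measure P {\<omega>\<in>space P. Max ((\<lambda>i. llr m {k} i P Q \<omega>) ` {1..n}) \<ge> real n * \<rho>}) \<longlonglongrightarrow> 0"
      using I(2) that by (simp add: max_bound_def)
    show "\<forall>\<^sub>F n in sequentially. measure P {\<omega>\<in>space P. real n * \<rho> \<le> src_llr k n P X \<omega>} \<le>
      measure P {\<omega>\<in>space P. Max ((\<lambda>i. llr m {k} i P Q \<omega>) ` {1..n}) \<ge> real n * \<rho>}"
      using eventually_ge_at_top[of 1]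
    proof eventually_elim
      case (elim n)
      have eq: "{\<omega>\<in>space P. Max ((\<lambda>i. llr m {k} i P Q \<omega>) ` {1..n}) \<ge> real n * \<rho>} =
        (\<Union>i\<in>{1..n}. {\<omega>\<in>space P. real n * \<rho> \<le> src_llr k i P X \<omega>})"
        using elim by (auto simp: Max_ge_iff e)
      have "{\<omega>\<in>space P. Max ((\<lambda>i. llr m {k} i P Q \<omega>) ` {1..n}) \<ge> real n * \<rho>} \<in> sets P"
        unfolding eq by measurable
      then show ?case by (rule P.finite_measure_mono[rotated]) (use elim eq in auto)
    qed
  qed auto
  moreover have "summably_below P k X \<rho>" if "\<rho> < I" for \<rho>
    using I(3) that by (simp add: complete_bound_def e)
  ultimately show ?thesis using I(1) unfolding llr_rate_def by blast
qed

lemma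
  assumes P: "P \<in> FP" and k: "k \<in> S"
  shows rate_pos: "0 < rate P k"
    and rate_attained: "\<exists>X\<in>opposite P k. \<forall>\<rho>>rate P k. rarely_above P k X \<rho>"
    and rate_summable: "\<And>X \<rho>. X \<in> opposite P k \<Longrightarrow> \<rho> < rate P k \<Longrightarrow>
          summably_below P k X \<rho>"
proof -
  let ?r = "\<lambda>X. SOME I. llr_rate P k X I"
  have r: "llr_rate P k X (?r X)" if "X \<in> opposite P k" for X
    using someI_ex[OF llr_rate_exists[OF P k that]] .
  have fin: "finite (?r ` opposite P k)" "?r ` opposite P k \<noteq> {}" using opposite_finite[OF k] by auto
  have "rate P k \<in> ?r ` opposite P k" unfolding rate_def by (rule Min_in[OF fin])
  then obtain X where X: "X \<in> opposite P k" "rate P k = ?r X" by auto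
  have rX: "llr_rate P k X (rate P k)" unfolding X(2) by (rule r[OF X(1)])
  then show "0 < rate P k" unfolding llr_rate_def by blast
  show "\<exists>X\<in>opposite P k. \<forall>\<rho>>rate P k. rarely_above P k X \<rho>"
    using rX X(1) unfolding llr_rate_def by blast
  show "summably_below P k X \<rho>" if "X \<in> opposite P k" "\<rho> < rate P k" for X \<rho>
  proof -
    have "rate P k \<le> ?r X" unfolding rate_def by (rule Min_le) (use fin that in auto)
    then have "\<rho> < ?r X" using that(2) by (rule less_le_trans[rotated])
    then show ?thesis using r[OF that(1)] unfolding llr_rate_def by blast
  qed
qed

text \<open>
  Replacing the law of each source in \<open>J\<close> by one of its opposite family turns signals into non-signals and
  conversely, hence the symmetric difference.
\<close>
lemma alter_sources:
  assumes P: "P \<in> FP" and J: "J \<subseteq> S" and X: "\<And>j. j \<in> J \<Longrightarrow> X j \<in> opposite P j"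
    and A: "(active m P - J) \<union> (J - active m P) \<in> Psi m"
  obtains Q where "Q \<in> FP" "active m Q = (active m P - J) \<union> (J - active m P)"
    "\<And>j. j \<in> J \<Longrightarrow> law m Q {j} = X j" "\<And>k. k \<in> S - J \<Longrightarrow> law m Q {k} = law m P {k}"
proof -
  let ?R = "\<lambda>k. if k \<in> J then X k else law m P {k}"
  have R: "?R k \<in> (if k \<in> (active m P - J) \<union> (J - active m P) then alts m k else hyps m k)" if "k \<in> S" for k
    using X[of k] fam_Psi_law[OF P that] by (auto simp: opposite_def split: if_splits)
  obtain Q where Q: "Q \<in> FP" "active m Q = (active m P - J) \<union> (J - active m P)" "\<And>k. k \<in> S \<Longrightarrow> law m Q {k} = ?R k"
    using combine_source_laws[OF A R] by blast
  show ?thesis by (rule that[OF Q(1,2)]) (use Q(3) J in auto)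
qed

text \<open>
  By independence only the changed sources contribute, and if the sum of their log-likelihood ratios is
  too large then so is one of them.
\<close>
lemma likelihood_tail:
  assumes P: "P \<in> FP" and Q: "Q \<in> FP" and J: "J \<subseteq> S" "J \<noteq> {}"
    and eq: "\<And>k. k \<in> S - J \<Longrightarrow> law m Q {k} = law m P {k}"
    and tail: "\<And>j \<rho>. j \<in> J \<Longrightarrow> r j < \<rho> \<Longrightarrow> rarely_above P j (law m Q {j}) \<rho>"
    and \<rho>: "(\<Sum>j\<in>J. r j) < \<rho>"
  shows "lr_rarely_above P Q \<rho>"
proof -
  note P' = fam_PsiD[OF P]
  interpret P: prob_space P using prob_fam[OF P'] .
  have fJ: "finite J" by (rule finite_subset[OF J(1) finite_sources])
  \<comment> \<open>The slack in the rate, shared equally by the changed sources.\<close>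
  define e where "e = (\<rho> - (\<Sum>j\<in>J. r j)) / card J"
  have cJ: "0 < card J" using fJ J by (simp add: card_gt_0_iff)
  have e: "0 < e" using \<rho> cJ by (simp add: e_def)
  have sum: "(\<Sum>j\<in>J. r j + e) = \<rho>" using cJ by (simp add: sum.distrib e_def)
  have meas[measurable]: "src_llr j n P (law m Q {j}) \<in> borel_measurable P" if "j \<in> J" for j n
    by (rule src_llr_measurable[OF P']) (use J that in auto)
  let ?B = "\<lambda>n j. {\<omega>\<in>space P. real n * (r j + e) \<le> src_llr j n P (law m Q {j}) \<omega>}"
  have Bm: "?B n j \<in> sets P" if "j \<in> J" for n j using meas[OF that] by measurable
  have incl: "AE \<omega> in P. \<omega> \<in> {\<omega>\<in>space P. exp (real n * \<rho>) \<le> L S n P Q \<omega>} \<longrightarrow> \<omega> \<in> (\<Union>j\<in>J. ?B n j)" if n: "1 \<le> n" for n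
    using AE_regular[OF P]
  proof eventually_elim
    case (elim \<omega>)
    show ?case
    proof (intro impI, rule ccontr)
      assume a: "\<omega> \<in> {\<omega>\<in>space P. exp (real n * \<rho>) \<le> L S n P Q \<omega>}" and b: "\<omega> \<notin> (\<Union>j\<in>J. ?B n j)"
      have pos: "0 < L {k} n P Q \<omega>" if "k \<in> S" for k using regularD(1)[OF elim n P Q, of "{k}"] that by auto
      have one: "L {k} n P Q \<omega> = 1" if "k \<in> S - J" for k
        using regular_refl[OF elim n P, of "{k}"] eq[OF that] that by auto
      have "L S n P Q \<omega> = (\<Prod>k\<in>S. L {k} n P Q \<omega>)" by (rule regular_product[OF elim n P Q])
      also have "\<dots> = (\<Prod>k\<in>J. L {k} n P Q \<omega>)"
        by (rule prod.mono_neutral_right) (use J one in auto)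
      also have "\<dots> = exp (\<Sum>k\<in>J. src_llr k n P (law m Q {k}) \<omega>)"
        unfolding exp_sum[OF fJ] by (rule prod.cong) (use J pos in \<open>auto simp: src_llr_def\<close>)
      also have "\<dots> < exp (\<Sum>k\<in>J. real n * (r k + e))"
        unfolding exp_less_cancel_iff using a b by (intro sum_strict_mono fJ J) auto
      also have "(\<Sum>k\<in>J. real n * (r k + e)) = real n * \<rho>" by (simp add: sum_distrib_left[symmetric] sum)
      finally show False using a by auto
    qed
  qed
  show ?thesis
  proof (rule tendsto_sandwich[OF _ _ tendsto_const])
    show "(\<lambda>n. \<Sum>j\<in>J. measure P (?B n j)) \<longlonglongrightarrow> 0"
      by (rule tendsto_null_sum) (rule tail, use e in auto)
    show "\<forall>\<^sub>F n in sequentially. measure P {\<omega>\<in>space P. exp (real n * \<rho>) \<le> L S n P Q \<omega>} \<le> (\<Sum>j\<in>J. measure P (?B n j))"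
      using eventually_ge_at_top[of 1]
    proof eventually_elim
      case (elim n)
      have "measure P {\<omega>\<in>space P. exp (real n * \<rho>) \<le> L S n P Q \<omega>} \<le> measure P (\<Union>j\<in>J. ?B n j)"
        using incl[OF elim] by (rule P.finite_measure_mono_AE) (use Bm fJ in auto)
      also have "\<dots> \<le> (\<Sum>j\<in>J. measure P (?B n j))"
        by (rule measure_UNION_le[OF fJ]) (use Bm in auto)
      finally show ?case .
    qed
  qed auto
qed

text \<open>
  The source \<open>j0\<close> provides the event that separates the two laws: membership of \<open>j0\<close> in the decision is right
  under one of them and wrong under the other. A wrongly declared signal costs \<open>\<gamma>\<close>, a missed one \<open>\<delta>\<close>.
\<close>
lemma test_class_lower_bound:
  assumes P: "P \<in> FP" and J: "J \<subseteq> S" and j0: "j0 \<in> J"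
    and A: "(active m P - J) \<union> (J - active m P) \<in> Psi m" and e: "0 < e" "e < 1"
  shows "\<forall>\<^sub>F (\<gamma>, \<delta>) in at_right 0 \<times>\<^sub>F at_right 0. \<forall>T D. (T, D) \<in> test_class m \<gamma> \<delta> \<longrightarrow>
    ennreal ((1 - e) * (\<bar>ln (if j0 \<in> active m P then \<gamma> else \<delta>)\<bar> / (\<Sum>j\<in>J. rate P j))) \<le> mean_time P T"
proof -
  note P' = fam_PsiD[OF P]
  have "\<forall>j\<in>J. \<exists>X. X \<in> opposite P j \<and> (\<forall>\<rho>>rate P j. rarely_above P j X \<rho>)"
  proof
    fix j assume "j \<in> J"
    then have "j \<in> S" using J by blast
    from rate_attained[OF P this]
    show "\<exists>X. X \<in> opposite P j \<and> (\<forall>\<rho>>rate P j. rarely_above P j X \<rho>)"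
      by blast
  qed
  from bchoice[OF this] obtain X where X': "\<forall>j\<in>J. X j \<in> opposite P j \<and>
      (\<forall>\<rho>>rate P j. rarely_above P j (X j) \<rho>)" ..
  then have X: "\<And>j. j \<in> J \<Longrightarrow> X j \<in> opposite P j"
    "\<And>j \<rho>. j \<in> J \<Longrightarrow> rate P j < \<rho> \<Longrightarrow> rarely_above P j (X j) \<rho>"
    by blast+
  obtain Q where Q: "Q \<in> FP" "active m Q = (active m P - J) \<union> (J - active m P)"
    "\<And>j. j \<in> J \<Longrightarrow> law m Q {j} = X j" "\<And>k. k \<in> S - J \<Longrightarrow> law m Q {k} = law m P {k}"
    using alter_sources[OF P J X(1) A] by blast
  let ?I = "\<Sum>j\<in>J. rate P j"
  have I: "0 < ?I" by (rule sum_pos) (use J j0 rate_pos[OF P] finite_subset[OF J] in auto)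
  have tail: "lr_rarely_above P Q \<rho>" if "?I < \<rho>" for \<rho>
    by (rule likelihood_tail[OF P Q(1) J _ Q(4) _ that]) (use j0 X(2) Q(3) in auto)
  obtain \<eta> where \<eta>: "0 < \<eta>" "\<eta> \<le> 1" "\<And>\<alpha> \<beta> T (D :: 'x path \<Rightarrow> nat set) U. \<lbrakk>0 < \<alpha>; \<alpha> < \<eta>; 0 < \<beta>; \<beta> < \<eta>; stopping_time (filt m S) T;
      D \<in> measurable (filtration.pre_sigma (space (paths m S)) (filt m S) T) (count_space UNIV);
      measure P {\<omega>\<in>space P. D \<omega> \<notin> U} \<le> \<beta>; measure Q {\<omega>\<in>space Q. D \<omega> \<in> U} \<le> \<alpha>\<rbrakk>
      \<Longrightarrow> ennreal ((1 - e) * (\<bar>ln \<alpha>\<bar> / ?I)) \<le> mean_time P T"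
    using mean_time_lower_bound[OF P Q(1) I tail e] by blast
  show ?thesis
  proof (rule eventually_small_pair[OF \<eta>(1)], intro allI impI)
    fix \<gamma> \<delta> T D assume g: "0 < \<gamma>" "\<gamma> < \<eta>" and d: "0 < \<delta>" "\<delta> < \<eta>" and T: "(T, D) \<in> test_class m \<gamma> \<delta>"
    have st: "stopping_time (filt m S) T"
      "D \<in> measurable (filtration.pre_sigma (space (paths m S)) (filt m S) T) (count_space UNIV)"
      using T by (auto simp: test_class_def)
    have err: "measure R {\<omega>\<in>space R. D \<omega> - active m R \<noteq> {}} \<le> \<gamma>" "measure R {\<omega>\<in>space R. active m R - D \<omega> \<noteq> {}} \<le> \<delta>"
      if "R \<in> FP" for R using T that by (auto simp: test_class_def)
    have Dm: "{\<omega>\<in>space R. D \<omega> \<in> V} \<in> sets R" if R: "R \<in> FP" for R V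
      by (rule decision_event(2)[OF st fam_PsiD[OF R]])
    have mono: "measure R {\<omega>\<in>space R. D \<omega> \<in> V} \<le> x"
      if "R \<in> FP" "measure R {\<omega>\<in>space R. D \<omega> \<in> W} \<le> x" "V \<subseteq> W" for R V W x
    proof -
      interpret R: prob_space R using prob_fam fam_PsiD that by auto
      have "measure R {\<omega>\<in>space R. D \<omega> \<in> V} \<le> measure R {\<omega>\<in>space R. D \<omega> \<in> W}"
        by (rule R.finite_measure_mono) (use that Dm in auto)
      with that show ?thesis by simp
    qed
    show "ennreal ((1 - e) * (\<bar>ln (if j0 \<in> active m P then \<gamma> else \<delta>)\<bar> / ?I)) \<le> mean_time P T"
    proof (cases "j0 \<in> active m P")
      case True
      have 1: "measure P {\<omega>\<in>space P. D \<omega> \<in> - {V. j0 \<in> V}} \<le> \<delta>"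
        by (rule mono[OF P, of "{V. active m P - V \<noteq> {}}"]) (use err[OF P] True in auto)
      have 2: "measure Q {\<omega>\<in>space Q. D \<omega> \<in> {V. j0 \<in> V}} \<le> \<gamma>"
        by (rule mono[OF Q(1), of "{V. V - active m Q \<noteq> {}}"]) (use err[OF Q(1)] True Q(2) j0 in auto)
      show ?thesis using \<eta>(3)[OF g d st, of "{V. j0 \<in> V}"] 1 2 True by simp
    next
      case False
      have 1: "measure P {\<omega>\<in>space P. D \<omega> \<in> {V. j0 \<in> V}} \<le> \<gamma>"
        by (rule mono[OF P, of "{V. V - active m P \<noteq> {}}"]) (use err[OF P] False in auto)
      have 2: "measure Q {\<omega>\<in>space Q. D \<omega> \<in> {V. j0 \<notin> V}} \<le> \<delta>"
        by (rule mono[OF Q(1), of "{V. active m Q - V \<noteq> {}}"]) (use err[OF Q(1)] False Q(2) j0 in auto)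
      show ?thesis using \<eta>(3)[OF d g st, of "{V. j0 \<notin> V}"] 1 2 False by simp
    qed
  qed
qed

end

section \<open>Upper bound on the mean sample size\<close>

lemma ennreal_of_enat_leI:
  assumes "\<And>t. enat t \<le> T \<Longrightarrow> of_nat t \<le> (z :: ennreal)"
  shows "ennreal_of_enat T \<le> z"
proof (cases T)
  case (enat t)
  then show ?thesis using assms[of t] by simp
next
  case infinity
  then have "of_nat t \<le> z" for t using assms[of t] by simp
  then have "z = \<top>" by (metis ennreal_Ex_less_of_nat not_less top.not_eq_extremum)
  then show ?thesis by simp
qed

text \<open>
  While \<open>T\<close> exceeds \<open>n \<ge> N\<close> the bad event at time \<open>n\<close> occurs, so \<open>T\<close> is at most \<open>N\<close> plus the number of bad events.
\<close>
lemma mean_time_le_count: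
  assumes P: "prob_space P" and B: "\<And>n. B n \<in> sets P" and sm: "summable (\<lambda>n. measure P (B n))"
    and hit: "AE \<omega> in P. \<forall>n\<ge>N. \<omega> \<notin> B n \<longrightarrow> T \<omega> \<le> enat n"
  shows "mean_time P T \<le> ennreal (real N + (\<Sum>n. measure P (B n)))"
proof -
  interpret prob_space P by fact
  have "mean_time P T \<le> (\<integral>\<^sup>+\<omega>. ennreal (real N) + (\<Sum>n. indicator (B n) \<omega>) \<partial>P)"
    unfolding mean_time_def
  proof (rule nn_integral_mono_AE)
    show "AE \<omega> in P. ennreal_of_enat (T \<omega>) \<le> ennreal (real N) + (\<Sum>n. indicator (B n) \<omega>)"
      using hit
    proof eventually_elim
      case (elim \<omega>)
      show ?case
      proof (rule ennreal_of_enat_leI)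
        fix t assume t: "enat t \<le> T \<omega>"
        have b: "\<omega> \<in> B n" if "n \<in> {N..<t}" for n
        proof (rule ccontr)
          assume "\<omega> \<notin> B n"
          then have "T \<omega> \<le> enat n" using elim that by auto
          with t have "enat t \<le> enat n" by (rule order_trans)
          then show False using that by simp
        qed
        have "real t \<le> real N + real (t - N)" by simp
        then have "(of_nat t :: ennreal) \<le> ennreal (real N + real (t - N))"
          by (simp add: ennreal_of_nat_eq_real_of_nat del: of_nat_add flip: of_nat_add)
        also have "\<dots> = ennreal (real N) + (\<Sum>n\<in>{N..<t}. indicator (B n) \<omega>)"
          using b by (simp add: ennreal_of_nat_eq_real_of_nat)
        also have "\<dots> \<le> ennreal (real N) + (\<Sum>n. indicator (B n) \<omega>)"
          by (intro add_left_mono sum_le_suminf) auto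
        finally show "of_nat t \<le> ennreal (real N) + (\<Sum>n. indicator (B n) \<omega>)" .
      qed
    qed
  qed
  also have "\<dots> = ennreal (real N) + (\<integral>\<^sup>+\<omega>. (\<Sum>n. indicator (B n) \<omega>) \<partial>P)"
    using B by (subst nn_integral_add) (auto simp: emeasure_space_1)
  also have "(\<integral>\<^sup>+\<omega>. (\<Sum>n. indicator (B n) \<omega>) \<partial>P) = (\<Sum>n. \<integral>\<^sup>+\<omega>. indicator (B n) \<omega> \<partial>P)"
    using B by (intro nn_integral_suminf) auto
  also have "\<dots> = (\<Sum>n. ennreal (measure P (B n)))"
    using B by (simp add: emeasure_eq_measure)
  also have "\<dots> = ennreal (\<Sum>n. measure P (B n))" by (rule suminf_ennreal2[OF _ sm]) simp
  finally show ?thesis using sm by (simp add: ennreal_plus suminf_nonneg)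
qed

context model_setting begin

text \<open>
  The law of \<open>P\<close> is among those over which one of the two maxima is taken and bounds it from below. The chain rule
  compares it with the law attaining the other maximum, which belongs to the opposite family.
\<close>
lemma Lam_ge:
  assumes g: "regular \<omega>" "1 \<le> n" and P: "P \<in> FP" and k: "k \<in> S" "k \<in> active m P"
    and h: "\<And>X. X \<in> opposite P k \<Longrightarrow> x \<le> src_llr k n P X \<omega>"
  shows "exp x \<le> Lam k n \<omega>"
proof -
  have NF: "null_ref \<in> FP" using null_ref null_subset by auto
  have "null_max null_ref k n \<omega> \<in> (\<lambda>R. lr m {k} n R (law m null_ref {k}) \<omega>) ` hyps m k"
    unfolding null_max_def by (rule Max_in) (use fin_hyps hyps_ne k in auto)
  then obtain X where X: "X \<in> hyps m k" "null_max null_ref k n \<omega> = lr m {k} n X (law m null_ref {k}) \<omega>" by auto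
  then have Xo: "X \<in> opposite P k" using k by (simp add: opposite_def)
  obtain Q where Q: "Q \<in> FP" "law m Q {k} = X" using src_law_FP[OF k(1), of X] X(1) by blast
  have pos: "0 < L {k} n P Q \<omega>" using regularD(1)[OF g P Q(1), of "{k}"] k by auto
  have hp: "0 < null_max null_ref k n \<omega>" by (rule alt_null_max_pos(2)[OF g k(1) NF])
  have "exp x \<le> L {k} n P Q \<omega>" using h[OF Xo] pos unfolding src_llr_def Q(2) by (simp add: ln_ge_iff)
  then have "exp x * null_max null_ref k n \<omega> \<le> L {k} n P Q \<omega> * null_max null_ref k n \<omega>" using hp by (intro mult_right_mono) auto
  also have "\<dots> = L {k} n P null_ref \<omega>" using regularD(2)[OF g P Q(1) _ _ NF, of "{k}"] k X(2) Q(2) by simp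
  also have "\<dots> \<le> alt_max null_ref k n \<omega>" unfolding alt_max_def
    by (rule Max_ge) (use fin_alts[OF k(1)] fam_Psi_law[OF P k(1)] k in auto)
  finally show ?thesis using hp by (simp add: Lam_eq[OF g k(1) null_ref] pos_le_divide_eq)
qed

lemma Lam_le:
  assumes g: "regular \<omega>" "1 \<le> n" and P: "P \<in> FP" and k: "k \<in> S" "k \<notin> active m P"
    and h: "\<And>X. X \<in> opposite P k \<Longrightarrow> x \<le> src_llr k n P X \<omega>"
  shows "Lam k n \<omega> \<le> exp (- x)"
proof -
  have NF: "null_ref \<in> FP" using null_ref null_subset by auto
  have "alt_max null_ref k n \<omega> \<in> (\<lambda>R. lr m {k} n R (law m null_ref {k}) \<omega>) ` alts m k"
    unfolding alt_max_def by (rule Max_in) (use fin_alts alts_ne k in auto)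
  then obtain X where X: "X \<in> alts m k" "alt_max null_ref k n \<omega> = lr m {k} n X (law m null_ref {k}) \<omega>" by auto
  then have Xo: "X \<in> opposite P k" using k by (simp add: opposite_def)
  obtain Q where Q: "Q \<in> FP" "law m Q {k} = X" using src_law_FP[OF k(1), of X] X(1) by blast
  have pos: "0 < L {k} n P Q \<omega>" using regularD(1)[OF g P Q(1), of "{k}"] k by auto
  have hp: "0 < null_max null_ref k n \<omega>" "0 < alt_max null_ref k n \<omega>" by (rule alt_null_max_pos[OF g k(1) NF])+
  have "exp x \<le> L {k} n P Q \<omega>" using h[OF Xo] pos unfolding src_llr_def Q(2) by (simp add: ln_ge_iff)
  then have "exp x * alt_max null_ref k n \<omega> \<le> L {k} n P Q \<omega> * alt_max null_ref k n \<omega>" using hp by (intro mult_right_mono) auto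
  also have "\<dots> = L {k} n P null_ref \<omega>" using regularD(2)[OF g P Q(1) _ _ NF, of "{k}"] k X(2) Q(2) by simp
  also have "\<dots> \<le> null_max null_ref k n \<omega>" unfolding null_max_def
    by (rule Max_ge) (use fin_hyps[OF k(1)] fam_Psi_law[OF P k(1)] k in auto)
  finally show ?thesis using hp by (simp add: Lam_eq[OF g k(1) null_ref] exp_minus field_simps)
qed

text \<open>
  The separation at which the test has stopped if \<open>P\<close> is the true law. In the case of \<open>u\<close> signals their lead over the
  other sources replaces the bound \<open>1 / a\<close>.
\<close>
definition hit_at :: "'x path measure \<Rightarrow> real \<Rightarrow> real \<Rightarrow> nat \<Rightarrow> 'x path \<Rightarrow> bool" where
  "hit_at P a c n \<omega> \<longleftrightarrow> (\<forall>k\<in>active m P. c \<le> Lam k n \<omega>) \<and> (\<forall>k\<in>S - active m P. Lam k n \<omega> \<le> 1) \<and>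
     (card (active m P) < bound m \<longrightarrow> (\<forall>k\<in>S - active m P. Lam k n \<omega> \<le> 1 / a)) \<and>
     (card (active m P) = bound m \<longrightarrow> (\<forall>k\<in>active m P. \<forall>j\<in>S - active m P. a * Lam j n \<omega> \<le> Lam k n \<omega>))"

text \<open>
  The bad event at time \<open>n\<close> is that some source falls short of its rate against some opposite law. By
  complete convergence the constant is finite, and it depends on \<open>P\<close> and \<open>r\<close> but not on the thresholds.
\<close>
lemma mean_time_hit:
  assumes P: "P \<in> FP" and r: "\<And>k. k \<in> S \<Longrightarrow> r k < rate P k"
  shows "\<exists>C\<ge>0. \<forall>T N. 1 \<le> N \<longrightarrow> (AE \<omega> in P. \<forall>n\<ge>N. (\<forall>k\<in>active m P. exp (real n * r k) \<le> Lam k n \<omega>) \<and>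
      (\<forall>k\<in>S - active m P. Lam k n \<omega> \<le> exp (- (real n * r k))) \<longrightarrow> T \<omega> \<le> enat n) \<longrightarrow>
      mean_time P T \<le> ennreal (real N + C)"
proof -
  note P' = fam_PsiD[OF P]
  interpret P: prob_space P using prob_fam[OF P'] .
  let ?b = "\<lambda>n k X. {\<omega>\<in>space P. src_llr k n P X \<omega> < real n * r k}"
  define B where "B n = (\<Union>k\<in>S. \<Union>X\<in>opposite P k. ?b n k X)" for n
  have bm: "?b n k X \<in> sets P" if k: "k \<in> S" "X \<in> opposite P k" for n k X
  proof -
    obtain Q where "law m Q {k} = X" using opposite_law[OF k] by blast
    then have [measurable]: "src_llr k n P X \<in> borel_measurable P" using src_llr_measurable[OF P' k(1), of n Q] by simp
    show ?thesis by measurable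
  qed
  have fo: "finite (opposite P k)" if "k \<in> S" for k using opposite_finite[OF that] by blast
  have Bm: "B n \<in> sets P" for n unfolding B_def using bm fo by (intro sets.finite_UN) auto
  have Ble: "measure P (B n) \<le> (\<Sum>k\<in>S. \<Sum>X\<in>opposite P k. measure P (?b n k X))" for n
  proof -
    have "measure P (B n) \<le> (\<Sum>k\<in>S. measure P (\<Union>X\<in>opposite P k. ?b n k X))"
      unfolding B_def by (rule measure_UNION_le) (use bm fo in auto)
    also have "\<dots> \<le> (\<Sum>k\<in>S. \<Sum>X\<in>opposite P k. measure P (?b n k X))"
      by (intro sum_mono measure_UNION_le) (use bm fo in auto)
    finally show ?thesis .
  qed
  have sm: "summable (\<lambda>n. measure P (B n))"
  proof (rule summable_comparison_test')
    show "summable (\<lambda>n. \<Sum>k\<in>S. \<Sum>X\<in>opposite P k. measure P (?b n k X))"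
      by (intro summable_sum rate_summable[OF P] r)
    show "norm (measure P (B n)) \<le> (\<Sum>k\<in>S. \<Sum>X\<in>opposite P k. measure P (?b n k X))" if "0 \<le> n" for n
      using Ble[of n] by simp
  qed
  show ?thesis
  proof (intro exI[of _ "\<Sum>n. measure P (B n)"] conjI allI impI)
    show "0 \<le> (\<Sum>n. measure P (B n))" using sm by (intro suminf_nonneg) auto
    fix T :: "'x path \<Rightarrow> enat" and N :: nat
    assume N: "1 \<le> N" and h: "AE \<omega> in P. \<forall>n\<ge>N. (\<forall>k\<in>active m P. exp (real n * r k) \<le> Lam k n \<omega>) \<and>
      (\<forall>k\<in>S - active m P. Lam k n \<omega> \<le> exp (- (real n * r k))) \<longrightarrow> T \<omega> \<le> enat n"
    show "mean_time P T \<le> ennreal (real N + (\<Sum>n. measure P (B n)))"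
    proof (rule mean_time_le_count[OF P.prob_space_axioms Bm sm])
      show "AE \<omega> in P. \<forall>n\<ge>N. \<omega> \<notin> B n \<longrightarrow> T \<omega> \<le> enat n"
        using h AE_regular[OF P] AE_space
      proof eventually_elim
        case (elim \<omega>)
        show ?case
        proof (intro allI impI)
          fix n assume n: "N \<le> n" and nb: "\<omega> \<notin> B n"
          then have n1: "1 \<le> n" using N by simp
          have x: "real n * r k \<le> src_llr k n P X \<omega>" if "k \<in> S" "X \<in> opposite P k" for k X
            using nb that elim(3) unfolding B_def by force
          have "exp (real n * r k) \<le> Lam k n \<omega>" if "k \<in> active m P" for k
            by (rule Lam_ge[OF elim(2) n1 P _ that x]) (use that active_sub[OF P] in auto)
          moreover have "Lam k n \<omega> \<le> exp (- (real n * r k))" if "k \<in> S - active m P" for k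
            by (rule Lam_le[OF elim(2) n1 P _ _ x]) (use that in auto)
          ultimately show "T \<omega> \<le> enat n" using elim(1) n by blast
        qed
      qed
    qed
  qed
qed

definition min_rate :: "'x path measure \<Rightarrow> nat set \<Rightarrow> real" where "min_rate P A = Min (rate P ` A)"

text \<open>
  The weights of \<open>\<bar>ln \<gamma>\<bar>\<close> and \<open>\<bar>ln \<delta>\<bar>\<close> in the first-order mean sample size \<open>max (\<bar>ln \<gamma>\<bar> w\<^sub>\<gamma>) (\<bar>ln \<delta>\<bar> w\<^sub>\<delta>)\<close>. A weight of 0 stands
  for an error that cannot be forced by changing \<open>P\<close>: there is no signal to remove or no source to add.
\<close>
definition weight_gamma where "weight_gamma P = (if active m P = {} then 0 else 1 / min_rate P (active m P))"

definition weight_delta where "weight_delta P = (if S - active m P = {} then 0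
   else if card (active m P) < bound m then 1 / min_rate P (S - active m P)
   else 1 / (min_rate P (active m P) + min_rate P (S - active m P)))"

lemma
  assumes P: "P \<in> FP" and A: "A \<subseteq> S" "A \<noteq> {}"
  shows min_rate_pos: "0 < min_rate P A" and min_rate_le: "\<And>k. k \<in> A \<Longrightarrow> min_rate P A \<le> rate P k"
    and min_rate_attained: "\<exists>k\<in>A. rate P k = min_rate P A"
proof -
  have f: "finite (rate P ` A)" "rate P ` A \<noteq> {}" using A finite_subset[OF A(1) finite_sources] by auto
  have "min_rate P A \<in> rate P ` A" unfolding min_rate_def by (rule Min_in[OF f])
  then show "\<exists>k\<in>A. rate P k = min_rate P A" by auto
  then show "0 < min_rate P A" using rate_pos[OF P] A by force
  show "\<And>k. k \<in> A \<Longrightarrow> min_rate P A \<le> rate P k" unfolding min_rate_def using f by (intro Min_le) auto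
qed

lemma active_nonempty_if_full: assumes "P \<in> FP" "card (active m P) = bound m" shows "active m P \<noteq> {}"
  using assms(2) bound_pos by auto

lemma weights_nonneg: assumes P: "P \<in> FP"
  shows "0 \<le> weight_gamma P" "0 \<le> weight_delta P" "0 < weight_gamma P \<or> 0 < weight_delta P"
proof -
  let ?A = "active m P"
  have A: "?A \<subseteq> S" "card ?A \<le> bound m" using active_sub[OF P] active_Psi[OF P] by (auto simp: Psi_def)
  have g: "0 < min_rate P ?A" if "?A \<noteq> {}" using min_rate_pos[OF P A(1) that] .
  have d: "0 < min_rate P (S - ?A)" if "S - ?A \<noteq> {}" using min_rate_pos[OF P _ that] by auto
  show "0 \<le> weight_gamma P" using g by (auto simp: weight_gamma_def less_imp_le)
  have full: "?A \<noteq> {}" if "\<not> card ?A < bound m" using active_nonempty_if_full[OF P] that A by auto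
  show "0 \<le> weight_delta P"
    using g d full by (auto simp: weight_delta_def less_imp_le add_nonneg_nonneg)
  show "0 < weight_gamma P \<or> 0 < weight_delta P"
  proof (cases "?A = {}")
    case True
    then show ?thesis using d sources_nonempty bound_pos by (auto simp: weight_delta_def)
  next
    case False
    then show ?thesis using g by (simp add: weight_gamma_def)
  qed
qed

lemma mean_time_lower:
  assumes P: "P \<in> FP" and e: "0 < e" "e < 1"
  shows "\<forall>\<^sub>F (g, d) in at_right 0 \<times>\<^sub>F at_right 0.
    ennreal ((1 - e) * max (weight_gamma P * \<bar>ln g\<bar>) (weight_delta P * \<bar>ln d\<bar>)) \<le> (INF (T, D)\<in>test_class m g d. mean_time P T)"
proof -
  let ?A = "active m P"
  have A: "?A \<subseteq> S" "card ?A \<le> bound m" using active_sub[OF P] active_Psi[OF P] by (auto simp: Psi_def)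
  have fA: "finite ?A" by (rule finite_subset[OF A(1) finite_sources])
  have 1: "\<forall>\<^sub>F (g, d) in at_right 0 \<times>\<^sub>F at_right 0. \<forall>T D. (T, D) \<in> test_class m g d \<longrightarrow> ennreal ((1 - e) * (weight_gamma P * \<bar>ln g\<bar>)) \<le> mean_time P T"
  proof (cases "?A = {}")
    case True
    then show ?thesis by (simp add: weight_gamma_def case_prod_unfold)
  next
    case False
    obtain k where k: "k \<in> ?A" "rate P k = min_rate P ?A" using min_rate_attained[OF P A(1) False] by blast
    have J: "{k} \<subseteq> S" using k A by auto
    have Ps: "(?A - {k}) \<union> ({k} - ?A) \<in> Psi m"
      using A k fA card_Diff1_le[of ?A k] by (auto simp: Psi_def insert_absorb)
    show ?thesis using test_class_lower_bound[OF P J insertI1 Ps e]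
      by eventually_elim (use k False in \<open>auto simp: weight_gamma_def\<close>)
  qed
  have 2: "\<forall>\<^sub>F (g, d) in at_right 0 \<times>\<^sub>F at_right 0. \<forall>T D. (T, D) \<in> test_class m g d \<longrightarrow> ennreal ((1 - e) * (weight_delta P * \<bar>ln d\<bar>)) \<le> mean_time P T"
  proof (cases "S - ?A = {}")
    case True
    then show ?thesis by (simp add: weight_delta_def case_prod_unfold)
  next
    case ne: False
    obtain j where j: "j \<in> S - ?A" "rate P j = min_rate P (S - ?A)" using min_rate_attained[OF P _ ne] by auto
    show ?thesis
    proof (cases "card ?A < bound m")
      case True
      have J: "{j} \<subseteq> S" using j by auto
      have "(?A - {j}) \<union> ({j} - ?A) = insert j ?A" using j by auto
      then have Ps: "(?A - {j}) \<union> ({j} - ?A) \<in> Psi m"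
        using A j fA True by (auto simp: Psi_def)
      show ?thesis using test_class_lower_bound[OF P J insertI1 Ps e]
        by eventually_elim (use j ne True in \<open>auto simp: weight_delta_def\<close>)
    next
      case False
      then have cA: "card ?A = bound m" using A by auto
      obtain k where k: "k \<in> ?A" "rate P k = min_rate P ?A"
        using min_rate_attained[OF P A(1) active_nonempty_if_full[OF P cA]] by blast
      have J: "{j, k} \<subseteq> S" and jk: "j \<noteq> k" using j k A by auto
      have "(?A - {j, k}) \<union> ({j, k} - ?A) = insert j (?A - {k})" using j k by auto
      moreover have "card (insert j (?A - {k})) = card ?A"
        using j fA card_Suc_Diff1[OF fA k(1)] by simp
      ultimately have Ps: "(?A - {j, k}) \<union> ({j, k} - ?A) \<in> Psi m"
        using A j by (auto simp: Psi_def)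
      show ?thesis using test_class_lower_bound[OF P J insertI1 Ps e]
        by eventually_elim (use j k ne False jk in \<open>auto simp: weight_delta_def add.commute\<close>)
    qed
  qed
  show ?thesis using 1 2
  proof eventually_elim
    case (elim x)
    obtain g d where x: "x = (g, d)" by (cases x)
    have "ennreal ((1 - e) * max (weight_gamma P * \<bar>ln g\<bar>) (weight_delta P * \<bar>ln d\<bar>)) \<le> mean_time P T" if "(T, D) \<in> test_class m g d" for T D
      using elim that unfolding x by (auto simp: max_def)
    then show ?case unfolding x by (auto intro!: INF_greatest)
  qed
qed

text \<open>
  At times beyond the maximum of the two terms, enlarged by \<open>1 + e\<close>, rates reduced by the same factor suffice for
  all thresholds. The additive constant collects the mean number of bad times and the rounding.
\<close>
lemma mean_time_upper:
  assumes P: "P \<in> FP" and e: "0 < e"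
    and hit: "\<And>a c. 1 < a \<Longrightarrow> 1 < c \<Longrightarrow> AE \<omega> in P. \<forall>n\<ge>1. hit_at P a c n \<omega> \<longrightarrow> T a c \<omega> \<le> enat n"
  shows "\<exists>C. \<forall>a>1. \<forall>c>1. mean_time P (T a c) \<le> ennreal ((1 + e) * max (weight_gamma P * ln c) (weight_delta P * ln a) + C)"
proof -
  let ?A = "active m P"
  have A: "?A \<subseteq> S" "card ?A \<le> bound m" using active_sub[OF P] active_Psi[OF P] by (auto simp: Psi_def)
  define r where "r k = rate P k / (1 + e)" for k
  have rp: "0 < r k" if "k \<in> S" for k using rate_pos[OF P that] e by (simp add: r_def)
  have r: "r k < rate P k" if "k \<in> S" for k
    using rate_pos[OF P that] e by (simp add: r_def divide_less_eq algebra_simps)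
  obtain C where C: "0 \<le> C" "\<And>T N. 1 \<le> N \<Longrightarrow> (AE \<omega> in P. \<forall>n\<ge>N. (\<forall>k\<in>?A. exp (real n * r k) \<le> Lam k n \<omega>) \<and>
      (\<forall>k\<in>S - ?A. Lam k n \<omega> \<le> exp (- (real n * r k))) \<longrightarrow> T \<omega> \<le> enat n) \<Longrightarrow>
      mean_time P T \<le> ennreal (real N + C)"
    using mean_time_hit[OF P r] by blast
  show ?thesis
  proof (intro exI[of _ "C + 2"] allI impI)
    fix a c :: real assume ac: "1 < a" "1 < c"
    define Z where "Z = (1 + e) * max (weight_gamma P * ln c) (weight_delta P * ln a)"
    have Z0: "0 \<le> Z" unfolding Z_def using e ac weights_nonneg[OF P] by (intro mult_nonneg_nonneg) (auto simp: le_max_iff_disj)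
    \<comment> \<open>The added 1 makes \<open>N\<close> at least 1, the first time of the statistics.\<close>
    define N where "N = nat \<lceil>Z\<rceil> + 1"
    have N: "1 \<le> N" "Z \<le> real N" "real N \<le> Z + 2" unfolding N_def using Z0 by linarith+
    have zc: "ln c \<le> real n * r k" if "N \<le> n" "k \<in> ?A" for n k
    proof -
      have l: "0 < min_rate P ?A" "min_rate P ?A \<le> rate P k" using min_rate_pos[OF P A(1)] min_rate_le[OF P A(1)] that by auto
      have "(1 + e) * (ln c / min_rate P ?A) \<le> Z" unfolding Z_def
        using that e by (intro mult_left_mono) (auto simp: weight_gamma_def)
      then have "(1 + e) * (ln c / min_rate P ?A) \<le> real n" using that N by simp
      then have "ln c \<le> real n * (min_rate P ?A / (1 + e))" using l e by (simp add: field_simps)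
      also have "\<dots> \<le> real n * r k" unfolding r_def using l e by (intro mult_left_mono divide_right_mono) auto
      finally show ?thesis .
    qed
    have za: "ln a \<le> real n * r k" if "N \<le> n" "k \<in> S - ?A" "card ?A < bound m" for n k
    proof -
      have ne: "S - ?A \<noteq> {}" using that by auto
      have l: "0 < min_rate P (S - ?A)" "min_rate P (S - ?A) \<le> rate P k" using min_rate_pos[OF P _ ne] min_rate_le[OF P _ ne] that by auto
      have "(1 + e) * (ln a / min_rate P (S - ?A)) \<le> Z" unfolding Z_def
        using that e ne by (intro mult_left_mono) (auto simp: weight_delta_def)
      then have "(1 + e) * (ln a / min_rate P (S - ?A)) \<le> real n" using that N by simp
      then have "ln a \<le> real n * (min_rate P (S - ?A) / (1 + e))" using l e by (simp add: field_simps)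
      also have "\<dots> \<le> real n * r k" unfolding r_def using l e by (intro mult_left_mono divide_right_mono) auto
      finally show ?thesis .
    qed
    have zb: "ln a \<le> real n * (r k + r j)" if "N \<le> n" "k \<in> ?A" "j \<in> S - ?A" "card ?A = bound m" for n k j
    proof -
      have ne: "S - ?A \<noteq> {}" using that by auto
      let ?l = "min_rate P ?A + min_rate P (S - ?A)"
      have l: "0 < ?l" "?l \<le> rate P k + rate P j"
        using min_rate_pos[OF P _ ne] min_rate_le[OF P _ ne] min_rate_pos[OF P A(1)] min_rate_le[OF P A(1)] that by (force intro: add_pos_pos add_mono)+
      have "(1 + e) * (ln a / ?l) \<le> Z" unfolding Z_def
        using that e ne by (intro mult_left_mono) (auto simp: weight_delta_def)
      then have "(1 + e) * (ln a / ?l) \<le> real n" using that N by simp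
      then have "ln a \<le> real n * (?l / (1 + e))" using l e by (simp add: field_simps)
      also have "\<dots> \<le> real n * ((rate P k + rate P j) / (1 + e))" using l e by (intro mult_left_mono divide_right_mono) auto
      also have "\<dots> = real n * (r k + r j)" by (simp add: r_def add_divide_distrib)
      finally show ?thesis .
    qed
    have "mean_time P (T a c) \<le> ennreal (real N + C)"
    proof (rule C(2)[OF N(1)])
      show "AE \<omega> in P. \<forall>n\<ge>N. (\<forall>k\<in>?A. exp (real n * r k) \<le> Lam k n \<omega>) \<and>
        (\<forall>k\<in>S - ?A. Lam k n \<omega> \<le> exp (- (real n * r k))) \<longrightarrow> T a c \<omega> \<le> enat n"
        using hit[OF ac]
      proof eventually_elim
        case (elim \<omega>)
        show ?case
        proof (intro allI impI, elim conjE)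
          fix n assume n: "N \<le> n" and hi: "\<forall>k\<in>?A. exp (real n * r k) \<le> Lam k n \<omega>"
            and lo: "\<forall>k\<in>S - ?A. Lam k n \<omega> \<le> exp (- (real n * r k))"
          have "hit_at P a c n \<omega>" unfolding hit_at_def
          proof (intro conjI ballI impI)
            fix k assume k: "k \<in> ?A"
            have "c = exp (ln c)" using ac by simp
            also have "\<dots> \<le> exp (real n * r k)" using zc[OF n k] by simp
            finally show "c \<le> Lam k n \<omega>" using hi k by force
          next
            fix k assume k: "k \<in> S - ?A"
            have "Lam k n \<omega> \<le> exp (- (real n * r k))" using lo k by blast
            also have "\<dots> \<le> 1" using rp[of k] k by simp
            finally show "Lam k n \<omega> \<le> 1" .
          next
            fix k assume c: "card ?A < bound m" and k: "k \<in> S - ?A"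
            have "Lam k n \<omega> \<le> exp (- (real n * r k))" using lo k by blast
            also have "\<dots> \<le> exp (- ln a)" using za[OF n k c] by simp
            also have "\<dots> = 1 / a" using ac by (simp add: exp_minus inverse_eq_divide)
            finally show "Lam k n \<omega> \<le> 1 / a" .
          next
            fix k j assume c: "card ?A = bound m" and k: "k \<in> ?A" and j: "j \<in> S - ?A"
            have "a * Lam j n \<omega> \<le> a * exp (- (real n * r j))" using lo j ac by (intro mult_left_mono) auto
            also have "\<dots> = exp (ln a - real n * r j)" using ac by (simp add: exp_diff exp_minus divide_inverse)
            also have "\<dots> \<le> exp (real n * r k)" using zb[OF n k j c] by (simp add: algebra_simps)
            also have "\<dots> \<le> Lam k n \<omega>" using hi k by blast
            finally show "a * Lam j n \<omega> \<le> Lam k n \<omega>" .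
          qed
          then show "T a c \<omega> \<le> enat n" using elim n N by auto
        qed
      qed
    qed
    also have "\<dots> \<le> ennreal (Z + (C + 2))" using N by (intro ennreal_leI) auto
    finally show "mean_time P (T a c) \<le> ennreal ((1 + e) * max (weight_gamma P * ln c) (weight_delta P * ln a) + (C + 2))"
      by (simp add: Z_def)
  qed
qed

end

section \<open>Asymptotic optimality\<close>

lemma ennreal_inverse_antimono:
  assumes "d \<le> c" shows "inverse c \<le> inverse (d :: ennreal)"
proof (cases "d = 0 \<or> c = \<top>")
  case False
  then obtain x y where xy: "d = ennreal x" "0 < x" "c = ennreal y" "0 \<le> y"
    by (cases d; cases c) (use assms in \<open>auto simp: top_unique less_le\<close>)
  then have "x \<le> y" using assms by simp
  then show ?thesis using xy by (simp add: inverse_ennreal ennreal_leI le_imp_inverse_le)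
qed auto

lemma ennreal_divide_mono: "a \<le> b \<Longrightarrow> d \<le> c \<Longrightarrow> a / c \<le> b / (d :: ennreal)"
  unfolding divide_ennreal_def by (intro mult_mono ennreal_inverse_antimono) auto

text \<open>
  The two error levels may tend to 0 at unrelated speeds: the thresholds enter both terms of the maximum with the
  same relative error \<open>e\<close>, hence so does the maximum. As one of the weights is positive, it tends to infinity and
  absorbs the constant.
\<close>
lemma ratio_tendsto_1:
  fixes M I :: "real \<Rightarrow> real \<Rightarrow> ennreal" and A B :: "real \<Rightarrow> real \<Rightarrow> real"
  assumes c: "0 \<le> cg" "0 \<le> cd" "0 < cg \<or> 0 < cd"
    and lo: "\<And>e. 0 < e \<Longrightarrow> e < 1 \<Longrightarrow> \<forall>\<^sub>F (g, d) in at_right 0 \<times>\<^sub>F at_right 0.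
        ennreal ((1 - e) * max (cg * \<bar>ln g\<bar>) (cd * \<bar>ln d\<bar>)) \<le> I g d"
    and hi: "\<And>e. 0 < e \<Longrightarrow> \<exists>C. \<forall>\<^sub>F (g, d) in at_right 0 \<times>\<^sub>F at_right 0.
        M g d \<le> ennreal ((1 + e) * max (cg * ln (B g d)) (cd * ln (A g d)) + C)"
    and IM: "\<forall>\<^sub>F (g, d) in at_right 0 \<times>\<^sub>F at_right 0. I g d \<le> M g d"
    and A: "(\<lambda>(g, d). ln (A g d)) \<sim>[at_right 0 \<times>\<^sub>F at_right 0] (\<lambda>(g, d). \<bar>ln d\<bar>)"
    and B: "(\<lambda>(g, d). ln (B g d)) \<sim>[at_right 0 \<times>\<^sub>F at_right 0] (\<lambda>(g, d). \<bar>ln g\<bar>)"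
  shows "((\<lambda>(g, d). M g d / I g d) \<longlongrightarrow> 1) (at_right 0 \<times>\<^sub>F at_right 0)"
proof -
  let ?F = "at_right 0 \<times>\<^sub>F at_right (0::real) :: (real \<times> real) filter"
  define V where "V g d = max (cg * \<bar>ln g\<bar>) (cd * \<bar>ln d\<bar>)" for g d :: real
  have lnlim: "filterlim (\<lambda>x::real. \<bar>ln x\<bar>) at_top (at_right 0)" by real_asymp
  have f1: "filterlim (\<lambda>x. \<bar>ln (fst x)\<bar>) at_top ?F" by (rule filterlim_compose[OF lnlim filterlim_fst])
  have f2: "filterlim (\<lambda>x. \<bar>ln (snd x)\<bar>) at_top ?F" by (rule filterlim_compose[OF lnlim filterlim_snd])
  have V: "\<forall>\<^sub>F (g, d) in ?F. Z \<le> V g d" for Z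
  proof (cases "0 < cg")
    case True
    have "\<forall>\<^sub>F x in ?F. Z / cg \<le> \<bar>ln (fst x)\<bar>" using f1 by (auto simp: filterlim_at_top)
    then show ?thesis by eventually_elim (use True in \<open>auto simp: V_def pos_divide_le_eq le_max_iff_disj mult.commute split: prod.splits\<close>)
  next
    case False
    then have cd: "0 < cd" using c by auto
    have "\<forall>\<^sub>F x in ?F. Z / cd \<le> \<bar>ln (snd x)\<bar>" using f2 by (auto simp: filterlim_at_top)
    then show ?thesis by eventually_elim (use cd in \<open>auto simp: V_def pos_divide_le_eq le_max_iff_disj mult.commute split: prod.splits\<close>)
  qed
  have asy: "\<forall>\<^sub>F x in ?F. f x \<le> (1 + e) * g x"
    if eq: "f \<sim>[?F] g" and g: "filterlim g at_top ?F" and e: "0 < e" for f g :: "real \<times> real \<Rightarrow> real" and e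
  proof -
    have g0: "\<forall>\<^sub>F x in ?F. 1 \<le> g x" using g by (auto simp: filterlim_at_top)
    then have "\<forall>\<^sub>F x in ?F. g x \<noteq> 0" by eventually_elim auto
    then have "((\<lambda>x. f x / g x) \<longlongrightarrow> 1) ?F" by (rule asymp_equivD_strong[OF eq, OF eventually_mono]) auto
    then have "\<forall>\<^sub>F x in ?F. f x / g x < 1 + e" using e by (intro order_tendstoD(2)) auto
    with g0 show ?thesis by eventually_elim (auto simp: divide_less_eq)
  qed
  have F2: "\<forall>\<^sub>F (g, d) in ?F. M g d / I g d < x" if x: "1 < x" for x :: ennreal
  proof -
    obtain q where q: "1 < q" "ennreal q < x"
    proof -
      obtain z where z: "1 < z" "z < x" using dense[OF x] by auto
      then have "z < \<top>" using less_le_trans top_greatest by blast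
      then obtain q where "z = ennreal q" "0 \<le> q" by (cases z) auto
      with z have "ennreal 1 < ennreal q" by simp
      then have "1 < q" by (subst (asm) ennreal_less_iff) auto
      with z \<open>z = ennreal q\<close> that[of q] show ?thesis by simp
    qed
    \<comment> \<open>The bound on the quotient for relative error \<open>e\<close>; it tends to 1 as \<open>e\<close> does to 0.\<close>
    have "((\<lambda>e::real. ((1 + e) * (1 + e) + e) / (1 - e)) \<longlongrightarrow> ((1 + 0) * (1 + 0) + 0) / (1 - 0)) (at_right 0)"
      by (intro tendsto_intros) auto
    then have "\<forall>\<^sub>F e::real in at_right 0. ((1 + e) * (1 + e) + e) / (1 - e) < q"
      by (rule order_tendstoD(2)) (use q in simp)
    moreover have "\<forall>\<^sub>F e::real in at_right 0. 0 < e \<and> e < 1"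
      unfolding eventually_at_right_field by (intro exI[of _ 1]) auto
    ultimately have "\<forall>\<^sub>F e::real in at_right 0. ((1 + e) * (1 + e) + e) / (1 - e) < q \<and> 0 < e \<and> e < 1"
      by eventually_elim auto
    then obtain e :: real where e: "((1 + e) * (1 + e) + e) / (1 - e) < q" "0 < e" "e < 1"
      using eventually_happens[of _ "at_right (0::real)"] by (auto simp: trivial_limit_at_right_real)
    obtain C where C: "\<forall>\<^sub>F (g, d) in ?F. M g d \<le> ennreal ((1 + e) * max (cg * ln (B g d)) (cd * ln (A g d)) + C)"
      using hi[OF e(2)] by blast
    have a: "\<forall>\<^sub>F x in ?F. (case x of (g, d) \<Rightarrow> ln (A g d)) \<le> (1 + e) * (case x of (g, d) \<Rightarrow> \<bar>ln d\<bar>)"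
      by (rule asy[OF A _ e(2)]) (use f2 in \<open>simp add: case_prod_unfold\<close>)
    have b: "\<forall>\<^sub>F x in ?F. (case x of (g, d) \<Rightarrow> ln (B g d)) \<le> (1 + e) * (case x of (g, d) \<Rightarrow> \<bar>ln g\<bar>)"
      by (rule asy[OF B _ e(2)]) (use f1 in \<open>simp add: case_prod_unfold\<close>)
    show ?thesis using C a b lo[OF e(2,3)] V[of "max 1 (C / e)"]
    proof eventually_elim
      case (elim x')
      obtain g d where x': "x' = (g, d)" by (cases x')
      have h: "M g d \<le> ennreal ((1 + e) * max (cg * ln (B g d)) (cd * ln (A g d)) + C)"
        "ln (A g d) \<le> (1 + e) * \<bar>ln d\<bar>" "ln (B g d) \<le> (1 + e) * \<bar>ln g\<bar>"
        "ennreal ((1 - e) * V g d) \<le> I g d" "1 \<le> V g d" "C / e \<le> V g d"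
        using elim by (auto simp: x' V_def)
      have "cg * ln (B g d) \<le> cg * ((1 + e) * \<bar>ln g\<bar>)" "cd * ln (A g d) \<le> cd * ((1 + e) * \<bar>ln d\<bar>)"
        using h c by (auto intro: mult_left_mono)
      moreover have "cg * ((1 + e) * \<bar>ln g\<bar>) \<le> (1 + e) * V g d" "cd * ((1 + e) * \<bar>ln d\<bar>) \<le> (1 + e) * V g d"
        using e by (auto simp: V_def mult.left_commute intro: mult_left_mono)
      ultimately have "max (cg * ln (B g d)) (cd * ln (A g d)) \<le> (1 + e) * V g d" by linarith
      then have "(1 + e) * max (cg * ln (B g d)) (cd * ln (A g d)) \<le> (1 + e) * ((1 + e) * V g d)"
        using e by (intro mult_left_mono) auto
      moreover have "C \<le> e * V g d" using h(6) e by (simp add: pos_divide_le_eq mult.commute)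
      ultimately have u: "(1 + e) * max (cg * ln (B g d)) (cd * ln (A g d)) + C \<le> ((1 + e) * (1 + e) + e) * V g d"
        by (simp add: algebra_simps)
      have p: "0 < (1 - e) * V g d" using e h(5) by simp
      have "M g d / I g d \<le> ennreal (((1 + e) * (1 + e) + e) * V g d) / ennreal ((1 - e) * V g d)"
        by (rule ennreal_divide_mono) (use h(1,4) ennreal_leI[OF u] in auto)
      also have "\<dots> = ennreal ((((1 + e) * (1 + e) + e) * V g d) / ((1 - e) * V g d))"
        using p e h(5) by (intro divide_ennreal) auto
      also have "(((1 + e) * (1 + e) + e) * V g d) / ((1 - e) * V g d) = ((1 + e) * (1 + e) + e) / (1 - e)"
        using h(5) by simp
      also have "ennreal (((1 + e) * (1 + e) + e) / (1 - e)) < x"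
        using e(1) q(2) by (meson ennreal_leI le_less_trans less_imp_le)
      finally show ?case by (simp add: x')
    qed
  qed
  \<comment> \<open>Finiteness of the numerator and positivity of the denominator make the quotient at least 1 in \<open>ennreal\<close>.\<close>
  have F1: "\<forall>\<^sub>F (g, d) in ?F. 1 \<le> M g d / I g d"
  proof -
    obtain C where C: "\<forall>\<^sub>F (g, d) in ?F. M g d \<le> ennreal ((1 + 1) * max (cg * ln (B g d)) (cd * ln (A g d)) + C)"
      using hi[of 1] by auto
    have l: "\<forall>\<^sub>F (g, d) in ?F. ennreal ((1 - 1/2) * V g d) \<le> I g d" unfolding V_def by (rule lo) auto
    show ?thesis using C IM l V[of 1]
    proof eventually_elim
      case (elim x')
      obtain g d where x': "x' = (g, d)" by (cases x')
      have h: "M g d < \<top>" "I g d \<le> M g d" "ennreal ((1 - 1/2) * V g d) \<le> I g d" "1 \<le> V g d"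
        using elim le_less_trans[OF _ ennreal_less_top] by (auto simp: x')
      have "0 < ennreal ((1 - 1/2) * V g d)" using h(4) by simp
      then have "0 < I g d" using h(3) by (rule less_le_trans)
      moreover have "I g d < \<top>" using h(1,2) by (rule le_less_trans[rotated])
      ultimately have "I g d / I g d = 1" by (intro ennreal_divide_self) auto
      moreover have "I g d / I g d \<le> M g d / I g d" by (rule ennreal_divide_mono) (use h in auto)
      ultimately show ?case by (simp add: x')
    qed
  qed
  show ?thesis
  proof (rule order_tendstoI)
    fix a :: ennreal assume "a < 1"
    then show "\<forall>\<^sub>F x in ?F. a < (case x of (g, d) \<Rightarrow> M g d / I g d)"
      using F1 by (auto elim!: eventually_mono intro: less_le_trans)
  next
    fix a :: ennreal assume "1 < a"
    from F2[OF this] show "\<forall>\<^sub>F x in ?F. (case x of (g, d) \<Rightarrow> M g d / I g d) < a"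
      by (auto elim!: eventually_mono)
  qed
qed

context model_setting begin

lemma asymp_optimal_if_hit:
  fixes A B :: "real \<Rightarrow> real \<Rightarrow> real"
  assumes P: "P \<in> FP"
    and thr: "\<And>\<gamma> \<delta>. \<gamma> \<in> {0<..<1} \<Longrightarrow> \<delta> \<in> {0<..<1} \<Longrightarrow>
        A \<gamma> \<delta> > 1 \<and> B \<gamma> \<delta> > 1 \<and> (T (A \<gamma> \<delta>) (B \<gamma> \<delta>), D (A \<gamma> \<delta>) (B \<gamma> \<delta>)) \<in> test_class m \<gamma> \<delta>"
    and A: "(\<lambda>(\<gamma>, \<delta>). ln (A \<gamma> \<delta>)) \<sim>[at_right 0 \<times>\<^sub>F at_right 0] (\<lambda>(\<gamma>, \<delta>). \<bar>ln \<delta>\<bar>)"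
    and B: "(\<lambda>(\<gamma>, \<delta>). ln (B \<gamma> \<delta>)) \<sim>[at_right 0 \<times>\<^sub>F at_right 0] (\<lambda>(\<gamma>, \<delta>). \<bar>ln \<gamma>\<bar>)"
    and hit: "\<And>a c. 1 < a \<Longrightarrow> 1 < c \<Longrightarrow> AE \<omega> in P. \<forall>n\<ge>1. hit_at P a c n \<omega> \<longrightarrow> T a c \<omega> \<le> enat n"
  shows "asymp_optimal m (\<lambda>\<gamma> \<delta>. T (A \<gamma> \<delta>) (B \<gamma> \<delta>)) P"
  unfolding asymp_optimal_def
proof (rule ratio_tendsto_1[OF weights_nonneg[OF P] mean_time_lower[OF P] _ _ A B])
  fix e :: real assume e: "0 < e"
  obtain C where C: "\<And>a c. 1 < a \<Longrightarrow> 1 < c \<Longrightarrow> mean_time P (T a c) \<le> ennreal ((1 + e) * max (weight_gamma P * ln c) (weight_delta P * ln a) + C)"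
    using mean_time_upper[OF P e hit] by blast
  show "\<exists>C. \<forall>\<^sub>F (g, d) in at_right 0 \<times>\<^sub>F at_right 0. mean_time P (T (A g d) (B g d))
        \<le> ennreal ((1 + e) * max (weight_gamma P * ln (B g d)) (weight_delta P * ln (A g d)) + C)"
    by (rule exI[of _ C], rule eventually_small_pair[of 1]) (use thr C in auto)
next
  show "\<forall>\<^sub>F (g, d) in at_right 0 \<times>\<^sub>F at_right 0. (INF (T, D)\<in>test_class m g d. mean_time P T) \<le> mean_time P (T (A g d) (B g d))"
    by (rule eventually_small_pair[of 1]) (use thr in \<open>force intro: INF_lower2\<close>)+
qed auto

end

theorem theorem5p4:
  fixes m :: "'x model"
    and s s' :: "nat \<Rightarrow> nat set"
    and b b' bl :: "nat \<Rightarrow> 'x path measure"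
    and A B :: "real \<Rightarrow> real \<Rightarrow> real"
  assumes "testing_model m"
    and "independent_sources m"
    and "all_combinations m"
    and "families_nonempty m"
    and "mutually_abs_cont m"
    and "cond_M_CC m"
    and s: "\<forall>k\<in>srcs m. s k = {k}"
    and base_det: "\<forall>k\<in>srcs m. b k \<in> laws m (global_null m) (s k)"
    and base_iso: "\<forall>k\<in>srcs m. b' k \<in> laws m (global_null m) (s' k)"
    and base_loc: "\<forall>k\<in>srcs m. bl k \<in> laws m (global_null m) {k}"
    and thresholds: "\<And>\<gamma> \<delta>. \<gamma> \<in> {0<..<1} \<Longrightarrow> \<delta> \<in> {0<..<1} \<Longrightarrow>
        A \<gamma> \<delta> > 1 \<and> B \<gamma> \<delta> > 1 \<and>
        (T_fwer m s s' b b' (A \<gamma> \<delta>) (B \<gamma> \<delta>), D_fwer m s s' b b' (A \<gamma> \<delta>) (B \<gamma> \<delta>))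
          \<in> test_class m \<gamma> \<delta>"
    and "(\<lambda>(\<gamma>, \<delta>). ln (A \<gamma> \<delta>)) \<sim>[at_right 0 \<times>\<^sub>F at_right 0] (\<lambda>(\<gamma>, \<delta>). \<bar>ln \<delta>\<bar>)"
    and "(\<lambda>(\<gamma>, \<delta>). ln (B \<gamma> \<delta>)) \<sim>[at_right 0 \<times>\<^sub>F at_right 0] (\<lambda>(\<gamma>, \<delta>). \<bar>ln \<gamma>\<bar>)"
  shows "(bound m = nsrc m \<and> (\<forall>k\<in>srcs m. s' k = {k}) \<longrightarrow>
            (\<forall>P\<in>fam_Psi m.
               asymp_optimal m (\<lambda>\<gamma> \<delta>. T_fwer m s s' b b' (A \<gamma> \<delta>) (B \<gamma> \<delta>)) P \<and>
               (\<forall>a>1. \<forall>c>1. AE \<omega> in P. T_fwer m s s' b b' a c \<omega> =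
                  first_time (\<lambda>n \<omega>. \<forall>k\<in>srcs m. loc_stat m bl k n \<omega> \<notin> {1 / a<..<c}) \<omega>)))
       \<and> (bound m < nsrc m \<and> (\<forall>k\<in>srcs m. s' k = srcs m) \<longrightarrow>
            (\<forall>P\<in>fam_Psi m.
               asymp_optimal m (\<lambda>\<gamma> \<delta>. T_fwer m s s' b b' (A \<gamma> \<delta>) (B \<gamma> \<delta>)) P \<and>
               (\<forall>a>1. \<forall>c>1. AE \<omega> in P. T_fwer m s s' b b' a c \<omega> =
                  Min {time0 m bl a \<omega>, time1 m bl a c \<omega>, time2 m bl a c \<omega>,
                       time3 m bl a c \<omega>, time4 m bl a c \<omega>})))"
proof -
  interpret model_setting m using assms(1-6) by unfold_locales
  have opt: "asymp_optimal m (\<lambda>\<gamma> \<delta>. T_fwer m s s' b b' (A \<gamma> \<delta>) (B \<gamma> \<delta>)) P" if P: "P \<in> fam_Psi m"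
    and h: "\<And>a c n \<omega>. 1 < a \<Longrightarrow> 1 < c \<Longrightarrow> regular \<omega> \<Longrightarrow> 1 \<le> n \<Longrightarrow> hit_at P a c n \<omega> \<Longrightarrow> T_fwer m s s' b b' a c \<omega> \<le> enat n" for P
  proof (rule asymp_optimal_if_hit[OF P thresholds assms(12,13)])
    fix a c :: real assume ac: "1 < a" "1 < c"
    show "AE \<omega> in P. \<forall>n\<ge>1. hit_at P a c n \<omega> \<longrightarrow> T_fwer m s s' b b' a c \<omega> \<le> enat n"
      using AE_regular[OF P] by eventually_elim (use h[OF ac] in blast)
  qed
  show ?thesis
  proof (intro conjI impI ballI allI; elim conjE)
    fix P assume u: "bound m = nsrc m" and s': "\<forall>k\<in>srcs m. s' k = {k}" and P: "P \<in> fam_Psi m"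
    show "asymp_optimal m (\<lambda>\<gamma> \<delta>. T_fwer m s s' b b' (A \<gamma> \<delta>) (B \<gamma> \<delta>)) P"
    proof (rule opt[OF P])
      fix a c n \<omega> assume ac: "1 < a" "1 < (c::real)" and g: "regular \<omega>" "1 \<le> n" and h: "hit_at P a c n \<omega>"
      show "T_fwer m s s' b b' a c \<omega> \<le> enat n"
      proof (rule T_fwer_hit_local[OF g s base_det s' base_iso u ac])
        fix k assume k: "k \<in> srcs m"
        show "c \<le> Lam k n \<omega> \<or> Lam k n \<omega> \<le> 1 / a"
        proof (cases "k \<in> active m P")
          case True
          then show ?thesis using h by (simp add: hit_at_def)
        next
          case False
          then have "active m P \<subset> srcs m" using k active_sub[OF P] by auto
          then have "card (active m P) < bound m" unfolding u card_S[symmetric] by (intro psubset_card_mono) auto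
          then show ?thesis using h False k by (simp add: hit_at_def)
        qed
      qed
    qed
    fix a c :: real assume ac: "1 < a" "1 < c"
    show "AE \<omega> in P. T_fwer m s s' b b' a c \<omega> = first_time (\<lambda>n \<omega>. \<forall>k\<in>srcs m. loc_stat m bl k n \<omega> \<notin> {1 / a<..<c}) \<omega>"
      using AE_regular[OF P]
    proof eventually_elim
      case (elim \<omega>)
      have "first_time (\<lambda>n \<omega>. \<forall>k\<in>srcs m. loc_stat m bl k n \<omega> \<notin> {1 / a<..<c}) \<omega> =
        first_time (\<lambda>n \<omega>. \<forall>k\<in>srcs m. Lam k n \<omega> \<notin> {1 / a<..<c}) \<omega>"
        by (rule first_time_cong) (use loc_stat_base[OF elim, where b=bl] base_loc in simp)
      then show ?case using T_fwer_eq_local[OF elim s base_det s' base_iso u ac] by simp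
    qed
  next
    fix P assume u: "bound m < nsrc m" and s': "\<forall>k\<in>srcs m. s' k = srcs m" and P: "P \<in> fam_Psi m"
    show "asymp_optimal m (\<lambda>\<gamma> \<delta>. T_fwer m s s' b b' (A \<gamma> \<delta>) (B \<gamma> \<delta>)) P"
    proof (rule opt[OF P])
      fix a c n \<omega> assume ac: "1 < a" "1 < (c::real)" and g: "regular \<omega>" "1 \<le> n" and h: "hit_at P a c n \<omega>"
      show "T_fwer m s s' b b' a c \<omega> \<le> enat n"
      proof (cases "active m P = {}")
        case True
        then show ?thesis
          by (intro T_fwer_hit_null[OF g s base_det]) (use h bound_pos in \<open>simp add: hit_at_def\<close>)
      next
        case False
        show ?thesis
          by (rule T_fwer_hit_full[OF g s base_det s' base_iso base_loc u ac active_sub[OF P] False])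
             (use active_Psi[OF P] h in \<open>auto simp: Psi_def hit_at_def\<close>)
      qed
    qed
    fix a c :: real assume ac: "1 < a" "1 < c"
    show "AE \<omega> in P. T_fwer m s s' b b' a c \<omega> =
                  Min {time0 m bl a \<omega>, time1 m bl a c \<omega>, time2 m bl a c \<omega>,
                       time3 m bl a c \<omega>, time4 m bl a c \<omega>}"
      using AE_regular[OF P] by eventually_elim (rule T_fwer_eq_Min_times[OF _ s base_det s' base_iso base_loc u ac])
  qed
qed

end
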